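(* Let $M$ be a smooth $5$-manifold and $\mathcal H\subset TM$ a generic rank two distribution. For any generalized contact form $\alpha$ for $\mathcal H$, the map $g_\alpha$ defined by $$g_\alpha(\zeta,\zeta')=d\alpha(\zeta_1,\pi_{-1}(\zeta'))-\tfrac43\alpha(\zeta)\alpha(\zeta')+d\alpha(\zeta'_1,\pi_{-1}(\zeta))$$ is a pseudo-Riemannian metric of signature $(2,3)$ on $M$.
   Context: **Generic distributions.** A rank two distribution $\mathcal H$ on a smooth $5$-manifold $M$ is generic if at each $x\in M$ the values of linear combinations of iterated Lie brackets of at most three sections of $\mathcal H$ span $T_xM$. Put $T^{-1}M=\mathcal H$; let $T^{-2}M=[\mathcal H,\mathcal H]$ be the rank $3$ subbundle spanned by sections of $\mathcal H$ and their Lie brackets; $T^{-3}M=TM$. Let $\mathrm{gr}_{-2}(TM)=T^{-2}M/T^{-1}M$, $\mathrm{gr}_{-3}(TM)=TM/T^{-2}M$, with quotient maps $q_{-2}:T^{-2}M\to\mathrm{gr}_{-2}(TM)$ and $q_{-3}:TM\to\mathrm{gr}_{-3}(TM)$. The Levi bracket is the skew-symmetric bundle map $\{\ ,\ \}$ given by $\{\xi,\eta\}=q_{-2}([\xi,\eta])$ for $\xi,\eta\in\Gamma(T^{-1}M)$ and $\{\xi,q_{-2}(\zeta)\}=-\{q_{-2}(\zeta),\xi\}=q_{-3}([\xi,\zeta])$ for $\xi\in\Gamma(T^{-1}M)$, $\zeta\in\Gamma(T^{-2}M)$. It induces isomorphisms $\Lambda^2T^{-1}M\cong\mathrm{gr}_{-2}(TM)$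 and $T^{-1}M\otimes\mathrm{gr}_{-2}(TM)\cong\mathrm{gr}_{-3}(TM)$. **Generalized contact form.** A smooth section $\alpha$ of $(T^{-2}M)^*$ such that $\ker\alpha(x)=T^{-1}_xM$ for all $x\in M$. **Partial connection determined by $r$.** If $r\in\Gamma(T^{-2}M)$ is such that $\varphi=q_{-2}(r)$ is nowhere vanishing, then for $\xi,\eta\in\Gamma(T^{-1}M)$ let $\nabla_\xi\eta\in\Gamma(T^{-1}M)$ be the unique section with $\{\nabla_\xi\eta,\varphi\}=q_{-3}([\xi,[\eta,r]])$. It induces a partial connection on $\mathrm{gr}_{-2}(TM)$ by $\nabla_\gamma\{\xi,\eta\}=\{\nabla_\gamma\xi,\eta\}+\{\xi,\nabla_\gamma\eta\}$. **Generalized Reeb field of $\alpha$.** The unique $r\in\Gamma(T^{-2}M)$ with $\alpha(r)=1$ such that $q_{-2}(r)$ is parallel for the partial connection $\nabla$ on $\mathrm{gr}_{-2}(TM)$ determined by $r$. From now on $r$ and $\nabla$ are these. **Canonical extension.** $\alpha$ extends uniquely to a one-form on $M$, again denoted $\alpha$, such that $d\alpha(r,\xi)=0$ for all $\xi\in T^{-1}M$. **Decomposition.** Each $\zeta\in\mathfrak X(M)$ can be uniquely written as $\zeta=[r,\zeta_1]+\alpha(\zeta)r+\zeta_2$ with $\zeta_1,\zeta_2\in\Gamma(T^{-1}M)$; here $\zeta_1$ is characterized by $q_{-3}(\zeta)=\{q_{-2}(r),\zeta_1\}$. **Operators $\Phi,\Psi:\Gamma(T^{-1}M)\to\Gamma(T^{-1}M)$.**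 They are determined by $$\nabla_\xi\nabla_\eta\gamma-\nabla_\eta\nabla_\xi\gamma-\nabla_{[\xi,\eta]-\alpha([\xi,\eta])r}\gamma=\alpha([\xi,\eta])\Phi(\gamma),\qquad \{\Psi(\gamma),q_{-2}(r)\}=\tfrac12 q_{-3}([r,[\gamma,r]])$$ for $\xi,\eta,\gamma\in\Gamma(T^{-1}M)$. Both satisfy $A(h\gamma)=hA(\gamma)+(r\cdot h)\gamma$ for $h\in C^\infty(M,\mathbb R)$. **Projection.** $\pi_{-1}:TM\to T^{-1}M$, $\pi_{-1}(\zeta)=-\tfrac25\Phi(\zeta_1)+\tfrac75\Psi(\zeta_1)+\zeta_2$ (this is $C^\infty$-linear, hence a bundle map). Signature $(2,3)$ means two positive and three negative directions. *)

theory Defs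
  imports "HOL-Analysis.Analysis" "HOL-Library.Function_Algebras" "HOL-Library.Set_Algebras"
begin

section \<open>Functions into a real vector space\<close>

text \<open>
  With the pointwise structure, functions on the manifold, tangent vectors and vector fields
  all live in instances of \<^class>\<open>real_vector\<close>, so that the library's \<^const>\<open>span\<close>,
  \<^const>\<open>independent\<close> etc. apply to them.
\<close>

instantiation "fun" :: (type, real_vector) real_vector
begin

definition scaleR_fun :: "real \<Rightarrow> ('a \<Rightarrow> 'b) \<Rightarrow> 'a \<Rightarrow> 'b"
  where "scaleR_fun c f = (\<lambda>x. c *\<^sub>R f x)"

instance
  by standard (auto simp: scaleR_fun_def fun_eq_iff algebra_simps)

end

definition linear_over :: "'v::real_vector set \<Rightarrow> ('v \<Rightarrow> 'w::real_vector) \<Rightarrow> bool" where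
  "linear_over S f \<longleftrightarrow> (\<forall>x\<in>S. \<forall>y\<in>S. \<forall>a b. f (a *\<^sub>R x + b *\<^sub>R y) = a *\<^sub>R f x + b *\<^sub>R f y)"


section \<open>Smooth manifolds\<close>

text \<open>\<open>C_k_on k S f\<close>: \<open>f\<close> is \<open>k\<close> times continuously differentiable on \<open>S\<close> (meant for open \<open>S\<close>).\<close>

primrec C_k_on ::
  "nat \<Rightarrow> 'e::euclidean_space set \<Rightarrow> ('e \<Rightarrow> 'f::real_normed_vector) \<Rightarrow> bool" where
  "C_k_on 0 S f \<longleftrightarrow> continuous_on S f"
| "C_k_on (Suc k) S f \<longleftrightarrow>
     (\<forall>x\<in>S. f differentiable at x) \<and>
     (\<forall>v. C_k_on k S (\<lambda>x. frechet_derivative f (at x) v))"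

definition smooth_on ::
  "'e::euclidean_space set \<Rightarrow> ('e \<Rightarrow> 'f::real_normed_vector) \<Rightarrow> bool" where
  "smooth_on S f \<longleftrightarrow> (\<forall>k. C_k_on k S f)"

text \<open>
  A chart is a pair of its domain and its coordinate map; values of the coordinate map outside
  the domain are irrelevant. The underlying topological manifold is the type \<open>'a\<close>, and the
  Hausdorff and second countability axioms are imposed as sort constraints on \<open>'a\<close>.
\<close>

type_synonym ('a, 'e) chart = "'a set \<times> ('a \<Rightarrow> 'e)"

definition smooth_atlas ::
  "('a::topological_space, 'e::euclidean_space) chart set \<Rightarrow> bool" where
  "smooth_atlas A \<longleftrightarrow>
     (\<forall>(U, \<phi>)\<in>A. open U \<and> open (\<phi> ` U) \<and> (\<exists>\<psi>. homeomorphism U (\<phi> ` U) \<phi> \<psi>)) \<and>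
     (\<Union>(U, \<phi>)\<in>A. U) = UNIV \<and>
     (\<forall>(U, \<phi>)\<in>A. \<forall>(V, \<psi>)\<in>A. smooth_on (\<phi> ` (U \<inter> V)) (\<psi> \<circ> the_inv_into U \<phi>))"

definition smooth_fun_on ::
  "('a::topological_space, 'e::euclidean_space) chart set \<Rightarrow> 'a set \<Rightarrow> ('a \<Rightarrow> real) \<Rightarrow> bool" where
  "smooth_fun_on A W f \<longleftrightarrow>
     (\<forall>(U, \<phi>)\<in>A. smooth_on (\<phi> ` (U \<inter> W)) (f \<circ> the_inv_into U \<phi>))"

definition smooth_funs ::
  "('a::topological_space, 'e::euclidean_space) chart set \<Rightarrow> ('a \<Rightarrow> real) set" where
  "smooth_funs A = {f. smooth_fun_on A UNIV f}"

text \<open>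
  Tangent vectors are derivations of the algebra of smooth functions. They are extended by zero
  to all functions, so that two tangent vectors are equal iff they agree on smooth functions.
\<close>

type_synonym 'a tvec = "('a \<Rightarrow> real) \<Rightarrow> real"
type_synonym 'a vfield = "'a \<Rightarrow> 'a tvec"

definition tangent_space ::
  "('a::topological_space, 'e::euclidean_space) chart set \<Rightarrow> 'a \<Rightarrow> 'a tvec set" where
  "tangent_space A p = {v.
     linear_over (smooth_funs A) v \<and>
     (\<forall>f\<in>smooth_funs A. \<forall>g\<in>smooth_funs A. v (\<lambda>x. f x * g x) = f p * v g + g p * v f) \<and>
     (\<forall>f. f \<notin> smooth_funs A \<longrightarrow> v f = 0)}"

definition vector_fields_on ::
  "('a::topological_space, 'e::euclidean_space) chart set \<Rightarrow> 'a set \<Rightarrow> 'a vfield set" where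
  "vector_fields_on A W = {X.
     (\<forall>p\<in>W. X p \<in> tangent_space A p) \<and>
     (\<forall>f\<in>smooth_funs A. smooth_fun_on A W (\<lambda>p. X p f))}"

abbreviation vector_fields ::
  "('a::topological_space, 'e::euclidean_space) chart set \<Rightarrow> 'a vfield set" where
  "vector_fields A \<equiv> vector_fields_on A UNIV"

definition fscale :: "('a \<Rightarrow> real) \<Rightarrow> 'a vfield \<Rightarrow> 'a vfield" where
  "fscale h X = (\<lambda>p. h p *\<^sub>R X p)"

definition lie_bracket :: "'a vfield \<Rightarrow> 'a vfield \<Rightarrow> 'a vfield" where
  "lie_bracket X Y = (\<lambda>p f. X p (\<lambda>q. Y q f) - Y p (\<lambda>q. X q f))"


section \<open>One-forms and pseudo-Riemannian metrics\<close>

definition one_forms ::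
  "('a::topological_space, 'e::euclidean_space) chart set \<Rightarrow> ('a \<Rightarrow> 'a tvec \<Rightarrow> real) set" where
  "one_forms A = {\<omega>.
     (\<forall>p. linear_over (tangent_space A p) (\<omega> p) \<and> (\<forall>v. v \<notin> tangent_space A p \<longrightarrow> \<omega> p v = 0)) \<and>
     (\<forall>X\<in>vector_fields A. (\<lambda>p. \<omega> p (X p)) \<in> smooth_funs A)}"

definition ext_deriv ::
  "('a \<Rightarrow> 'a tvec \<Rightarrow> real) \<Rightarrow> 'a vfield \<Rightarrow> 'a vfield \<Rightarrow> 'a \<Rightarrow> real" where
  "ext_deriv \<omega> X Y = (\<lambda>p.
     X p (\<lambda>q. \<omega> q (Y q)) - Y p (\<lambda>q. \<omega> q (X q)) - \<omega> p (lie_bracket X Y p))"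

definition orthonormal_basis ::
  "'v::real_vector set \<Rightarrow> ('v \<Rightarrow> 'v \<Rightarrow> real) \<Rightarrow> nat \<Rightarrow> nat \<Rightarrow> (nat \<Rightarrow> 'v) \<Rightarrow> bool" where
  "orthonormal_basis V b m n e \<longleftrightarrow>
     inj_on e {..<m+n} \<and> independent (e ` {..<m+n}) \<and> span (e ` {..<m+n}) = V \<and>
     (\<forall>i<m+n. \<forall>j<m+n. b (e i) (e j) = (if i \<noteq> j then 0 else if i < m then 1 else -1))"

definition metric_tensor ::
  "('a::topological_space, 'e::euclidean_space) chart set \<Rightarrow> nat \<Rightarrow> nat
    \<Rightarrow> ('a \<Rightarrow> 'a tvec \<Rightarrow> 'a tvec \<Rightarrow> real) \<Rightarrow> bool" where
  "metric_tensor A m n G \<longleftrightarrow>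
     (\<forall>p. \<forall>v\<in>tangent_space A p.
        linear_over (tangent_space A p) (G p v) \<and>
        (\<forall>w\<in>tangent_space A p. G p v w = G p w v) \<and>
        (v \<noteq> 0 \<longrightarrow> (\<exists>w\<in>tangent_space A p. G p v w \<noteq> 0))) \<and>
     (\<forall>X\<in>vector_fields A. \<forall>Y\<in>vector_fields A. (\<lambda>p. G p (X p) (Y p)) \<in> smooth_funs A) \<and>
     (\<forall>p. \<exists>e. orthonormal_basis (tangent_space A p) (G p) m n e)"

text \<open>
  A map \<open>g\<close> defined on vector fields is a pseudo-Riemannian metric of signature \<open>(m, n)\<close>
  (\<open>m\<close> positive, \<open>n\<close> negative directions) if it is evaluation of such a metric tensor.
\<close>

definition pseudo_riemannian_metric ::
  "('a::topological_space, 'e::euclidean_space) chart set \<Rightarrow> nat \<Rightarrow> nat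
    \<Rightarrow> ('a vfield \<Rightarrow> 'a vfield \<Rightarrow> 'a \<Rightarrow> real) \<Rightarrow> bool" where
  "pseudo_riemannian_metric A m n g \<longleftrightarrow>
     (\<exists>G. metric_tensor A m n G \<and>
       (\<forall>X\<in>vector_fields A. \<forall>Y\<in>vector_fields A. g X Y = (\<lambda>p. G p (X p) (Y p))))"


section \<open>Generic rank two distributions\<close>

definition distribution ::
  "('a::topological_space, 'e::euclidean_space) chart set \<Rightarrow> nat \<Rightarrow> ('a \<Rightarrow> 'a tvec set) \<Rightarrow> bool" where
  "distribution A k E \<longleftrightarrow>
     (\<forall>p. \<exists>U X. open U \<and> p \<in> U \<and> (\<forall>i<k. X i \<in> vector_fields_on A U) \<and>
       (\<forall>q\<in>U. inj_on (\<lambda>i. X i q) {..<k} \<and> independent ((\<lambda>i. X i q) ` {..<k}) \<and>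
              E q = span ((\<lambda>i. X i q) ` {..<k})))"

definition sections ::
  "('a::topological_space, 'e::euclidean_space) chart set \<Rightarrow> ('a \<Rightarrow> 'a tvec set) \<Rightarrow> 'a vfield set" where
  "sections A E = {X \<in> vector_fields A. \<forall>p. X p \<in> E p}"

text \<open>By skew-symmetry, \<open>[[\<xi>, \<eta>], \<zeta>]\<close> need not be listed separately.\<close>

definition generic_distribution ::
  "('a::topological_space, 'e::euclidean_space) chart set \<Rightarrow> ('a \<Rightarrow> 'a tvec set) \<Rightarrow> bool" where
  "generic_distribution A H \<longleftrightarrow> distribution A 2 H \<and>
     (\<forall>p. tangent_space A p = span (
        {\<xi> p |\<xi>. \<xi> \<in> sections A H} \<union>
        {lie_bracket \<xi> \<eta> p |\<xi> \<eta>. \<xi> \<in> sections A H \<and> \<eta> \<in> sections A H} \<union>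
        {lie_bracket \<xi> (lie_bracket \<eta> \<zeta>) p |\<xi> \<eta> \<zeta>.
           \<xi> \<in> sections A H \<and> \<eta> \<in> sections A H \<and> \<zeta> \<in> sections A H}))"

definition T2 ::
  "('a::topological_space, 'e::euclidean_space) chart set \<Rightarrow> ('a \<Rightarrow> 'a tvec set) \<Rightarrow> 'a \<Rightarrow> 'a tvec set" where
  "T2 A H p = span (
     {\<xi> p |\<xi>. \<xi> \<in> sections A H} \<union>
     {lie_bracket \<xi> \<eta> p |\<xi> \<eta>. \<xi> \<in> sections A H \<and> \<eta> \<in> sections A H})"

text \<open>
  Sections of the quotient bundles are functions assigning to each point a coset: \<open>gr_-2\<close> is
  \<open>T2\<close> modulo \<open>H\<close> and \<open>gr_-3\<close> is the tangent bundle modulo \<open>T2\<close>. The sum of cosets is the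
  elementwise sum of sets, and the zero section of \<open>gr_-2\<close> is \<open>H\<close>.
\<close>

type_synonym 'a gr_section = "'a \<Rightarrow> 'a tvec set"

definition q2 :: "('a \<Rightarrow> 'a tvec set) \<Rightarrow> 'a vfield \<Rightarrow> 'a gr_section" where
  "q2 H \<zeta> = (\<lambda>p. \<zeta> p +o H p)"

definition q3 ::
  "('a::topological_space, 'e::euclidean_space) chart set \<Rightarrow> ('a \<Rightarrow> 'a tvec set)
    \<Rightarrow> 'a vfield \<Rightarrow> 'a gr_section" where
  "q3 A H \<zeta> = (\<lambda>p. \<zeta> p +o T2 A H p)"

text \<open>The two components of the Levi bracket, on \<open>H \<times> H\<close> and on \<open>H \<times> gr_-2\<close>.\<close>

definition levi1 :: "('a \<Rightarrow> 'a tvec set) \<Rightarrow> 'a vfield \<Rightarrow> 'a vfield \<Rightarrow> 'a gr_section" where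
  "levi1 H \<xi> \<eta> = q2 H (lie_bracket \<xi> \<eta>)"

definition levi2 ::
  "('a::topological_space, 'e::euclidean_space) chart set \<Rightarrow> ('a \<Rightarrow> 'a tvec set)
    \<Rightarrow> 'a vfield \<Rightarrow> 'a gr_section \<Rightarrow> 'a gr_section" where
  "levi2 A H \<xi> \<sigma> =
     (THE \<tau>. \<exists>\<zeta>\<in>sections A (T2 A H). q2 H \<zeta> = \<sigma> \<and> \<tau> = q3 A H (lie_bracket \<xi> \<zeta>))"


section \<open>Objects determined by a generalized contact form\<close>

text \<open>Values of \<open>\<alpha> p\<close> outside \<open>T2 A H p\<close> are irrelevant.\<close>

definition generalized_contact_form ::
  "('a::topological_space, 'e::euclidean_space) chart set \<Rightarrow> ('a \<Rightarrow> 'a tvec set)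
    \<Rightarrow> ('a \<Rightarrow> 'a tvec \<Rightarrow> real) \<Rightarrow> bool" where
  "generalized_contact_form A H \<alpha> \<longleftrightarrow>
     (\<forall>p. linear_over (T2 A H p) (\<alpha> p)) \<and>
     (\<forall>\<zeta>\<in>sections A (T2 A H). (\<lambda>p. \<alpha> p (\<zeta> p)) \<in> smooth_funs A) \<and>
     (\<forall>p. {v \<in> T2 A H p. \<alpha> p v = 0} = H p)"

definition nabla ::
  "('a::topological_space, 'e::euclidean_space) chart set \<Rightarrow> ('a \<Rightarrow> 'a tvec set) \<Rightarrow> 'a vfield
    \<Rightarrow> 'a vfield \<Rightarrow> 'a vfield \<Rightarrow> 'a vfield" where
  "nabla A H r \<xi> \<eta> = (THE \<zeta>. \<zeta> \<in> sections A H \<and>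
     levi2 A H \<zeta> (q2 H r) = q3 A H (lie_bracket \<xi> (lie_bracket \<eta> r)))"

text \<open>
  A partial connection is a local operator, and near each point every section of \<open>gr_-2\<close> is
  of the form \<open>{\<xi>, \<eta>}\<close>. The induced partial connection is therefore given at each point by the
  formula \<open>\<nabla>\<^sub>\<gamma>{\<xi>, \<eta>} = {\<nabla>\<^sub>\<gamma>\<xi>, \<eta>} + {\<xi>, \<nabla>\<^sub>\<gamma>\<eta>}\<close>, applied to any such local representation.
\<close>

definition nabla_gr ::
  "('a::topological_space, 'e::euclidean_space) chart set \<Rightarrow> ('a \<Rightarrow> 'a tvec set) \<Rightarrow> 'a vfield
    \<Rightarrow> 'a vfield \<Rightarrow> 'a gr_section \<Rightarrow> 'a gr_section" where
  "nabla_gr A H r \<gamma> \<sigma> = (\<lambda>p. THE C.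
     \<exists>\<xi>\<in>sections A H. \<exists>\<eta>\<in>sections A H. \<exists>U. open U \<and> p \<in> U \<and>
       (\<forall>q\<in>U. \<sigma> q = levi1 H \<xi> \<eta> q) \<and>
       C = levi1 H (nabla A H r \<gamma> \<xi>) \<eta> p + levi1 H \<xi> (nabla A H r \<gamma> \<eta>) p)"

definition reeb ::
  "('a::topological_space, 'e::euclidean_space) chart set \<Rightarrow> ('a \<Rightarrow> 'a tvec set)
    \<Rightarrow> ('a \<Rightarrow> 'a tvec \<Rightarrow> real) \<Rightarrow> 'a vfield" where
  "reeb A H \<alpha> = (THE r. r \<in> sections A (T2 A H) \<and> (\<forall>p. \<alpha> p (r p) = 1) \<and>
     (\<forall>\<gamma>\<in>sections A H. nabla_gr A H r \<gamma> (q2 H r) = H))"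

definition canonical_extension ::
  "('a::topological_space, 'e::euclidean_space) chart set \<Rightarrow> ('a \<Rightarrow> 'a tvec set)
    \<Rightarrow> ('a \<Rightarrow> 'a tvec \<Rightarrow> real) \<Rightarrow> 'a \<Rightarrow> 'a tvec \<Rightarrow> real" where
  "canonical_extension A H \<alpha> = (THE \<omega>. \<omega> \<in> one_forms A \<and>
     (\<forall>p. \<forall>v\<in>T2 A H p. \<omega> p v = \<alpha> p v) \<and>
     (\<forall>\<xi>\<in>sections A H. ext_deriv \<omega> (reeb A H \<alpha>) \<xi> = (\<lambda>p. 0)))"

definition alpha_eval ::
  "('a::topological_space, 'e::euclidean_space) chart set \<Rightarrow> ('a \<Rightarrow> 'a tvec set)
    \<Rightarrow> ('a \<Rightarrow> 'a tvec \<Rightarrow> real) \<Rightarrow> 'a vfield \<Rightarrow> 'a \<Rightarrow> real" where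
  "alpha_eval A H \<alpha> \<zeta> = (\<lambda>p. canonical_extension A H \<alpha> p (\<zeta> p))"

definition decomposition ::
  "('a::topological_space, 'e::euclidean_space) chart set \<Rightarrow> ('a \<Rightarrow> 'a tvec set)
    \<Rightarrow> ('a \<Rightarrow> 'a tvec \<Rightarrow> real) \<Rightarrow> 'a vfield \<Rightarrow> 'a vfield \<times> 'a vfield" where
  "decomposition A H \<alpha> \<zeta> = (THE (\<zeta>1, \<zeta>2). \<zeta>1 \<in> sections A H \<and> \<zeta>2 \<in> sections A H \<and>
     \<zeta> = lie_bracket (reeb A H \<alpha>) \<zeta>1 + fscale (alpha_eval A H \<alpha> \<zeta>) (reeb A H \<alpha>) + \<zeta>2)"

definition Phi ::
  "('a::topological_space, 'e::euclidean_space) chart set \<Rightarrow> ('a \<Rightarrow> 'a tvec set)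
    \<Rightarrow> ('a \<Rightarrow> 'a tvec \<Rightarrow> real) \<Rightarrow> 'a vfield \<Rightarrow> 'a vfield" where
  "Phi A H \<alpha> \<gamma> =
     (let r = reeb A H \<alpha>; D = nabla A H r in
      THE \<delta>. \<delta> \<in> sections A H \<and>
        (\<forall>\<xi>\<in>sections A H. \<forall>\<eta>\<in>sections A H.
           let B = lie_bracket \<xi> \<eta>; a = alpha_eval A H \<alpha> B in
           D \<xi> (D \<eta> \<gamma>) - D \<eta> (D \<xi> \<gamma>) - D (B - fscale a r) \<gamma> = fscale a \<delta>))"

definition Psi ::
  "('a::topological_space, 'e::euclidean_space) chart set \<Rightarrow> ('a \<Rightarrow> 'a tvec set)
    \<Rightarrow> ('a \<Rightarrow> 'a tvec \<Rightarrow> real) \<Rightarrow> 'a vfield \<Rightarrow> 'a vfield" where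
  "Psi A H \<alpha> \<gamma> =
     (let r = reeb A H \<alpha> in
      THE \<delta>. \<delta> \<in> sections A H \<and>
        levi2 A H \<delta> (q2 H r) = q3 A H ((1/2) *\<^sub>R lie_bracket r (lie_bracket \<gamma> r)))"

definition proj1 ::
  "('a::topological_space, 'e::euclidean_space) chart set \<Rightarrow> ('a \<Rightarrow> 'a tvec set)
    \<Rightarrow> ('a \<Rightarrow> 'a tvec \<Rightarrow> real) \<Rightarrow> 'a vfield \<Rightarrow> 'a vfield" where
  "proj1 A H \<alpha> \<zeta> =
     (let (\<zeta>1, \<zeta>2) = decomposition A H \<alpha> \<zeta> in
      (- 2/5) *\<^sub>R Phi A H \<alpha> \<zeta>1 + (7/5) *\<^sub>R Psi A H \<alpha> \<zeta>1 + \<zeta>2)"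

definition g_alpha ::
  "('a::topological_space, 'e::euclidean_space) chart set \<Rightarrow> ('a \<Rightarrow> 'a tvec set)
    \<Rightarrow> ('a \<Rightarrow> 'a tvec \<Rightarrow> real) \<Rightarrow> 'a vfield \<Rightarrow> 'a vfield \<Rightarrow> 'a \<Rightarrow> real" where
  "g_alpha A H \<alpha> \<zeta> \<zeta>' =
     (let \<omega> = canonical_extension A H \<alpha>;
          \<zeta>1 = fst (decomposition A H \<alpha> \<zeta>);
          \<zeta>1' = fst (decomposition A H \<alpha> \<zeta>')
      in (\<lambda>p. ext_deriv \<omega> \<zeta>1 (proj1 A H \<alpha> \<zeta>') p
              - 4/3 * \<omega> p (\<zeta> p) * \<omega> p (\<zeta>' p)
              + ext_deriv \<omega> \<zeta>1' (proj1 A H \<alpha> \<zeta>) p))"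

end

theory Submission
  imports Defs
begin

text \<open>
  Near every point there is a frame \<open>e\<^sub>0\<close>, \<open>e\<^sub>1\<close> of \<open>H\<close> with \<open>\<alpha>([e\<^sub>0, e\<^sub>1]) = 1\<close>, and genericity together with
  the bound \<open>dim T p \<ge> 5\<close> makes \<open>e\<^sub>0\<close>, \<open>e\<^sub>1\<close>, \<open>c\<close>, \<open>[e\<^sub>0, c]\<close>, \<open>[e\<^sub>1, c]\<close> a frame of the tangent bundle for any
  section \<open>c\<close> of \<open>T2\<close> with \<open>\<alpha>(c) = 1\<close>. In such a frame the Reeb condition is the vanishing of the trace of a
  connection form; it determines the components of \<open>r\<close> pointwise, so that local solutions glue.

  Of \<open>\<Phi>\<close> and \<open>\<Psi>\<close> only the rule \<open>A(h \<gamma>) = h A(\<gamma>) + (r h) \<gamma>\<close> matters. It makes \<open>\<pi>\<^sub>-\<^sub>1\<close> tensorial, and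
  \<open>\<zeta> \<mapsto> (\<zeta>\<^sub>1, \<alpha>(\<zeta>), \<pi>\<^sub>-\<^sub>1(\<zeta>))\<close> identifies the tangent space with \<open>H \<oplus> \<real> \<oplus> H\<close>. Since \<open>d\<alpha>\<close> restricts
  to minus the symplectic form \<open>\<sigma>(\<xi>, \<eta>) = \<alpha>([\<xi>, \<eta>])\<close> on \<open>H\<close>, the metric becomes
  \<open>- \<sigma>(\<xi>, \<eta>') - \<sigma>(\<xi>', \<eta>) - 4/3 s s'\<close>, the sum of a neutral form on \<open>H \<oplus> H\<close> and a negative line.
\<close>

section \<open>Smooth functions on Euclidean space\<close>

text \<open>The objects of the theorem are definite descriptions over global smooth sections,
  whereas frames exist only near a point and tangent vectors act on global functions. Each
  description therefore needs a global witness. One pattern recurs: a condition that turns out to be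
  tensorial is imposed at a single point, a formula in an arbitrary frame shows that it determines a
  value there and that these values vary smoothly, and the pointwise solutions together form the
  witness. Bump functions make this possible: a local frame is represented by global fields that
  form a frame only near the given point, so statements hold eventually in \<open>nhds p\<close>.

  That the Reeb condition determines \<open>r\<close> rests on one computation. Adding
  \<open>a e\<^sub>0 + b e\<^sub>1\<close> to a normalized section shifts the trace along \<gamma>
  by \<open>b \<theta>\<^sub>0(\<gamma>) - a \<theta>\<^sub>1(\<gamma>)\<close>. No derivatives of
  \<open>a\<close> and \<open>b\<close> occur, and the shift is nondegenerate because the Levi form
  is; the equation is algebraic, not differential.\<close>

lemma C_k_on_SucI:
  fixes f :: "'e::euclidean_space \<Rightarrow> 'f::real_normed_vector"
  assumes S: "open S" and d: "\<And>x. x \<in> S \<Longrightarrow> (f has_derivative f' x) (at x)"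
    and c: "\<And>v. C_k_on k S (\<lambda>x. f' x v)"
    and cong: "\<And>g h :: 'e \<Rightarrow> 'f. \<lbrakk>\<And>x. x \<in> S \<Longrightarrow> g x = h x; C_k_on k S g\<rbrakk> \<Longrightarrow> C_k_on k S h"
  shows "C_k_on (Suc k) S f"
proof -
  have "f differentiable at x" if "x \<in> S" for x
    using d[OF that] differentiableI by blast
  moreover have "C_k_on k S (\<lambda>x. frechet_derivative f (at x) v)" for v
  proof (rule cong[of "\<lambda>x. f' x v"])
    show "f' x v = frechet_derivative f (at x) v" if "x \<in> S" for x
      using frechet_derivative_at[OF d[OF that]] by simp
  qed (rule c)
  ultimately show ?thesis by simp
qed

lemma C_k_on_cong:
  assumes "open S" "\<And>x. x \<in> S \<Longrightarrow> f x = g x" "C_k_on k S f"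
  shows "C_k_on k S g"
  using assms(2,3)
proof (induction k arbitrary: f g)
  case 0
  then show ?case using continuous_on_cong by (metis C_k_on.simps(1))
next
  case (Suc k)
  show ?case
  proof (rule C_k_on_SucI[OF \<open>open S\<close>])
    fix x assume "x \<in> S"
    then have "(f has_derivative frechet_derivative f (at x)) (at x)"
      using Suc.prems(2) frechet_derivative_works by auto
    then show "(g has_derivative frechet_derivative f (at x)) (at x)"
      using has_derivative_transform_within_open[OF _ \<open>open S\<close> \<open>x \<in> S\<close>] Suc.prems(1) by blast
  next
    show "C_k_on k S (\<lambda>x. frechet_derivative f (at x) v)" for v
      using Suc.prems(2) by simp
  qed (use Suc.IH in blast)
qed

text \<open>\<open>C_k_on\<close> speaks of the chosen function \<open>frechet_derivative\<close>,
  so a derivative known by a formula has to be exchanged for it on \<open>S\<close>. The exchange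
  needs congruence, whose inductive proof needs the same exchange; hence \<open>C_k_on_SucI\<close>
  assumes the congruence at level \<open>k\<close>, and it is discharged here.\<close>

lemma C_k_on_Suc_intro:
  assumes "open S" "\<And>x. x \<in> S \<Longrightarrow> (f has_derivative f' x) (at x)"
    "\<And>v. C_k_on k S (\<lambda>x. f' x v)"
  shows "C_k_on (Suc k) S f"
  using C_k_on_SucI[OF assms] C_k_on_cong[OF \<open>open S\<close>] by blast

lemma C_k_on_SucD:
  assumes "C_k_on (Suc k) S f"
  shows "x \<in> S \<Longrightarrow> (f has_derivative frechet_derivative f (at x)) (at x)"
    and "C_k_on k S (\<lambda>x. frechet_derivative f (at x) v)"
  using assms frechet_derivative_works by auto

lemma C_k_on_Suc_imp: "C_k_on (Suc k) S f \<Longrightarrow> C_k_on k S f"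
proof (induction k arbitrary: f)
  case 0
  then show ?case
    by (auto simp: continuous_at_imp_continuous_on differentiable_imp_continuous_within)
next
  case (Suc k)
  then show ?case by (metis C_k_on.simps(2))
qed

lemma C_k_on_subset: "C_k_on k S f \<Longrightarrow> T \<subseteq> S \<Longrightarrow> C_k_on k T f"
  by (induction k arbitrary: f) (auto intro: continuous_on_subset)

text \<open>Derivatives in \<open>C_k_on\<close> are taken \<open>at x\<close>, not within
  \<open>S\<close>, so they see only the germ of \<open>f\<close>.\<close>

lemma C_k_on_local:
  assumes "\<And>x. x \<in> S \<Longrightarrow> \<exists>T. open T \<and> x \<in> T \<and> C_k_on k T f"
  shows "C_k_on k S f"
  using assms
proof (induction k arbitrary: f)
  case 0
  then have "isCont f x" if "x \<in> S" for x
    using that by (metis C_k_on.simps(1) continuous_on_eq_continuous_at)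
  then show ?case by (simp add: continuous_at_imp_continuous_on)
next
  case (Suc k)
  have "f differentiable at x" if "x \<in> S" for x
    using Suc.prems[OF that] by auto
  moreover have "C_k_on k S (\<lambda>x. frechet_derivative f (at x) v)" for v
    by (rule Suc.IH) (metis C_k_on.simps(2) Suc.prems)
  ultimately show ?case by simp
qed

lemma C_k_on_const:
  assumes "open S"
  shows "C_k_on k S (\<lambda>x. c)"
proof (induction k arbitrary: c)
  case (Suc k)
  then show ?case
    using C_k_on_Suc_intro[OF assms, of "\<lambda>x. c" "\<lambda>x v. 0"] by simp
qed simp

lemma C_k_on_bounded_linear:
  assumes "open S" "bounded_linear L"
  shows "C_k_on k S L"
proof (cases k)
  case 0
  then show ?thesis using assms linear_continuous_on by auto
next
  case (Suc j)
  show ?thesis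
    unfolding Suc using assms
    by (intro C_k_on_Suc_intro[where f'="\<lambda>x. L"] C_k_on_const bounded_linear_imp_has_derivative)
qed

lemma C_k_on_linear_comp:
  assumes "open S" "bounded_linear L" "C_k_on k S f"
  shows "C_k_on k S (\<lambda>x. L (f x))"
  using assms(3)
proof (induction k arbitrary: f)
  case 0
  then show ?case using bounded_linear.continuous_on[OF assms(2)] by simp
next
  case (Suc k)
  show ?case
  proof (rule C_k_on_Suc_intro[OF \<open>open S\<close>])
    show "((\<lambda>x. L (f x)) has_derivative (\<lambda>v. L (frechet_derivative f (at x) v))) (at x)" if "x \<in> S" for x
      using bounded_linear.has_derivative[OF assms(2) C_k_on_SucD(1)[OF Suc.prems that]] .
  qed (use Suc.IH[OF C_k_on_SucD(2)[OF Suc.prems]] in blast)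
qed

lemma C_k_on_add:
  assumes "open S" "C_k_on k S f" "C_k_on k S g"
  shows "C_k_on k S (\<lambda>x. f x + g x)"
  using assms(2,3)
proof (induction k arbitrary: f g)
  case 0
  then show ?case by (simp add: continuous_on_add)
next
  case (Suc k)
  show ?case
  proof (rule C_k_on_Suc_intro[OF \<open>open S\<close>])
    show "((\<lambda>x. f x + g x) has_derivative
        (\<lambda>v. frechet_derivative f (at x) v + frechet_derivative g (at x) v)) (at x)" if "x \<in> S" for x
      using that C_k_on_SucD(1) Suc.prems by (intro has_derivative_add) blast+
  qed (use Suc C_k_on_SucD(2) in blast)
qed

lemma C_k_on_sum:
  assumes "open S" "\<And>i. i \<in> I \<Longrightarrow> C_k_on k S (f i)"
  shows "C_k_on k S (\<lambda>x. \<Sum>i\<in>I. f i x)"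
  using assms(2)
  by (induction I rule: infinite_finite_induct) (auto intro: C_k_on_const C_k_on_add assms(1))

lemma C_k_on_mult:
  fixes f g :: "'e::euclidean_space \<Rightarrow> real"
  assumes "open S" "C_k_on k S f" "C_k_on k S g"
  shows "C_k_on k S (\<lambda>x. f x * g x)"
  using assms(2,3)
proof (induction k arbitrary: f g)
  case 0
  then show ?case by (simp add: continuous_on_mult)
next
  case (Suc k)
  show ?case
  proof (rule C_k_on_Suc_intro[OF \<open>open S\<close>])
    show "((\<lambda>x. f x * g x) has_derivative
        (\<lambda>v. f x * frechet_derivative g (at x) v + frechet_derivative f (at x) v * g x)) (at x)"
      if "x \<in> S" for x
      using that C_k_on_SucD(1) Suc.prems by (intro has_derivative_mult) blast+
  next
    fix v show "C_k_on k S (\<lambda>x. f x * frechet_derivative g (at x) v + frechet_derivative f (at x) v * g x)"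
      using Suc.IH C_k_on_SucD(2)[OF Suc.prems(1)] C_k_on_SucD(2)[OF Suc.prems(2)]
        C_k_on_Suc_imp[OF Suc.prems(1)] C_k_on_Suc_imp[OF Suc.prems(2)]
      by (intro C_k_on_add[OF \<open>open S\<close>]) blast+
  qed
qed

text \<open>In the chain rule the direction \<open>?Df x v\<close> fed to the derivative of
  \<open>g\<close> varies with \<open>x\<close>, whereas \<open>C_k_on\<close> controls derivatives
  in a fixed direction. Expanding the direction in \<open>Basis\<close> separates the two: the
  induction hypothesis handles each partial derivative of \<open>g\<close>, and the coefficients are
  derivatives of \<open>f\<close>.\<close>

lemma C_k_on_compose:
  fixes f :: "'e::euclidean_space \<Rightarrow> 'f::euclidean_space" and g :: "'f \<Rightarrow> real"
  assumes "open S" "open T" "f ` S \<subseteq> T" "C_k_on k S f" "C_k_on k T g"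
  shows "C_k_on k S (\<lambda>x. g (f x))"
  using assms(4,5)
proof (induction k arbitrary: g)
  case 0
  then show ?case using assms(3) continuous_on_compose2 by (metis C_k_on.simps(1))
next
  case (Suc k)
  let ?Df = "\<lambda>x. frechet_derivative f (at x)" and ?Dg = "\<lambda>y. frechet_derivative g (at y)"
  have Dg: "(g has_derivative ?Dg y) (at y)" if "y \<in> T" for y
    using C_k_on_SucD(1)[OF Suc.prems(2) that] .
  show ?case
  proof (rule C_k_on_Suc_intro[OF \<open>open S\<close>])
    fix x assume x: "x \<in> S"
    then have fx: "f x \<in> T" using assms(3) by auto
    have "((\<lambda>x. g (f x)) has_derivative (\<lambda>v. ?Dg (f x) (?Df x v))) (at x)"
      by (rule has_derivative_compose[OF C_k_on_SucD(1)[OF Suc.prems(1) x] Dg[OF fx]])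
    moreover have e: "?Dg (f x) w = (\<Sum>b\<in>Basis. (w \<bullet> b) * ?Dg (f x) b)" for w
    proof -
      have lin: "linear (?Dg (f x))" using Dg[OF fx] has_derivative_linear by blast
      have "?Dg (f x) w = ?Dg (f x) (\<Sum>b\<in>Basis. (w \<bullet> b) *\<^sub>R b)"
        by (simp add: euclidean_representation)
      then show ?thesis by (simp add: linear_sum[OF lin] linear_cmul[OF lin])
    qed
    ultimately show "((\<lambda>x. g (f x)) has_derivative (\<lambda>v. \<Sum>b\<in>Basis. (?Df x v \<bullet> b) * ?Dg (f x) b)) (at x)"
      by (subst e[symmetric])
  next
    fix v
    have "C_k_on k S (\<lambda>x. ?Dg (f x) b)" for b
      using Suc.IH[OF C_k_on_Suc_imp[OF Suc.prems(1)] C_k_on_SucD(2)[OF Suc.prems(2)]] .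
    moreover have "C_k_on k S (\<lambda>x. ?Df x v \<bullet> b)" for b
      using C_k_on_linear_comp[OF \<open>open S\<close> bounded_linear_inner_left C_k_on_SucD(2)[OF Suc.prems(1)]] .
    ultimately show "C_k_on k S (\<lambda>x. \<Sum>b\<in>Basis. (?Df x v \<bullet> b) * ?Dg (f x) b)"
      by (intro C_k_on_sum C_k_on_mult assms(1))
  qed
qed

lemma C_k_on_inverse:
  fixes f :: "'e::euclidean_space \<Rightarrow> real"
  assumes "open S" "\<And>x. x \<in> S \<Longrightarrow> f x \<noteq> 0" "C_k_on k S f"
  shows "C_k_on k S (\<lambda>x. inverse (f x))"
  using assms(3)
proof (induction k)
  case 0
  then show ?case using assms(2) by (simp add: continuous_on_inverse)
next
  case (Suc k)
  have i: "C_k_on k S (\<lambda>x. inverse (f x))"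
    using Suc C_k_on_Suc_imp by blast
  show ?case
  proof (rule C_k_on_Suc_intro[OF \<open>open S\<close>])
    show "((\<lambda>x. inverse (f x)) has_derivative
        (\<lambda>v. - (inverse (f x) * frechet_derivative f (at x) v * inverse (f x)))) (at x)" if "x \<in> S" for x
      using Deriv.has_derivative_inverse[OF assms(2) C_k_on_SucD(1)[OF Suc.prems]] that by blast
    show "C_k_on k S (\<lambda>x. - (inverse (f x) * frechet_derivative f (at x) v * inverse (f x)))" for v
      using i C_k_on_SucD(2)[OF Suc.prems]
      by (intro C_k_on_linear_comp[OF \<open>open S\<close> bounded_linear_minus[OF bounded_linear_ident]]
          C_k_on_mult[OF \<open>open S\<close>])
  qed
qed

section \<open>The flat function exp(-1/t) and smooth bump functions\<close>

lemma exp_minus_inverse_power_tendsto_0: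
  "((\<lambda>t::real. (1/t)^n * exp (-1/t)) \<longlongrightarrow> 0) (at_right 0)"
proof -
  have "((\<lambda>s::real. s^n / exp s) \<longlongrightarrow> 0) at_top"
    by (rule tendsto_power_div_exp_0)
  then have "((\<lambda>t::real. (inverse t)^n / exp (inverse t)) \<longlongrightarrow> 0) (at_right 0)"
    by (rule filterlim_compose[OF _ filterlim_inverse_at_top_right])
  then show ?thesis by (simp add: exp_minus field_simps)
qed

text \<open>Differentiation sends \<open>flat n\<close> to a combination of
  \<open>flat (n+1)\<close> and \<open>flat (n+2)\<close>. Carrying the powers of \<open>1/t\<close>
  along thus gives a family closed under differentiation, and one induction over \<open>k\<close>
  treats all members; the bump function uses \<open>flat 0\<close>.\<close>

definition flat :: "nat \<Rightarrow> real \<Rightarrow> real" where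
  "flat n t = (if t \<le> 0 then 0 else (1/t)^n * exp (-1/t))"

lemma has_derivative_flat: "(flat n has_field_derivative flat (n+2) t - n * flat (n+1) t) (at t)"
proof (cases "t = 0")
  case False
  show ?thesis
  proof (cases "t < 0")
    case True
    have "(flat n has_field_derivative 0) (at t)"
      by (rule has_field_derivative_transform_within_open[where f="\<lambda>x. 0" and S="{..<0}"])
        (use True in \<open>auto simp: flat_def\<close>)
    then show ?thesis using True by (simp add: flat_def)
  next
    case f: False
    then have t: "t > 0" using False by simp
    \<comment> \<open>For \<open>n = 0\<close> the truncated difference is harmless because the
      factor \<open>n\<close> vanishes.\<close>
    have e: "n * (1/t)^(n-1) = n * (1/t)^n * t"
      using t by (cases n) auto
    have "((\<lambda>t. (1/t)^n * exp (-1/t)) has_field_derivative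
        (n * (1/t)^(n-1) * (-1/t^2)) * exp (-1/t) + (1/t)^n * (exp (-1/t) * (1/t^2))) (at t)"
      using t by (auto intro!: derivative_eq_intros simp: power2_eq_square)
    also have "(n * (1/t)^(n-1) * (-1/t^2)) * exp (-1/t) + (1/t)^n * (exp (-1/t) * (1/t^2))
      = flat (n+2) t - n * flat (n+1) t"
      unfolding e using t by (simp add: flat_def power2_eq_square field_simps)
    finally show ?thesis
      by (rule has_field_derivative_transform_within_open[where S="{0<..}"])
        (use t in \<open>auto simp: flat_def\<close>)
  qed
next
  case True
  \<comment> \<open>The difference quotient at 0 is zero from the left; from the right, dividing by
    \<open>h\<close> only raises the power of \<open>1/h\<close> by one, and the exponential still
    dominates.\<close>
  have "((\<lambda>h. flat n h / h) \<longlongrightarrow> 0) (at 0)"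
    unfolding filterlim_at_split
  proof
    show "((\<lambda>h. flat n h / h) \<longlongrightarrow> 0) (at_left 0)"
      by (rule tendsto_eventually) (auto simp: flat_def eventually_at_left_field intro!: exI[of _ "-1"])
    show "((\<lambda>h. flat n h / h) \<longlongrightarrow> 0) (at_right 0)"
      by (rule Lim_transform_eventually[OF exp_minus_inverse_power_tendsto_0[of "Suc n"]])
        (auto simp: flat_def eventually_at_right_field field_simps intro!: exI[of _ 1])
  qed
  moreover have "flat k 0 = 0" for k by (simp add: flat_def)
  ultimately show ?thesis using True by (simp add: DERIV_def)
qed

lemma C_k_on_flat: "C_k_on k UNIV (flat n)"
proof (induction k arbitrary: n)
  case 0
  have "isCont (flat n) t" for t using has_derivative_flat DERIV_isCont by blast
  then show ?case by (simp add: continuous_at_imp_continuous_on)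
next
  case (Suc k)
  show ?case
  proof (rule C_k_on_Suc_intro)
    show "(flat n has_derivative (\<lambda>v. (flat (n+2) t - n * flat (n+1) t) * v)) (at t)" for t
      using has_derivative_flat[of n t] by (simp add: has_field_derivative_def)
    show "C_k_on k UNIV (\<lambda>t. (flat (n+2) t - n * flat (n+1) t) * v)" for v
    proof -
      have "C_k_on k UNIV (\<lambda>t. flat (n+2) t * v + flat (n+1) t * (- real n * v))"
        by (intro C_k_on_add C_k_on_linear_comp[OF open_UNIV bounded_linear_mult_left] Suc) simp
      then show ?thesis by (simp add: algebra_simps)
    qed
  qed simp
qed

text \<open>The quotient \<open>u / (u + v)\<close>, where \<open>u\<close> vanishes exactly outside
  the open ball of radius \<open>\<rho>\<close> and \<open>v\<close> exactly on the closed ball of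
  radius \<open>\<rho>/2\<close>. These sets are disjoint, so the denominator has no zero. Squared
  distances keep the arguments smooth at the centre.\<close>

lemma smooth_bump:
  fixes a :: "'e::euclidean_space" and \<rho> :: real
  assumes "\<rho> > 0"
  obtains B :: "'e \<Rightarrow> real" where "smooth_on UNIV B"
    "\<And>x. dist a x \<le> \<rho>/2 \<Longrightarrow> B x = 1" "\<And>x. dist a x \<ge> \<rho> \<Longrightarrow> B x = 0"
proof -
  let ?d = "\<lambda>x. (x - a) \<bullet> (x - a)"
  let ?u = "\<lambda>x. flat 0 (\<rho>^2 - ?d x)" and ?v = "\<lambda>x. flat 0 (?d x - \<rho>^2/4)"
  let ?B = "\<lambda>x. ?u x * inverse (?u x + ?v x)"
  have pos: "flat 0 t \<ge> 0" "flat 0 t = 0 \<longleftrightarrow> t \<le> 0" for t by (auto simp: flat_def)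
  have nz: "?u x + ?v x \<noteq> 0" for x
  proof
    assume "?u x + ?v x = 0"
    then have "\<rho>^2 \<le> ?d x" "?d x \<le> \<rho>^2/4"
      using pos by (smt (verit))+
    moreover have "\<rho>^2 > 0" using assms by simp
    ultimately show False by linarith
  qed
  have d: "?d x = (dist a x)^2" for x
    by (subst dist_commute) (simp add: dist_norm power2_norm_eq_inner)
  have Cd: "C_k_on k UNIV ?d" for k
  proof -
    have e: "?d = (\<lambda>x. \<Sum>b\<in>Basis. (x \<bullet> b + (- a \<bullet> b)) * (x \<bullet> b + (- a \<bullet> b)))"
      by (subst euclidean_inner) (simp add: inner_diff_left)
    have "C_k_on k UNIV (\<lambda>x. x \<bullet> b + (- a \<bullet> b))" for b
      by (intro C_k_on_add C_k_on_const C_k_on_bounded_linear bounded_linear_inner_left) auto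
    then show ?thesis unfolding e by (intro C_k_on_sum C_k_on_mult open_UNIV)
  qed
  have flatc: "C_k_on k UNIV (\<lambda>x. flat 0 (c * ?d x + e))" for c e k
    by (rule C_k_on_compose[where T=UNIV and g="flat 0"])
      (intro open_UNIV subset_UNIV C_k_on_add C_k_on_mult C_k_on_const Cd C_k_on_flat)+
  have "C_k_on k UNIV ?B" for k
    using flatc[of k "-1" "\<rho>^2"] flatc[of k 1 "- (\<rho>^2/4)"]
    by (intro C_k_on_mult C_k_on_inverse C_k_on_add nz open_UNIV) simp_all
  then have "smooth_on UNIV ?B" by (simp add: smooth_on_def)
  moreover have "?B x = 1" if "dist a x \<le> \<rho>/2" for x
  proof -
    have "?d x \<le> (\<rho>/2)^2" unfolding d using that assms by (intro power_mono) auto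
    then have "?v x = 0" by (simp add: flat_def power_divide)
    then show ?thesis using nz[of x] by simp
  qed
  moreover have "?B x = 0" if "dist a x \<ge> \<rho>" for x
  proof -
    have "\<rho>^2 \<le> ?d x" unfolding d using that assms by (intro power_mono) auto
    then show ?thesis by (simp add: flat_def)
  qed
  ultimately show ?thesis using that by blast
qed

section \<open>Smooth functions on a manifold\<close>

lemma sum_fun_apply: "(\<Sum>i\<in>I. f i) x = (\<Sum>i\<in>I. f i x)"
  for f :: "'i \<Rightarrow> 'a \<Rightarrow> 'b::comm_monoid_add"
  by (induction I rule: infinite_finite_induct) auto

lemma scaleR_fun_apply [simp]: "(c *\<^sub>R f) x = c *\<^sub>R f x"
  by (simp add: scaleR_fun_def)

locale smooth_manifold =
  fixes A :: "('a::t2_space, 'e::euclidean_space) chart set"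
  assumes atlas: "smooth_atlas A"
begin

abbreviation "S \<equiv> smooth_funs A"
abbreviation "T \<equiv> tangent_space A"
abbreviation "VF \<equiv> vector_fields A"

lemma chart_homeomorphism:
  assumes "(U, \<phi>) \<in> A"
  shows "open U" "open (\<phi> ` U)" "homeomorphism U (\<phi> ` U) \<phi> (the_inv_into U \<phi>)" "inj_on \<phi> U"
proof -
  obtain \<psi> where U: "open U" "open (\<phi> ` U)" and \<psi>: "homeomorphism U (\<phi> ` U) \<phi> \<psi>"
    using atlas assms unfolding smooth_atlas_def by blast
  show inj: "inj_on \<phi> U"
    by (rule inj_on_inverseI[of U \<psi>]) (rule homeomorphism_apply1[OF \<psi>])
  have "\<psi> y = the_inv_into U \<phi> y" if "y \<in> \<phi> ` U" for y
    using that homeomorphism_apply1[OF \<psi>] the_inv_into_f_f[OF inj] by auto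
  then show "homeomorphism U (\<phi> ` U) \<phi> (the_inv_into U \<phi>)"
    using homeomorphism_cong[OF \<psi>, of U "\<phi> ` U" \<phi> "the_inv_into U \<phi>"] by simp
  show "open U" "open (\<phi> ` U)" by fact+
qed

lemma chart_inverse: "(U, \<phi>) \<in> A \<Longrightarrow> q \<in> U \<Longrightarrow> the_inv_into U \<phi> (\<phi> q) = q"
  using chart_homeomorphism(4) the_inv_into_f_f by metis

lemma chart_image_open:
  assumes "(U, \<phi>) \<in> A" "open W"
  shows "open (\<phi> ` (U \<inter> W))"
proof -
  have "\<phi> ` (U \<inter> W) = \<phi> ` U \<inter> the_inv_into U \<phi> -` W"
    using chart_inverse[OF assms(1)] by force
  then show ?thesis
    using continuous_open_preimage[OF homeomorphism_cont2[OF chart_homeomorphism(3)[OF assms(1)]]]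
      chart_homeomorphism(2)[OF assms(1)] assms(2) by simp
qed

lemma obtain_chart:
  obtains U \<phi> where "(U, \<phi>) \<in> A" "p \<in> U"
  using atlas unfolding smooth_atlas_def by blast

lemma smooth_fun_on_iff:
  "smooth_fun_on A W f \<longleftrightarrow>
     (\<forall>(U, \<phi>)\<in>A. \<forall>k. C_k_on k (\<phi> ` (U \<inter> W)) (\<lambda>y. f (the_inv_into U \<phi> y)))"
  unfolding smooth_fun_on_def smooth_on_def comp_def by blast

lemma smooth_fun_on_cong:
  assumes "open W" "\<And>q. q \<in> W \<Longrightarrow> f q = g q" "smooth_fun_on A W f"
  shows "smooth_fun_on A W g"
  unfolding smooth_fun_on_iff
proof safe
  fix U \<phi> k assume c: "(U, \<phi>) \<in> A"
  show "C_k_on k (\<phi> ` (U \<inter> W)) (\<lambda>y. g (the_inv_into U \<phi> y))"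
  proof (rule C_k_on_cong[OF chart_image_open[OF c assms(1)]])
    show "C_k_on k (\<phi> ` (U \<inter> W)) (\<lambda>y. f (the_inv_into U \<phi> y))"
      using assms(3) c unfolding smooth_fun_on_iff by blast
  qed (use assms(2) chart_inverse[OF c] in auto)
qed

lemma smooth_fun_on_subset: "smooth_fun_on A W f \<Longrightarrow> V \<subseteq> W \<Longrightarrow> smooth_fun_on A V f"
  unfolding smooth_fun_on_iff by (fast intro: C_k_on_subset)

lemma smooth_fun_on_local:
  assumes "\<And>q. q \<in> W \<Longrightarrow> \<exists>V. open V \<and> q \<in> V \<and> smooth_fun_on A V f"
  shows "smooth_fun_on A W f"
  unfolding smooth_fun_on_iff
proof safe
  fix U \<phi> k assume c: "(U, \<phi>) \<in> A"
  show "C_k_on k (\<phi> ` (U \<inter> W)) (\<lambda>y. f (the_inv_into U \<phi> y))"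
  proof (rule C_k_on_local)
    fix y assume "y \<in> \<phi> ` (U \<inter> W)"
    then obtain q where q: "q \<in> U" "q \<in> W" "y = \<phi> q" by auto
    then obtain V where "open V" "q \<in> V" "smooth_fun_on A V f" using assms by blast
    then show "\<exists>T. open T \<and> y \<in> T \<and> C_k_on k T (\<lambda>y. f (the_inv_into U \<phi> y))"
      using q c by (intro exI[of _ "\<phi> ` (U \<inter> V)"]) (auto simp: smooth_fun_on_iff chart_image_open[OF c])
  qed
qed

lemma smooth_fun_on_add:
  assumes "open W" "smooth_fun_on A W f" "smooth_fun_on A W g"
  shows "smooth_fun_on A W (\<lambda>q. f q + g q)"
  using assms chart_image_open unfolding smooth_fun_on_iff by (fast intro: C_k_on_add)

lemma smooth_fun_on_mult:
  assumes "open W" "smooth_fun_on A W f" "smooth_fun_on A W g"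
  shows "smooth_fun_on A W (\<lambda>q. f q * g q)"
  using assms chart_image_open unfolding smooth_fun_on_iff by (fast intro: C_k_on_mult)

lemma smooth_fun_on_const: "open W \<Longrightarrow> smooth_fun_on A W (\<lambda>q. c)"
  using chart_image_open unfolding smooth_fun_on_iff by (fast intro: C_k_on_const)

lemma smooth_fun_on_inverse:
  assumes "open W" "smooth_fun_on A W f" "\<And>q. q \<in> W \<Longrightarrow> f q \<noteq> 0"
  shows "smooth_fun_on A W (\<lambda>q. inverse (f q))"
  unfolding smooth_fun_on_iff
proof safe
  fix U \<phi> k assume c: "(U, \<phi>) \<in> A"
  show "C_k_on k (\<phi> ` (U \<inter> W)) (\<lambda>y. inverse (f (the_inv_into U \<phi> y)))"
    using assms(2,3) c chart_inverse[OF c]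
    by (intro C_k_on_inverse chart_image_open[OF c] assms(1)) (auto simp: smooth_fun_on_iff)
qed

lemma smooth_funs_iff: "f \<in> S \<longleftrightarrow> smooth_fun_on A UNIV f"
  by (simp add: smooth_funs_def)

lemma C_k_on_smooth_fun:
  assumes "f \<in> S" "(U, \<phi>) \<in> A"
  shows "C_k_on k (\<phi> ` U) (\<lambda>y. f (the_inv_into U \<phi> y))"
  using assms unfolding smooth_funs_iff smooth_fun_on_iff by fastforce

lemma smooth_funs_const [simp, intro]: "(\<lambda>q. c) \<in> S"
  by (simp add: smooth_funs_iff smooth_fun_on_const)

lemma smooth_funs_add [simp, intro]: "f \<in> S \<Longrightarrow> g \<in> S \<Longrightarrow> (\<lambda>q. f q + g q) \<in> S"
  by (simp add: smooth_funs_iff smooth_fun_on_add)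

lemma smooth_funs_mult [simp, intro]: "f \<in> S \<Longrightarrow> g \<in> S \<Longrightarrow> (\<lambda>q. f q * g q) \<in> S"
  by (simp add: smooth_funs_iff smooth_fun_on_mult)

lemma smooth_funs_minus [simp, intro]: "f \<in> S \<Longrightarrow> (\<lambda>q. - f q) \<in> S"
  using smooth_funs_mult[OF smooth_funs_const[of "-1"]] by auto

lemma smooth_funs_diff [simp, intro]: "f \<in> S \<Longrightarrow> g \<in> S \<Longrightarrow> (\<lambda>q. f q - g q) \<in> S"
  using smooth_funs_add[OF _ smooth_funs_minus, of f g] by simp

lemma smooth_funs_local_smooth:
  assumes "\<And>q. \<exists>V. open V \<and> q \<in> V \<and> smooth_fun_on A V f"
  shows "f \<in> S"
  unfolding smooth_funs_iff by (rule smooth_fun_on_local) (use assms in blast)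

section \<open>Cutoff functions and the extension of germs to the whole manifold\<close>

lemma smooth_fun_on_chart_pullback:
  assumes c: "(U, \<phi>) \<in> A" and F: "smooth_on UNIV (F :: 'e \<Rightarrow> real)"
  shows "smooth_fun_on A U (\<lambda>q. F (\<phi> q))"
  unfolding smooth_fun_on_iff
proof safe
  fix V \<psi> k assume d: "(V, \<psi>) \<in> A"
  have "smooth_on (\<psi> ` (V \<inter> U)) (\<phi> \<circ> the_inv_into V \<psi>)"
    using atlas c d unfolding smooth_atlas_def by blast
  then have "C_k_on k (\<psi> ` (V \<inter> U)) (\<phi> \<circ> the_inv_into V \<psi>)" "C_k_on k UNIV F"
    using F unfolding smooth_on_def by blast+
  from C_k_on_compose[OF chart_image_open[OF d chart_homeomorphism(1)[OF c]] open_UNIV subset_UNIV this]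
  show "C_k_on k (\<psi> ` (V \<inter> U)) (\<lambda>y. F (\<phi> (the_inv_into V \<psi> y)))"
    by simp
qed

text \<open>The Hausdorff property enters here: a closed ball in the chart is compact, hence closed
  in the whole manifold and not merely in the chart domain. This is what makes extension by zero
  smooth at boundary points of \<open>U\<close>.\<close>

lemma chart_ball_complement_open:
  assumes c: "(U, \<phi>) \<in> A" and K: "cball a \<rho> \<subseteq> \<phi> ` U"
  shows "open (- {q \<in> U. \<phi> q \<in> cball a \<rho>})"
proof -
  have "{q \<in> U. \<phi> q \<in> cball a \<rho>} = the_inv_into U \<phi> ` cball a \<rho>"
    using K chart_inverse[OF c] by force
  moreover have "compact (the_inv_into U \<phi> ` cball a \<rho>)"
    using compact_continuous_image[OF continuous_on_subset compact_cball]
      homeomorphism_cont2[OF chart_homeomorphism(3)[OF c]] K by blast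
  ultimately show ?thesis
    by (simp add: compact_imp_closed open_Compl)
qed

lemma smooth_funs_chart_extension:
  assumes c: "(U, \<phi>) \<in> A" and F: "smooth_on UNIV (F :: 'e \<Rightarrow> real)"
    and K: "cball a \<rho> \<subseteq> \<phi> ` U" and z: "\<And>y. y \<notin> cball a \<rho> \<Longrightarrow> F y = 0"
  shows "(\<lambda>q. if q \<in> U then F (\<phi> q) else 0) \<in> S" (is "?f \<in> S")
proof (rule smooth_funs_local_smooth)
  fix q
  let ?V = "- {q \<in> U. \<phi> q \<in> cball a \<rho>}"
  show "\<exists>V. open V \<and> q \<in> V \<and> smooth_fun_on A V ?f"
  proof (cases "q \<in> U")
    case True
    have "smooth_fun_on A U ?f"
      by (rule smooth_fun_on_cong[OF _ _ smooth_fun_on_chart_pullback[OF c F]])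
        (auto simp: chart_homeomorphism(1)[OF c])
    then show ?thesis using True chart_homeomorphism(1)[OF c] by blast
  next
    case False
    have "smooth_fun_on A ?V ?f"
      by (rule smooth_fun_on_cong[OF _ _ smooth_fun_on_const[of _ 0]])
        (use z chart_ball_complement_open[OF c K] in auto)
    then show ?thesis using False chart_ball_complement_open[OF c K] by blast
  qed
qed

lemma chart_cutoff:
  assumes c: "(U, \<phi>) \<in> A" and W: "open W" "p \<in> U" "p \<in> W"
  obtains B a \<rho> where "smooth_on UNIV (B :: 'e \<Rightarrow> real)" "cball a \<rho> \<subseteq> \<phi> ` (U \<inter> W)"
    "\<forall>y. y \<notin> cball a \<rho> \<longrightarrow> B y = 0" "\<forall>\<^sub>F y in nhds (\<phi> p). B y = 1"
proof -
  obtain \<rho> where \<rho>: "\<rho> > 0" "cball (\<phi> p) \<rho> \<subseteq> \<phi> ` (U \<inter> W)"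
    using chart_image_open[OF c W(1)] W(2,3) open_contains_cball by blast
  obtain B :: "'e \<Rightarrow> real" where B: "smooth_on UNIV B"
    "\<And>x. dist (\<phi> p) x \<le> \<rho>/2 \<Longrightarrow> B x = 1" "\<And>x. dist (\<phi> p) x \<ge> \<rho> \<Longrightarrow> B x = 0"
    using smooth_bump[OF \<rho>(1)] by blast
  have "\<forall>\<^sub>F y in nhds (\<phi> p). B y = 1"
    unfolding eventually_nhds
    by (rule exI[of _ "ball (\<phi> p) (\<rho>/2)"]) (use \<rho>(1) B(2) in auto)
  then show ?thesis using that[of B "\<phi> p" \<rho>] B \<rho>(2) by auto
qed

lemma eventually_chart:
  assumes "(U, \<phi>) \<in> A" "p \<in> U" "\<forall>\<^sub>F y in nhds (\<phi> p). P y"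
  shows "\<forall>\<^sub>F q in nhds p. q \<in> U \<and> P (\<phi> q)"
proof -
  have "filterlim \<phi> (nhds (\<phi> p)) (nhds p)"
    using homeomorphism_cont1[OF chart_homeomorphism(3)[OF assms(1)]] assms(2)
      continuous_on_eq_continuous_at[OF chart_homeomorphism(1)[OF assms(1)], of \<phi>]
    by (simp add: isCont_def tendsto_at_iff_tendsto_nhds)
  then have "\<forall>\<^sub>F q in nhds p. P (\<phi> q)"
    using assms(3) unfolding filterlim_iff by blast
  then show ?thesis
    using eventually_nhds_in_open[OF chart_homeomorphism(1)[OF assms(1)] assms(2)]
    by (rule eventually_conj[rotated])
qed

text \<open>The function vanishes on an open set containing the complement of \<open>W\<close>, not
  just on the complement itself. Its product with something smooth only on \<open>W\<close> is
  therefore smooth everywhere.\<close>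

lemma bump_function:
  assumes "open W" "p \<in> W"
  obtains b V where "b \<in> S" "\<forall>\<^sub>F q in nhds p. b q = 1" "open V" "- W \<subseteq> V" "\<And>q. q \<in> V \<Longrightarrow> b q = 0"
proof -
  obtain U \<phi> where c: "(U, \<phi>) \<in> A" "p \<in> U" by (rule obtain_chart[of p])
  obtain B a \<rho> where B: "smooth_on UNIV (B :: 'e \<Rightarrow> real)" "cball a \<rho> \<subseteq> \<phi> ` (U \<inter> W)"
    "\<forall>y. y \<notin> cball a \<rho> \<longrightarrow> B y = 0" "\<forall>\<^sub>F y in nhds (\<phi> p). B y = 1"
    by (rule chart_cutoff[OF c(1) assms(1) c(2) assms(2)])
  have K: "cball a \<rho> \<subseteq> \<phi> ` U" using B(2) by blast
  show ?thesis
  proof (rule that)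
    show "(\<lambda>q. if q \<in> U then B (\<phi> q) else 0) \<in> S"
      by (rule smooth_funs_chart_extension[OF c(1) B(1) K B(3)[rule_format]])
    show "\<forall>\<^sub>F q in nhds p. (if q \<in> U then B (\<phi> q) else 0) = 1"
      using eventually_chart[OF c B(4)] by eventually_elim simp
    show "open (- {q \<in> U. \<phi> q \<in> cball a \<rho>})"
      by (rule chart_ball_complement_open[OF c(1) K])
    show "- W \<subseteq> - {q \<in> U. \<phi> q \<in> cball a \<rho>}"
      using B(2) inj_onD[OF chart_homeomorphism(4)[OF c(1)]] by blast
  qed (use B(3) in auto)
qed

text \<open>Tangent vectors take global functions as arguments; this supplies a global
  representative of each germ.\<close>

lemma smooth_fun_on_extend:
  assumes "open W" "p \<in> W" "smooth_fun_on A W f"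
  obtains g where "g \<in> S" "\<forall>\<^sub>F q in nhds p. g q = f q"
proof -
  obtain b V where b: "b \<in> S" "\<forall>\<^sub>F q in nhds p. b q = 1" "open V" "- W \<subseteq> V" "\<And>q. q \<in> V \<Longrightarrow> b q = 0"
    using bump_function[OF assms(1,2)] by blast
  have "(\<lambda>q. b q * f q) \<in> S"
  proof (rule smooth_funs_local_smooth)
    fix q
    show "\<exists>V. open V \<and> q \<in> V \<and> smooth_fun_on A V (\<lambda>q. b q * f q)"
    proof (cases "q \<in> W")
      case True
      then show ?thesis
        using assms smooth_fun_on_mult[OF assms(1) smooth_fun_on_subset[OF _ subset_UNIV] assms(3)]
          b(1) smooth_funs_iff by blast
    next
      case False
      have "smooth_fun_on A V (\<lambda>q. b q * f q)"
        by (rule smooth_fun_on_cong[OF b(3) _ smooth_fun_on_const[OF b(3), of 0]]) (use b(5) in auto)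
      then show ?thesis using False b(3,4) by blast
    qed
  qed
  moreover have "\<forall>\<^sub>F q in nhds p. b q * f q = f q"
    using b(2) by eventually_elim simp
  ultimately show ?thesis using that by blast
qed

lemma smooth_funs_local:
  assumes "\<And>p. \<exists>g\<in>S. \<forall>\<^sub>F q in nhds p. f q = g q"
  shows "f \<in> S"
proof (rule smooth_funs_local_smooth)
  fix p
  obtain g V where "g \<in> S" "open V" "p \<in> V" "\<forall>q\<in>V. f q = g q"
    using assms[of p] unfolding eventually_nhds by blast
  then show "\<exists>V. open V \<and> p \<in> V \<and> smooth_fun_on A V f"
    using smooth_fun_on_cong[of V g f] smooth_fun_on_subset[of UNIV g V] smooth_funs_iff by auto
qed

lemma smooth_funs_germ_inverse:
  assumes "f \<in> S" "f p \<noteq> 0"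
  obtains g where "g \<in> S" "\<forall>\<^sub>F q in nhds p. g q * f q = 1"
proof -
  obtain U \<phi> where c: "(U, \<phi>) \<in> A" "p \<in> U" by (rule obtain_chart[of p])
  have "continuous_on (\<phi> ` U) (\<lambda>y. f (the_inv_into U \<phi> y))"
    using C_k_on_smooth_fun[OF assms(1) c(1), of 0] by simp
  then have "isCont (\<lambda>y. f (the_inv_into U \<phi> y)) (\<phi> p)"
    using c chart_homeomorphism(2) continuous_on_eq_continuous_at by blast
  then have "((\<lambda>y. f (the_inv_into U \<phi> y)) \<longlongrightarrow> f (the_inv_into U \<phi> (\<phi> p))) (nhds (\<phi> p))"
    unfolding isCont_def by (rule tendsto_at_iff_tendsto_nhds[THEN iffD1])
  then have "((\<lambda>y. f (the_inv_into U \<phi> y)) \<longlongrightarrow> f p) (nhds (\<phi> p))"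
    unfolding chart_inverse[OF c] .
  then have "\<forall>\<^sub>F y in nhds (\<phi> p). f (the_inv_into U \<phi> y) \<noteq> 0"
    using assms(2) by (rule tendsto_imp_eventually_ne)
  from eventually_chart[OF c this] have "\<forall>\<^sub>F q in nhds p. f q \<noteq> 0"
    by (rule eventually_mono) (use chart_inverse[OF c(1)] in auto)
  then obtain W where W: "open W" "p \<in> W" "\<And>q. q \<in> W \<Longrightarrow> f q \<noteq> 0"
    unfolding eventually_nhds by blast
  have "smooth_fun_on A W (\<lambda>q. inverse (f q))"
    by (rule smooth_fun_on_inverse[OF W(1) smooth_fun_on_subset[OF _ subset_UNIV] W(3)])
      (use assms(1) smooth_funs_iff in auto)
  then obtain g where g: "g \<in> S" "\<forall>\<^sub>F q in nhds p. g q = inverse (f q)"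
    by (rule smooth_fun_on_extend[OF W(1,2)])
  have "\<forall>\<^sub>F q in nhds p. g q * f q = 1"
    using g(2) \<open>\<forall>\<^sub>F q in nhds p. f q \<noteq> 0\<close> by eventually_elim simp
  then show ?thesis using that g(1) by blast
qed

text \<open>Only the lower bound \<open>dim T p \<ge> DIM('e)\<close> is needed: genericity supplies the upper bound.\<close>

lemma tangent_space_independent:
  obtains D where "D \<subseteq> T p" "independent D" "card D = DIM('e)" "finite D"
proof -
  obtain U \<phi> where c: "(U, \<phi>) \<in> A" "p \<in> U" by (rule obtain_chart[of p])
  obtain B a \<rho> where B: "smooth_on UNIV (B :: 'e \<Rightarrow> real)" "cball a \<rho> \<subseteq> \<phi> ` (U \<inter> UNIV)"
    "\<forall>y. y \<notin> cball a \<rho> \<longrightarrow> B y = 0" "\<forall>\<^sub>F y in nhds (\<phi> p). B y = 1"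
    by (rule chart_cutoff[OF c(1) open_UNIV c(2) UNIV_I])
  let ?i = "the_inv_into U \<phi>"
  \<comment> \<open>The directional derivative in the chart, set to zero off the smooth functions as
    \<open>tangent_space\<close> demands.\<close>
  define d where "d v f = (if f \<in> S then frechet_derivative (\<lambda>y. f (?i y)) (at (\<phi> p)) v else 0)"
    for v :: 'e and f
  have diff: "((\<lambda>y. f (?i y)) has_derivative (\<lambda>v. d v f)) (at (\<phi> p))" if "f \<in> S" for f
  proof -
    have "C_k_on (Suc 0) (\<phi> ` U) (\<lambda>y. f (?i y))"
      by (rule C_k_on_smooth_fun[OF that c(1)])
    from C_k_on_SucD(1)[OF this] show ?thesis using c(2) that unfolding d_def by simp
  qed
  have dI: "d v f = f' v" if "f \<in> S" "((\<lambda>y. f (?i y)) has_derivative f') (at (\<phi> p))" for v f f'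
    using has_derivative_unique[OF diff[OF that(1)] that(2)] by metis
  have ip: "?i (\<phi> p) = p" using chart_inverse[OF c] .
  have tangent: "d v \<in> T p" for v
    unfolding tangent_space_def linear_over_def
  proof (safe)
    fix f g a b assume fg: "f \<in> S" "g \<in> S"
    have e: "a *\<^sub>R f + b *\<^sub>R g = (\<lambda>q. a * f q + b * g q)" by (auto simp: scaleR_fun_def)
    have "((\<lambda>y. a * f (?i y) + b * g (?i y)) has_derivative (\<lambda>v. a * d v f + b * d v g)) (at (\<phi> p))"
      by (intro has_derivative_add has_derivative_mult_right diff fg)
    from dI[OF _ this] show "d v (a *\<^sub>R f + b *\<^sub>R g) = a *\<^sub>R d v f + b *\<^sub>R d v g"
      unfolding e using fg by auto
  next
    fix f g assume fg: "f \<in> S" "g \<in> S"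
    from dI[OF _ has_derivative_mult[OF diff[OF fg(1)] diff[OF fg(2)]]]
    show "d v (\<lambda>x. f x * g x) = f p * d v g + g p * d v f"
      using fg by (auto simp: ip)
  qed (simp add: d_def)
  \<comment> \<open>Coordinates times a cutoff that is 1 near \<open>p\<close>: global smooth
    functions on which \<open>d v\<close> returns the components of \<open>v\<close>, so that they
    detect linear relations.\<close>
  define x where "x j = (\<lambda>q. if q \<in> U then B (\<phi> q) * (\<phi> q \<bullet> j) else 0)" for j :: 'e
  have xS: "x j \<in> S" for j
  proof -
    have "smooth_on UNIV (\<lambda>y. B y * (y \<bullet> j))"
      using B(1) unfolding smooth_on_def
      by (intro allI C_k_on_mult open_UNIV) (auto intro: C_k_on_bounded_linear bounded_linear_inner_left)
    from smooth_funs_chart_extension[OF c(1) this _ , of a \<rho>] show ?thesis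
      unfolding x_def using B(2,3) by auto
  qed
  have dx: "d v (x j) = v \<bullet> j" for v j
  proof (rule dI[OF xS])
    have "\<forall>\<^sub>F y in nhds (\<phi> p). y \<in> \<phi> ` U"
      using chart_homeomorphism(2)[OF c(1)] c(2) by (simp add: eventually_nhds_in_open)
    with B(4) have "\<forall>\<^sub>F y in nhds (\<phi> p). y \<bullet> j = x j (?i y)"
      by eventually_elim (auto simp: x_def chart_inverse[OF c(1)])
    moreover have "((\<lambda>y. y \<bullet> j) has_derivative (\<lambda>v. v \<bullet> j)) (at (\<phi> p))"
      by (intro bounded_linear_imp_has_derivative bounded_linear_inner_left)
    ultimately show "((\<lambda>y. x j (?i y)) has_derivative (\<lambda>v. v \<bullet> j)) (at (\<phi> p))"
      using has_derivative_transform_eventually[of "\<lambda>y. y \<bullet> j" _ "\<phi> p" UNIV "\<lambda>y. x j (?i y)"]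
      by (simp add: eventually_nhds_conv_at)
  qed
  have inj: "inj_on d Basis"
  proof (rule inj_onI)
    fix b b' :: 'e assume *: "b \<in> Basis" "b' \<in> Basis" "d b = d b'"
    then have "b \<bullet> b = b' \<bullet> b" using dx by metis
    then show "b = b'" using * by (auto simp: inner_Basis split: if_splits)
  qed
  show ?thesis
  proof (rule that)
    show "card (d ` Basis) = DIM('e)" using inj by (rule card_image)
    show "independent (d ` Basis)"
      unfolding dependent_finite[OF finite_imageI[OF finite_Basis]]
    proof clarify
      fix u v b assume s: "(\<Sum>v\<in>d ` Basis. u v *\<^sub>R v) = 0" and b: "(b::'e) \<in> Basis" "u (d b) \<noteq> 0"
      have "0 = (\<Sum>b\<in>Basis. u (d b) *\<^sub>R d b)"
        using s by (simp add: sum.reindex[OF inj])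
      then have "0 = (\<Sum>i\<in>Basis. u (d i) *\<^sub>R d i) (x b)" by simp
      also have "\<dots> = (\<Sum>i\<in>Basis. u (d i) * d i (x b))"
        by (subst sum_fun_apply) (simp add: scaleR_fun_def)
      also have "\<dots> = u (d b)"
        using b(1) by (simp add: dx inner_Basis if_distrib sum.delta cong: if_cong)
      finally show False using b(2) by simp
    qed
  qed (use tangent in auto)
qed

end

section \<open>Vector fields and local coframes\<close>

lemma fscale_apply [simp]: "fscale h X p = h p *\<^sub>R X p"
  by (simp add: fscale_def)

context smooth_manifold
begin

section \<open>Tangent vectors as derivations\<close>

lemma tangent_mult:
  assumes "v \<in> T p" "f \<in> S" "g \<in> S"
  shows "v (\<lambda>x. f x * g x) = f p * v g + g p * v f"
  using assms unfolding tangent_space_def by blast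

lemma tangent_linear:
  assumes "v \<in> T p" "f \<in> S" "g \<in> S"
  shows "v (\<lambda>x. a * f x + b * g x) = a * v f + b * v g"
proof -
  have "v (a *\<^sub>R f + b *\<^sub>R g) = a *\<^sub>R v f + b *\<^sub>R v g"
    using assms unfolding tangent_space_def linear_over_def by blast
  moreover have "a *\<^sub>R f + b *\<^sub>R g = (\<lambda>x. a * f x + b * g x)"
    by (simp add: fun_eq_iff)
  ultimately show ?thesis by simp
qed

lemma tangent_const: "v \<in> T p \<Longrightarrow> v (\<lambda>x. c) = 0"
  using tangent_mult[of v p "\<lambda>x. 1" "\<lambda>x. 1"] tangent_linear[of v p "\<lambda>x. 1" "\<lambda>x. 1" c 0] by simp

lemma tangent_add: "v \<in> T p \<Longrightarrow> f \<in> S \<Longrightarrow> g \<in> S \<Longrightarrow> v (\<lambda>x. f x + g x) = v f + v g"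
  using tangent_linear[of v p f g 1 1] by simp

lemma tangent_diff: "v \<in> T p \<Longrightarrow> f \<in> S \<Longrightarrow> g \<in> S \<Longrightarrow> v (\<lambda>x. f x - g x) = v f - v g"
  using tangent_linear[of v p f g 1 "-1"] by simp

lemma tangent_cmult: "v \<in> T p \<Longrightarrow> f \<in> S \<Longrightarrow> v (\<lambda>x. c * f x) = c * v f"
  using tangent_linear[of v p f f c 0] by simp

lemma tangent_space_not_smooth: "v \<in> T p \<Longrightarrow> f \<notin> S \<Longrightarrow> v f = 0"
  unfolding tangent_space_def by blast

lemma tangent_spaceI:
  assumes "\<And>f g. f \<in> S \<Longrightarrow> g \<in> S \<Longrightarrow> v (\<lambda>x. f x + g x) = v f + v g"
    "\<And>f c. f \<in> S \<Longrightarrow> v (\<lambda>x. c * f x) = c * v f"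
    "\<And>f g. f \<in> S \<Longrightarrow> g \<in> S \<Longrightarrow> v (\<lambda>x. f x * g x) = f p * v g + g p * v f"
    "\<And>f. f \<notin> S \<Longrightarrow> v f = 0"
  shows "v \<in> T p"
  unfolding tangent_space_def linear_over_def
proof (intro CollectI conjI ballI allI impI)
  fix f g a b assume fg: "f \<in> S" "g \<in> S"
  have "v (a *\<^sub>R f + b *\<^sub>R g) = v (\<lambda>x. (\<lambda>x. a * f x) x + (\<lambda>x. b * g x) x)"
    by (rule arg_cong[where f=v]) (simp add: fun_eq_iff)
  also have "\<dots> = v (\<lambda>x. a * f x) + v (\<lambda>x. b * g x)"
    by (rule assms(1)) (use fg in auto)
  finally show "v (a *\<^sub>R f + b *\<^sub>R g) = a *\<^sub>R v f + b *\<^sub>R v g"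
    using assms(2) fg by simp
qed (use assms in auto)

lemma subspace_tangent_space: "subspace (T p)"
proof -
  have "0 \<in> T p" by (rule tangent_spaceI) auto
  moreover have "v + w \<in> T p" if "v \<in> T p" "w \<in> T p" for v w
    by (rule tangent_spaceI)
      (use that in \<open>auto simp: tangent_add tangent_mult tangent_cmult tangent_space_not_smooth algebra_simps\<close>)
  moreover have "c *\<^sub>R v \<in> T p" if "v \<in> T p" for c v
    by (rule tangent_spaceI)
      (use that in \<open>auto simp: tangent_add tangent_mult tangent_cmult tangent_space_not_smooth algebra_simps\<close>)
  ultimately show ?thesis unfolding subspace_def by blast
qed

lemma tangent_eqI:
  assumes "v \<in> T p" "w \<in> T p" "\<And>f. f \<in> S \<Longrightarrow> v f = w f"
  shows "v = w"
  using assms tangent_space_not_smooth by (metis ext)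

text \<open>For a bump \<open>b\<close> supported where \<open>f = g\<close>, the product
  \<open>b (f - g)\<close> is identically zero. The Leibniz rule at \<open>p\<close>, where
  \<open>b = 1\<close> and \<open>f - g = 0\<close>, leaves exactly
  \<open>v f - v g\<close>.\<close>

lemma tangent_local:
  assumes v: "v \<in> T p" and fg: "f \<in> S" "g \<in> S" and eq: "\<forall>\<^sub>F q in nhds p. f q = g q"
  shows "v f = v g"
proof -
  obtain W where W: "open W" "p \<in> W" "\<And>q. q \<in> W \<Longrightarrow> f q = g q"
    using eq unfolding eventually_nhds by blast
  obtain b V where b: "b \<in> S" "\<forall>\<^sub>F q in nhds p. b q = 1" "open V" "- W \<subseteq> V" "\<And>q. q \<in> V \<Longrightarrow> b q = 0"
    using bump_function[OF W(1,2)] by blast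
  have "b p = 1" using b(2) eventually_nhds_x_imp_x by fast
  have "(\<lambda>x. b x * (f x - g x)) = (\<lambda>x. 0)"
  proof
    fix x show "b x * (f x - g x) = 0"
      using W(3)[of x] b(4) b(5)[of x] by (cases "x \<in> W") auto
  qed
  then have "0 = v (\<lambda>x. b x * (f x - g x))"
    using tangent_const[OF v] by simp
  also have "\<dots> = b p * v (\<lambda>x. f x - g x) + (f p - g p) * v b"
    by (rule tangent_mult[OF v b(1)]) (use fg in auto)
  also have "\<dots> = v f - v g"
    using \<open>b p = 1\<close> W(2,3) tangent_diff[OF v fg] by simp
  finally show ?thesis by simp
qed

section \<open>Vector fields and their Lie brackets\<close>

lemma vector_fields_iff: "X \<in> VF \<longleftrightarrow> (\<forall>p. X p \<in> T p) \<and> (\<forall>f\<in>S. (\<lambda>p. X p f) \<in> S)"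
  unfolding vector_fields_on_def by (simp add: smooth_funs_iff)

lemma vector_fieldsD: "X \<in> VF \<Longrightarrow> X p \<in> T p" "X \<in> VF \<Longrightarrow> f \<in> S \<Longrightarrow> (\<lambda>p. X p f) \<in> S"
  by (auto simp: vector_fields_iff)

lemma vector_fields_zero [simp, intro]: "0 \<in> VF"
  using subspace_0[OF subspace_tangent_space] by (auto simp: vector_fields_iff)

lemma vector_fields_add [simp, intro]: "X \<in> VF \<Longrightarrow> Y \<in> VF \<Longrightarrow> X + Y \<in> VF"
  using subspace_add[OF subspace_tangent_space] by (auto simp: vector_fields_iff)

lemma vector_fields_fscale [simp, intro]: "h \<in> S \<Longrightarrow> X \<in> VF \<Longrightarrow> fscale h X \<in> VF"
  using subspace_scale[OF subspace_tangent_space] by (auto simp: vector_fields_iff)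

lemma scaleR_eq_fscale: "c *\<^sub>R X = fscale (\<lambda>q. c) X"
  by (simp add: fun_eq_iff)

lemma minus_eq_fscale: "- X = fscale (\<lambda>q. - 1) X"
  by (simp add: fun_eq_iff)

lemma vector_fields_scaleR [simp, intro]: "X \<in> VF \<Longrightarrow> c *\<^sub>R X \<in> VF"
  unfolding scaleR_eq_fscale by blast

lemma vector_fields_minus [simp, intro]: "X \<in> VF \<Longrightarrow> - X \<in> VF"
  unfolding minus_eq_fscale by blast

lemma vector_fields_diff [simp, intro]: "X \<in> VF \<Longrightarrow> Y \<in> VF \<Longrightarrow> X - Y \<in> VF"
  using vector_fields_add[of X "- Y"] by simp

lemma vector_fields_sum [intro]: "(\<And>i. i \<in> I \<Longrightarrow> X i \<in> VF) \<Longrightarrow> (\<Sum>i\<in>I. X i) \<in> VF"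
  by (induction I rule: infinite_finite_induct) auto

lemma vector_fields_local:
  assumes "\<And>p. \<exists>Z\<in>VF. \<forall>\<^sub>F q in nhds p. X q = Z q"
  shows "X \<in> VF"
  unfolding vector_fields_iff
proof (intro conjI allI ballI)
  fix p
  obtain Z where Z: "Z \<in> VF" "\<forall>\<^sub>F q in nhds p. X q = Z q" using assms by blast
  then have "X p = Z p" using eventually_nhds_x_imp_x by fast
  then show "X p \<in> T p" using Z(1) vector_fieldsD(1) by simp
next
  fix f assume f: "f \<in> S"
  show "(\<lambda>p. X p f) \<in> S"
  proof (rule smooth_funs_local)
    fix p
    obtain Z where Z: "Z \<in> VF" "\<forall>\<^sub>F q in nhds p. X q = Z q" using assms by blast
    from Z(2) have "\<forall>\<^sub>F q in nhds p. X q f = Z q f" by eventually_elim simp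
    then show "\<exists>g\<in>S. \<forall>\<^sub>F q in nhds p. X q f = g q"
      by (rule bexI[OF _ vector_fieldsD(2)[OF Z(1) f]])
  qed
qed

text \<open>A single cutoff \<open>b\<close> serves all fields on \<open>U\<close> at once, so a
  local frame becomes a family of global fields that coincides with it near
  \<open>p\<close>.\<close>

lemma vector_field_globalize:
  assumes "open U" "p \<in> U"
  obtains b where "b \<in> S" "\<forall>\<^sub>F q in nhds p. b q = 1" "\<And>q. q \<notin> U \<Longrightarrow> b q = 0"
    "\<And>X. X \<in> vector_fields_on A U \<Longrightarrow> fscale b X \<in> VF"
proof -
  obtain b V where b: "b \<in> S" "\<forall>\<^sub>F q in nhds p. b q = 1" "open V" "- U \<subseteq> V" "\<And>q. q \<in> V \<Longrightarrow> b q = 0"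
    using bump_function[OF assms] by blast
  have "fscale b X \<in> VF" if X: "X \<in> vector_fields_on A U" for X
    unfolding vector_fields_iff
  proof (intro conjI allI ballI)
    fix q show "fscale b X q \<in> T q"
    proof (cases "q \<in> U")
      case True
      then show ?thesis
        using X subspace_scale[OF subspace_tangent_space] unfolding vector_fields_on_def by auto
    next
      case False
      then have "b q = 0" using b(4,5) by blast
      then show ?thesis using subspace_0[OF subspace_tangent_space] by simp
    qed
  next
    fix f assume f: "f \<in> S"
    show "(\<lambda>q. fscale b X q f) \<in> S"
    proof (rule smooth_funs_local)
      fix q show "\<exists>g\<in>S. \<forall>\<^sub>F q' in nhds q. fscale b X q' f = g q'"
      proof (cases "q \<in> U")
        case True
        have "smooth_fun_on A U (\<lambda>q. X q f)" using X f unfolding vector_fields_on_def by blast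
        then obtain g where g: "g \<in> S" "\<forall>\<^sub>F q' in nhds q. g q' = X q' f"
          by (rule smooth_fun_on_extend[OF assms(1) True])
        from g(2) have "\<forall>\<^sub>F q' in nhds q. fscale b X q' f = b q' * g q'"
          by eventually_elim simp
        then show ?thesis using g(1) b(1) by (intro bexI[of _ "\<lambda>q. b q * g q"]) auto
      next
        case False
        then have "\<forall>\<^sub>F q' in nhds q. q' \<in> V" using b(3,4) by (auto intro: eventually_nhds_in_open)
        then have "\<forall>\<^sub>F q' in nhds q. fscale b X q' f = 0"
          by eventually_elim (simp add: b(5))
        then show ?thesis by (intro bexI[of _ "\<lambda>q. 0"]) auto
      qed
    qed
  qed
  then show ?thesis using that b by blast
qed

lemma vector_fields_bracket [simp, intro]:
  assumes X: "X \<in> VF" and Y: "Y \<in> VF"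
  shows "lie_bracket X Y \<in> VF"
  unfolding vector_fields_iff
proof (intro conjI allI ballI)
  fix p
  note XT = vector_fieldsD(1)[OF X] and YT = vector_fieldsD(1)[OF Y]
  note XS = vector_fieldsD(2)[OF X] and YS = vector_fieldsD(2)[OF Y]
  show "lie_bracket X Y p \<in> T p"
  proof (rule tangent_spaceI)
    fix f g assume fg: "f \<in> S" "g \<in> S"
    show "lie_bracket X Y p (\<lambda>x. f x + g x) = lie_bracket X Y p f + lie_bracket X Y p g"
      unfolding lie_bracket_def using fg XS YS by (simp add: tangent_add[OF XT] tangent_add[OF YT])
    show "lie_bracket X Y p (\<lambda>x. f x * g x) = f p * lie_bracket X Y p g + g p * lie_bracket X Y p f"
      unfolding lie_bracket_def using fg XS YS
      by (simp add: tangent_mult[OF XT] tangent_mult[OF YT] tangent_add[OF XT] tangent_add[OF YT] algebra_simps)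
  next
    fix f c assume f: "f \<in> S"
    show "lie_bracket X Y p (\<lambda>x. c * f x) = c * lie_bracket X Y p f"
      unfolding lie_bracket_def using f XS YS
      by (simp add: tangent_cmult[OF XT] tangent_cmult[OF YT] algebra_simps)
  next
    \<comment> \<open>For such \<open>f\<close> both inner functions are constantly zero, and
      derivations kill constants.\<close>
    fix f assume f: "f \<notin> S"
    show "lie_bracket X Y p f = 0"
      unfolding lie_bracket_def using tangent_space_not_smooth[OF XT f] tangent_space_not_smooth[OF YT f]
      by (simp add: tangent_const[OF XT]
          tangent_const[OF YT])
  qed
next
  fix f assume f: "f \<in> S"
  show "(\<lambda>p. lie_bracket X Y p f) \<in> S"
    unfolding lie_bracket_def
    by (intro smooth_funs_diff vector_fieldsD(2)[OF X] vector_fieldsD(2)[OF Y] f)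
qed

lemma vector_field_eqI:
  assumes "X \<in> VF" "Y \<in> VF" "\<And>p f. f \<in> S \<Longrightarrow> X p f = Y p f"
  shows "X = Y"
  by (rule ext, rule tangent_eqI[OF vector_fieldsD(1)[OF assms(1)] vector_fieldsD(1)[OF assms(2)]])
    (rule assms(3))

lemma bracket_skew: "lie_bracket X Y = - lie_bracket Y X"
  by (simp add: lie_bracket_def fun_eq_iff)

lemma bracket_skew_at: "lie_bracket X Y p = - lie_bracket Y X p"
  by (simp add: lie_bracket_def fun_eq_iff)

lemma bracket_add_right:
  assumes "X \<in> VF" "Y \<in> VF" "Z \<in> VF"
  shows "lie_bracket X (Y + Z) = lie_bracket X Y + lie_bracket X Z"
proof (rule vector_field_eqI)
  fix p f assume "f \<in> S"
  then show "lie_bracket X (Y + Z) p f = (lie_bracket X Y + lie_bracket X Z) p f"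
    using assms vector_fieldsD(2) unfolding lie_bracket_def
    by (simp add: tangent_add[OF vector_fieldsD(1)[OF assms(1)]])
qed (use assms in auto)

lemma bracket_fscale_right:
  assumes "X \<in> VF" "Y \<in> VF" "h \<in> S"
  shows "lie_bracket X (fscale h Y) = fscale h (lie_bracket X Y) + fscale (\<lambda>q. X q h) Y"
proof (rule vector_field_eqI)
  fix p f assume "f \<in> S"
  then show "lie_bracket X (fscale h Y) p f = (fscale h (lie_bracket X Y) + fscale (\<lambda>q. X q h) Y) p f"
    using assms vector_fieldsD(2) unfolding lie_bracket_def
    by (simp add: tangent_mult[OF vector_fieldsD(1)[OF assms(1)]] algebra_simps)
qed (use assms vector_fieldsD in auto)

lemma bracket_add_left:
  assumes "X \<in> VF" "Y \<in> VF" "Z \<in> VF"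
  shows "lie_bracket (Y + Z) X = lie_bracket Y X + lie_bracket Z X"
  using bracket_add_right[OF assms] bracket_skew[of _ X] by simp

lemma bracket_fscale_left:
  assumes "X \<in> VF" "Y \<in> VF" "h \<in> S"
  shows "lie_bracket (fscale h Y) X = fscale h (lie_bracket Y X) - fscale (\<lambda>q. X q h) Y"
proof -
  have "fscale h (- Z) = - fscale h Z" for Z :: "'a vfield" by (simp add: fun_eq_iff)
  then show ?thesis
    using bracket_fscale_right[OF assms] bracket_skew[of _ X] by simp
qed

lemma bracket_zero_right: "X \<in> VF \<Longrightarrow> lie_bracket X 0 = 0"
  using bracket_add_right[of X 0 0] by simp

lemma bracket_sum_right:
  assumes "X \<in> VF" "\<And>i. i \<in> I \<Longrightarrow> Y i \<in> VF"
  shows "lie_bracket X (\<Sum>i\<in>I. Y i) = (\<Sum>i\<in>I. lie_bracket X (Y i))"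
  using assms(2)
  by (induction I rule: infinite_finite_induct)
    (auto simp: bracket_zero_right assms(1) bracket_add_right vector_fields_sum)

lemma bracket_local_right:
  assumes "X \<in> VF" "Y \<in> VF" "Z \<in> VF" "\<forall>\<^sub>F q in nhds p. Y q = Z q"
  shows "lie_bracket X Y p = lie_bracket X Z p"
proof (rule tangent_eqI)
  fix f assume f: "f \<in> S"
  have "Y p = Z p" using assms(4) eventually_nhds_x_imp_x by fast
  moreover have "X p (\<lambda>q. Y q f) = X p (\<lambda>q. Z q f)"
    by (rule tangent_local[OF vector_fieldsD(1)[OF assms(1)]])
      (use assms f vector_fieldsD in \<open>auto elim: eventually_mono\<close>)
  ultimately show "lie_bracket X Y p f = lie_bracket X Z p f"
    unfolding lie_bracket_def by simp
qed (use assms vector_fieldsD vector_fields_bracket in auto)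

lemma bracket_local_left:
  assumes "X \<in> VF" "Y \<in> VF" "Z \<in> VF" "\<forall>\<^sub>F q in nhds p. Y q = Z q"
  shows "lie_bracket Y X p = lie_bracket Z X p"
  using bracket_local_right[OF assms] bracket_skew_at[of _ X] by simp

text \<open>The coordinate formula for the bracket, for expansions valid only near \<open>p\<close>;
  this suffices because the bracket at \<open>p\<close> depends on germs. The one-sided Leibniz rule
  \<open>step\<close> is applied in the right slot and, after exchanging the arguments, in the left
  one.\<close>

lemma bracket_combination:
  assumes X: "X \<in> VF" "\<And>i. i \<in> I \<Longrightarrow> x i \<in> S \<and> E i \<in> VF" "\<forall>\<^sub>F q in nhds p. X q = (\<Sum>i\<in>I. x i q *\<^sub>R E i q)"
    and Y: "Y \<in> VF" "\<And>j. j \<in> J \<Longrightarrow> y j \<in> S \<and> F j \<in> VF" "\<forall>\<^sub>F q in nhds p. Y q = (\<Sum>j\<in>J. y j q *\<^sub>R F j q)"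
  shows "lie_bracket X Y p = (\<Sum>i\<in>I. \<Sum>j\<in>J. (x i p * y j p) *\<^sub>R lie_bracket (E i) (F j) p)
    + (\<Sum>j\<in>J. X p (y j) *\<^sub>R F j p) - (\<Sum>i\<in>I. Y p (x i) *\<^sub>R E i p)"
proof -
  have step: "lie_bracket Z W p = (\<Sum>j\<in>K. w j p *\<^sub>R lie_bracket Z (G j) p) + (\<Sum>j\<in>K. Z p (w j) *\<^sub>R G j p)"
    if Z: "Z \<in> VF" and W: "W \<in> VF" "\<And>j. j \<in> K \<Longrightarrow> w j \<in> S \<and> G j \<in> VF"
      "\<forall>\<^sub>F q in nhds p. W q = (\<Sum>j\<in>K. w j q *\<^sub>R G j q)"
    for Z W :: "'a vfield" and K :: "'k set" and w G
  proof -
    have "\<forall>\<^sub>F q in nhds p. W q = (\<Sum>j\<in>K. fscale (w j) (G j)) q"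
      using W(3) by eventually_elim (simp add: sum_fun_apply)
    then have "lie_bracket Z W p = lie_bracket Z (\<Sum>j\<in>K. fscale (w j) (G j)) p"
      using Z W by (intro bracket_local_right vector_fields_sum) auto
    also have "\<dots> = (\<Sum>j\<in>K. lie_bracket Z (fscale (w j) (G j)) p)"
      using Z W by (subst bracket_sum_right) (auto simp: sum_fun_apply)
    also have "\<dots> = (\<Sum>j\<in>K. w j p *\<^sub>R lie_bracket Z (G j) p + Z p (w j) *\<^sub>R G j p)"
      using Z W by (intro sum.cong refl) (simp add: bracket_fscale_right)
    finally show ?thesis by (simp add: sum.distrib)
  qed
  have "lie_bracket X Y p = (\<Sum>j\<in>J. y j p *\<^sub>R lie_bracket X (F j) p) + (\<Sum>j\<in>J. X p (y j) *\<^sub>R F j p)"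
    by (rule step) (use X Y in auto)
  moreover have "lie_bracket X Y p = - lie_bracket Y X p" by (rule bracket_skew_at)
  moreover have XF: "lie_bracket X (F j) p = (\<Sum>i\<in>I. x i p *\<^sub>R lie_bracket (E i) (F j) p) - (\<Sum>i\<in>I. F j p (x i) *\<^sub>R E i p)"
    if "j \<in> J" for j
  proof -
    have "lie_bracket (F j) X p = (\<Sum>i\<in>I. x i p *\<^sub>R lie_bracket (F j) (E i) p) + (\<Sum>i\<in>I. F j p (x i) *\<^sub>R E i p)"
      by (rule step) (use X Y that in auto)
    then show ?thesis
      unfolding bracket_skew_at[of X "F j" p] bracket_skew_at[of "F j" "E _" p]
      by (simp add: sum_negf)
  qed
  moreover have "(\<Sum>j\<in>J. y j p *\<^sub>R lie_bracket X (F j) p) =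
      (\<Sum>i\<in>I. \<Sum>j\<in>J. (x i p * y j p) *\<^sub>R lie_bracket (E i) (F j) p) - (\<Sum>i\<in>I. Y p (x i) *\<^sub>R E i p)"
  proof -
    have Yp: "Y p = (\<Sum>j\<in>J. y j p *\<^sub>R F j p)"
      using Y(3) eventually_nhds_x_imp_x by fast
    have "(\<Sum>j\<in>J. y j p *\<^sub>R lie_bracket X (F j) p) =
      (\<Sum>j\<in>J. \<Sum>i\<in>I. (x i p * y j p) *\<^sub>R lie_bracket (E i) (F j) p) - (\<Sum>j\<in>J. \<Sum>i\<in>I. (y j p * F j p (x i)) *\<^sub>R E i p)"
      unfolding sum_subtractf[symmetric]
      by (intro sum.cong refl) (simp add: XF scaleR_diff_right scaleR_sum_right sum_subtractf mult.commute)
    \<comment> \<open>The vectors \<open>F j p\<close>, weighted by \<open>y j p\<close>, reassemble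
      to \<open>Y p\<close>.\<close>
    also have "(\<Sum>j\<in>J. \<Sum>i\<in>I. (y j p * F j p (x i)) *\<^sub>R E i p) = (\<Sum>i\<in>I. Y p (x i) *\<^sub>R E i p)"
      by (subst sum.swap) (simp add: Yp sum_fun_apply scaleR_sum_left)
    finally show ?thesis by (subst sum.swap)
  qed
  ultimately show ?thesis by simp
qed

text \<open>The functionals are linear on the whole type of tangent vectors, not only on tangent
  spaces, so linearity can be used without membership conditions. Differentials
  \<open>v \<mapsto> v f\<close> have this property, and the dual coframes are built from
  them.\<close>

definition lforms :: "('a \<Rightarrow> 'a tvec \<Rightarrow> real) set" where
  "lforms = {\<theta>. (\<forall>q. linear (\<theta> q)) \<and> (\<forall>X\<in>VF. (\<lambda>q. \<theta> q (X q)) \<in> S)}"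

lemma lformsD: "\<theta> \<in> lforms \<Longrightarrow> linear (\<theta> q)" "\<theta> \<in> lforms \<Longrightarrow> X \<in> VF \<Longrightarrow> (\<lambda>q. \<theta> q (X q)) \<in> S"
  by (auto simp: lforms_def)

lemma lforms_differential: "f \<in> S \<Longrightarrow> (\<lambda>q v. v f) \<in> lforms"
  unfolding lforms_def using vector_fieldsD by (auto intro!: linearI)

lemma lforms_add: "\<theta> \<in> lforms \<Longrightarrow> \<theta>' \<in> lforms \<Longrightarrow> (\<lambda>q v. \<theta> q v + \<theta>' q v) \<in> lforms"
  unfolding lforms_def by (auto intro: linear_compose_add)

lemma lforms_scale: "\<theta> \<in> lforms \<Longrightarrow> h \<in> S \<Longrightarrow> (\<lambda>q v. h q * \<theta> q v) \<in> lforms"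
  unfolding lforms_def using linear_compose_scale_right[of "\<theta> _" "h _"] by auto

lemma lforms_sum:
  assumes "\<And>i. i \<in> I \<Longrightarrow> \<theta> i \<in> lforms"
  shows "(\<lambda>q v. \<Sum>i\<in>I. \<theta> i q v) \<in> lforms"
  using assms
proof (induction I rule: infinite_finite_induct)
  case (insert i I)
  then show ?case using lforms_add[of "\<theta> i" "\<lambda>q v. \<Sum>i\<in>I. \<theta> i q v"] by auto
qed (auto simp: lforms_def intro: linearI)

lemma lforms_diff: "\<theta> \<in> lforms \<Longrightarrow> \<theta>' \<in> lforms \<Longrightarrow> (\<lambda>q v. \<theta> q v - \<theta>' q v) \<in> lforms"
  using lforms_add[of \<theta> "\<lambda>q v. (- 1) * \<theta>' q v"] lforms_scale[of \<theta>' "\<lambda>q. -1"] by simp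

text \<open>Gauss elimination: \<open>\<theta> k\<close> is a multiple of \<open>df - (\<Sum>i<k. e\<^sub>i f \<theta>\<^sub>i)\<close> for a function \<open>f\<close> on which
  the component of \<open>e k\<close> transversal to the previous fields does not vanish.\<close>

lemma dual_coframe:
  fixes k :: nat
  assumes "\<And>i. i < k \<Longrightarrow> e i \<in> VF" "\<And>i. i < k \<Longrightarrow> e i p \<notin> span ((\<lambda>j. e j p) ` {..<i})"
  obtains \<theta> where "\<And>i. i < k \<Longrightarrow> \<theta> i \<in> lforms"
    "\<forall>\<^sub>F q in nhds p. \<forall>i<k. \<forall>j<k. \<theta> i q (e j q) = (if i = j then 1 else 0)"
proof -
  have "\<exists>\<theta>. (\<forall>i<k. \<theta> i \<in> lforms) \<and>
    (\<forall>\<^sub>F q in nhds p. \<forall>i<k. \<forall>j<k. \<theta> i q (e j q) = (if i = j then 1 else 0))"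
    using assms
  proof (induction k)
    case (Suc k)
    have "\<exists>\<theta>. (\<forall>i<k. \<theta> i \<in> lforms) \<and>
        (\<forall>\<^sub>F q in nhds p. \<forall>i<k. \<forall>j<k. \<theta> i q (e j q) = (if i = j then 1 else 0))"
      by (rule Suc.IH) (use Suc.prems in auto)
    then obtain \<theta> where \<theta>: "\<forall>i<k. \<theta> i \<in> lforms"
      "\<forall>\<^sub>F q in nhds p. \<forall>i<k. \<forall>j<k. \<theta> i q (e j q) = (if i = j then 1 else 0)"
      by (elim exE conjE)
    have eVF: "e i \<in> VF" if "i \<le> k" for i using Suc.prems(1) that by simp
    let ?c = "\<lambda>i q. \<theta> i q (e k q)"
    have cS: "?c i \<in> S" if "i < k" for i using lformsD(2) \<theta>(1) eVF that by blast
    define Y where "Y = e k - (\<Sum>i<k. fscale (?c i) (e i))"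
    have Y: "Y \<in> VF" unfolding Y_def using cS eVF by (intro vector_fields_diff vector_fields_sum) auto
    have Yq: "Y q = e k q - (\<Sum>i<k. ?c i q *\<^sub>R e i q)" for q
      unfolding Y_def by (simp add: sum_fun_apply)
    have "Y p \<noteq> 0"
    proof
      assume "Y p = 0"
      then have "e k p = (\<Sum>i<k. ?c i p *\<^sub>R e i p)" using Yq[of p] by simp
      also have "\<dots> \<in> span ((\<lambda>j. e j p) ` {..<k})"
        by (intro span_sum span_scale span_base) auto
      finally show False using Suc.prems(2) by blast
    qed
    then obtain f where f: "f \<in> S" "Y p f \<noteq> 0"
      using tangent_space_not_smooth[OF vector_fieldsD(1)[OF Y]] by (metis ext zero_fun_apply)
    obtain h where h: "h \<in> S" "\<forall>\<^sub>F q in nhds p. h q * Y q f = 1"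
      using smooth_funs_germ_inverse[OF vector_fieldsD(2)[OF Y f(1)] f(2)] by blast
    define \<tau> where "\<tau> q v = h q * (v f - (\<Sum>i<k. e i q f * \<theta> i q v))" for q and v :: "'a tvec"
    have \<tau>: "\<tau> \<in> lforms"
      unfolding \<tau>_def using \<theta>(1) eVF f(1) h(1) vector_fieldsD(2)
      by (intro lforms_scale lforms_diff lforms_sum lforms_differential) auto
    \<comment> \<open>Subtracting a multiple of \<open>\<tau>\<close> makes the earlier forms vanish
      on \<open>e k\<close>; their duality with the earlier fields survives because
      \<open>\<tau>\<close> vanishes on these near \<open>p\<close>.\<close>
    define \<theta>' where "\<theta>' i = (if i < k then (\<lambda>q v. \<theta> i q v - ?c i q * \<tau> q v) else \<tau>)" for i
    have "\<theta>' i \<in> lforms" for i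
    proof (cases "i < k")
      case True
      then show ?thesis
        unfolding \<theta>'_def using lforms_diff[OF _ lforms_scale[OF \<tau> cS], of "\<theta> i" i] \<theta>(1) by simp
    qed (simp add: \<theta>'_def \<tau>)
    moreover have "\<forall>\<^sub>F q in nhds p. \<forall>i<Suc k. \<forall>j<Suc k. \<theta>' i q (e j q) = (if i = j then 1 else 0)"
      using \<theta>(2) h(2)
    proof eventually_elim
      case (elim q)
      have 1: "\<tau> q (e j q) = 0" if "j < k" for j
      proof -
        have "(\<Sum>i<k. e i q f * \<theta> i q (e j q)) = (\<Sum>i<k. if i = j then e i q f else 0)"
          using elim(1) that by (intro sum.cong) auto
        also have "\<dots> = e j q f" using that by simp
        finally show ?thesis unfolding \<tau>_def by simp
      qed
      have 2: "\<tau> q (e k q) = 1"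
        using elim(2) unfolding \<tau>_def Yq by (simp add: sum_fun_apply mult.commute)
      show ?case
        using elim(1) by (auto simp: \<theta>'_def 1 2 less_Suc_eq)
    qed
    ultimately show ?case by blast
  qed simp
  then show ?thesis using that by blast
qed

lemma coframe_expansion:
  fixes k :: nat
  assumes "\<And>i. i < k \<Longrightarrow> linear (\<theta> i)"
    "\<And>i j. i < k \<Longrightarrow> j < k \<Longrightarrow> \<theta> i (b j) = (if i = j then 1 else 0::real)"
    "v \<in> span (b ` {..<k})"
  shows "v = (\<Sum>i<k. \<theta> i v *\<^sub>R b i)"
proof -
  have "linear (\<lambda>v. \<Sum>i<k. \<theta> i v *\<^sub>R b i)"
    using assms(1) by (intro linear_compose_sum) (auto intro!: linearI simp: linear_add linear_scale scaleR_add_left)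
  moreover have "id x = (\<Sum>i<k. \<theta> i x *\<^sub>R b i)" if "x \<in> b ` {..<k}" for x
  proof -
    obtain j where j: "j < k" "x = b j" using \<open>x \<in> b ` {..<k}\<close> by auto
    have "(\<Sum>i<k. \<theta> i x *\<^sub>R b i) = (\<Sum>i<k. if i = j then b i else 0)"
      using assms(2) j by (intro sum.cong) auto
    also have "\<dots> = b j" using j(1) by (subst sum.delta) auto
    finally show ?thesis using j(2) by simp
  qed
  ultimately have "id v = (\<Sum>i<k. \<theta> i v *\<^sub>R b i)"
    using linear_eq_on_span[OF linear_id] assms(3) by blast
  then show ?thesis by simp
qed

end

declare One_nat_def [simp del]

section \<open>Frames of a generic distribution\<close>

lemma linear_overD:
  assumes "linear_over V f" "x \<in> V" "y \<in> V"
  shows "f (a *\<^sub>R x + b *\<^sub>R y) = a *\<^sub>R f x + b *\<^sub>R f y"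
  using assms unfolding linear_over_def by blast

lemma lessThan_2_3_5: "{..<1} = {0::nat}" "{..<2} = {0, 1::nat}" "{..<3} = {0, 1, 2::nat}" "{..<5} = {0, 1, 2, 3, 4::nat}"
  by auto

lemma less_5_cases: "i < (5::nat) \<longleftrightarrow> i = 0 \<or> i = 1 \<or> i = 2 \<or> i = 3 \<or> i = 4"
  by auto

lemma less_3_cases: "i < (3::nat) \<longleftrightarrow> i = 0 \<or> i = 1 \<or> i = 2"
  by auto

lemma less_2_cases': "i < (2::nat) \<longleftrightarrow> i = 0 \<or> i = 1"
  by auto

locale contact_distribution = smooth_manifold A
  for A :: "('a::t2_space, real^5) chart set" +
  fixes H :: "'a \<Rightarrow> 'a tvec set" and \<alpha> :: "'a \<Rightarrow> 'a tvec \<Rightarrow> real"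
  assumes generic: "generic_distribution A H"
    and contact: "generalized_contact_form A H \<alpha>"
begin

abbreviation "GH \<equiv> sections A H"
abbreviation "D2 \<equiv> T2 A H"
abbreviation "G2 \<equiv> sections A D2"

lemma subspace_H: "subspace (H p)"
  using generic unfolding generic_distribution_def distribution_def by (metis subspace_span)

lemma subspace_D2: "subspace (D2 p)"
  unfolding T2_def by (rule subspace_span)

lemma sectionsD: "X \<in> sections A E \<Longrightarrow> X \<in> VF" "X \<in> sections A E \<Longrightarrow> X p \<in> E p"
  by (auto simp: sections_def)

lemma sectionsI: "X \<in> VF \<Longrightarrow> (\<And>p. X p \<in> E p) \<Longrightarrow> X \<in> sections A E"
  by (auto simp: sections_def)

lemma sections_closed:
  assumes "\<And>p. subspace (E p)"
  shows sections_zero: "0 \<in> sections A E"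
    and sections_add: "X \<in> sections A E \<Longrightarrow> Y \<in> sections A E \<Longrightarrow> X + Y \<in> sections A E"
    and sections_diff: "X \<in> sections A E \<Longrightarrow> Y \<in> sections A E \<Longrightarrow> X - Y \<in> sections A E"
    and sections_minus: "X \<in> sections A E \<Longrightarrow> - X \<in> sections A E"
    and sections_fscale: "h \<in> S \<Longrightarrow> X \<in> sections A E \<Longrightarrow> fscale h X \<in> sections A E"
    and sections_scaleR: "X \<in> sections A E \<Longrightarrow> c *\<^sub>R X \<in> sections A E"
  using subspace_0[OF assms] subspace_add[OF assms] subspace_diff[OF assms] subspace_scale[OF assms]
    subspace_neg[OF assms]
  by (auto simp: sections_def)

lemmas GH_closed [simp, intro] = sections_closed[of H, OF subspace_H]
lemmas G2_closed [simp, intro] = sections_closed[of D2, OF subspace_D2]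

lemma GH_VF [simp, intro]: "X \<in> GH \<Longrightarrow> X \<in> VF"
  by (rule sectionsD)

lemma G2_VF [simp, intro]: "X \<in> G2 \<Longrightarrow> X \<in> VF"
  by (rule sectionsD)

lemma GH_bracket_G2 [simp, intro]: "\<xi> \<in> GH \<Longrightarrow> \<eta> \<in> GH \<Longrightarrow> lie_bracket \<xi> \<eta> \<in> G2"
  unfolding sections_def[of A D2] T2_def by (auto intro!: span_base)

text \<open>The definitions quantify over global sections, so frames have to consist of global
  fields. The local frame of the distribution is cut off for this purpose; what remains spans
  \<open>H\<close> only near \<open>p\<close>.\<close>

lemma GH_local_frame:
  obtains e :: "nat \<Rightarrow> 'a vfield" where "e 0 \<in> GH" "e 1 \<in> GH"
    "\<forall>\<^sub>F q in nhds p. H q = span {e 0 q, e 1 q}" "e 0 p \<noteq> 0" "e 1 p \<notin> span {e 0 p}"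
proof -
  obtain U X where U: "open U" "p \<in> U" and X: "\<forall>i<2. X i \<in> vector_fields_on A U"
    and fr: "\<forall>q\<in>U. inj_on (\<lambda>i. X i q) {..<2} \<and> independent ((\<lambda>i. X i q) ` {..<2::nat}) \<and>
      H q = span ((\<lambda>i. X i q) ` {..<2})"
    using generic unfolding generic_distribution_def distribution_def by blast
  obtain b where b: "b \<in> S" "\<forall>\<^sub>F q in nhds p. b q = 1" "\<And>q. q \<notin> U \<Longrightarrow> b q = 0"
    "\<And>X. X \<in> vector_fields_on A U \<Longrightarrow> fscale b X \<in> VF"
    using vector_field_globalize[OF U] by blast
  define e where "e i = fscale b (X i)" for i
  have e: "e i \<in> GH" if "i < 2" for i
  proof (rule sectionsI)
    show "e i \<in> VF" unfolding e_def using b(4) X that by blast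
    show "e i q \<in> H q" for q
    proof (cases "q \<in> U")
      case True
      then have "X i q \<in> H q" using fr that by (auto intro: span_base)
      then show ?thesis unfolding e_def using subspace_scale[OF subspace_H] by simp
    next
      case False
      then show ?thesis unfolding e_def using b(3) subspace_0[OF subspace_H] by simp
    qed
  qed
  have "\<forall>\<^sub>F q in nhds p. q \<in> U" using U by (rule eventually_nhds_in_open)
  with b(2) have "\<forall>\<^sub>F q in nhds p. H q = span {e 0 q, e 1 q}"
    by eventually_elim (use fr in \<open>simp add: e_def lessThan_2_3_5\<close>)
  moreover have bp: "b p = 1" using b(2) eventually_nhds_x_imp_x by fast
  have "X 0 p \<noteq> X 1 p" "independent {X 0 p, X 1 p}"
    using fr U(2) by (auto simp: lessThan_2_3_5 inj_on_def)
  then have "X 0 p \<noteq> 0" "X 1 p \<notin> span {X 0 p}"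
    using dependent_zero[of "{X 0 p, X 1 p}"] independent_insert[of "X 1 p" "{X 0 p}"]
    by (auto simp: insert_commute)
  then have "e 0 p \<noteq> 0" "e 1 p \<notin> span {e 0 p}" by (simp_all add: e_def bp)
  ultimately show ?thesis using that e[of 0] e[of 1] by simp
qed

lemma H_subset_D2: "H p \<subseteq> D2 p"
proof -
  obtain e :: "nat \<Rightarrow> 'a vfield" where e: "e 0 \<in> GH" "e 1 \<in> GH"
    "\<forall>\<^sub>F q in nhds p. H q = span {e 0 q, e 1 q}" "e 0 p \<noteq> 0" "e 1 p \<notin> span {e 0 p}"
    by (rule GH_local_frame)
  have "H p = span {e 0 p, e 1 p}" by (rule eventually_nhds_x_imp_x[OF e(3)])
  moreover have "e i p \<in> D2 p" if "e i \<in> GH" for i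
    unfolding T2_def by (rule span_base) (use that in blast)
  ultimately show ?thesis using e(1,2) by (simp add: span_minimal subspace_D2)
qed

lemma GH_G2 [simp, intro]:
  assumes "X \<in> GH"
  shows "X \<in> G2"
  by (rule sectionsI[OF sectionsD(1)[OF assms] subsetD[OF H_subset_D2 sectionsD(2)[OF assms]]])

lemma D2_subset_T: "D2 p \<subseteq> T p"
  unfolding T2_def
  by (rule span_minimal[OF _ subspace_tangent_space]) (auto intro: vector_fieldsD(1))

text \<open>A germ of a frame of \<open>H\<close> with its dual forms, carried by global objects.
  Since the conditions hold near \<open>p\<close>, the same data form a frame at all nearby points,
  so identities proved at a point can afterwards be differentiated.\<close>

definition frame_H where
  "frame_H p e \<theta> \<longleftrightarrow> e 0 \<in> GH \<and> e (1::nat) \<in> GH \<and> \<theta> 0 \<in> lforms \<and> \<theta> (1::nat) \<in> lforms \<and>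
    (\<forall>\<^sub>F q in nhds p. H q = span {e 0 q, e 1 q} \<and>
      \<theta> 0 q (e 0 q) = 1 \<and> \<theta> 0 q (e 1 q) = 0 \<and> \<theta> 1 q (e 0 q) = 0 \<and> \<theta> 1 q (e 1 q) = 1)"

lemma frame_H_exists: obtains e \<theta> where "frame_H p e \<theta>"
proof -
  obtain e :: "nat \<Rightarrow> 'a vfield" where e: "e 0 \<in> GH" "e 1 \<in> GH"
    "\<forall>\<^sub>F q in nhds p. H q = span {e 0 q, e 1 q}" "e 0 p \<noteq> 0" "e 1 p \<notin> span {e 0 p}"
    by (rule GH_local_frame)
  have "e i \<in> VF" "e i p \<notin> span ((\<lambda>j. e j p) ` {..<i})" if "i < 2" for i
    using e that by (auto simp: less_2_cases' lessThan_2_3_5)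
  then obtain \<theta> where \<theta>: "\<And>i. i < 2 \<Longrightarrow> \<theta> i \<in> lforms"
    "\<forall>\<^sub>F q in nhds p. \<forall>i<2. \<forall>j<2. \<theta> i q (e j q) = (if i = j then 1 else 0)"
    by (rule dual_coframe[of 2 e p]) blast+
  have "\<forall>\<^sub>F q in nhds p. H q = span {e 0 q, e 1 q} \<and>
      \<theta> 0 q (e 0 q) = 1 \<and> \<theta> 0 q (e 1 q) = 0 \<and> \<theta> 1 q (e 0 q) = 0 \<and> \<theta> 1 q (e 1 q) = 1"
    using e(3) \<theta>(2) by eventually_elim auto
  then have "frame_H p e \<theta>"
    unfolding frame_H_def using e(1,2) \<theta>(1)[of 0] \<theta>(1)[of 1] by simp
  then show ?thesis by (rule that)
qed

lemma frame_H_eventually: "frame_H p e \<theta> \<Longrightarrow> \<forall>\<^sub>F q in nhds p. frame_H q e \<theta>"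
  unfolding frame_H_def using eventually_eventually[of _ p] by auto

lemma frame_H_expansion:
  assumes F: "frame_H p e \<theta>" and v: "v \<in> H p"
  shows "v = \<theta> 0 p v *\<^sub>R e 0 p + \<theta> 1 p v *\<^sub>R e 1 p"
proof -
  have lin: "linear (\<theta> 0 p)" "linear (\<theta> 1 p)"
    using F lformsD(1) unfolding frame_H_def by blast+
  have fr: "H p = span {e 0 p, e 1 p}" "\<theta> 0 p (e 0 p) = 1" "\<theta> 0 p (e 1 p) = 0"
      "\<theta> 1 p (e 0 p) = 0" "\<theta> 1 p (e 1 p) = 1"
    using F eventually_nhds_x_imp_x unfolding frame_H_def by fast+
  have "v = (\<Sum>i<2. \<theta> i p v *\<^sub>R e i p)"
    by (rule coframe_expansion) (use lin fr v in \<open>auto simp: lessThan_2_3_5 less_2_cases'\<close>)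
  then show ?thesis by (simp add: lessThan_2_3_5)
qed

text \<open>The coframe provides coefficients that are smooth everywhere although \<open>Z\<close>
  lies in \<open>H\<close> only near \<open>p\<close>. Brackets see germs, so \<open>Z\<close> may
  be replaced by a section.\<close>

lemma locally_in_H:
  assumes Z: "Z \<in> VF" "\<forall>\<^sub>F q in nhds p. Z q \<in> H q"
  obtains \<beta> where "\<beta> \<in> GH" "\<forall>\<^sub>F q in nhds p. Z q = \<beta> q"
proof -
  obtain e \<theta> where F: "frame_H p e \<theta>" by (rule frame_H_exists)
  then have e: "e 0 \<in> GH" "e 1 \<in> GH" "\<theta> 0 \<in> lforms" "\<theta> 1 \<in> lforms"
    unfolding frame_H_def by blast+
  let ?b = "fscale (\<lambda>q. \<theta> 0 q (Z q)) (e 0) + fscale (\<lambda>q. \<theta> 1 q (Z q)) (e 1)"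
  have "?b \<in> GH" using e lformsD(2)[OF _ Z(1)] by blast
  moreover have "\<forall>\<^sub>F q in nhds p. Z q = ?b q"
    using frame_H_eventually[OF F] Z(2)
    by eventually_elim (simp, rule frame_H_expansion)
  ultimately show ?thesis by (rule that)
qed

lemma bracket_locally_in_H:
  assumes "\<xi> \<in> GH" "Z \<in> VF" "\<forall>\<^sub>F q in nhds p. Z q \<in> H q"
  shows "lie_bracket \<xi> Z p \<in> D2 p"
proof -
  obtain \<beta> where b: "\<beta> \<in> GH" "\<forall>\<^sub>F q in nhds p. Z q = \<beta> q"
    by (rule locally_in_H[OF assms(2,3)])
  have "lie_bracket \<xi> Z p = lie_bracket \<xi> \<beta> p"
    using assms b by (intro bracket_local_right) auto
  then show ?thesis using sectionsD(2)[OF GH_bracket_G2[OF assms(1) b(1)]] by simp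
qed

text \<open>Modulo \<open>H\<close> only the determinant of the coefficients survives: an
  alternating form in rank two is determined by its value on one pair, here
  \<open>[e 0, e 1]\<close>.\<close>

lemma frame_H_bracket:
  assumes F: "frame_H p e \<theta>" and xi: "\<xi> \<in> GH" and eta: "\<eta> \<in> GH"
  shows "lie_bracket \<xi> \<eta> p =
    (\<theta> 0 p (\<xi> p) * \<theta> 1 p (\<eta> p) - \<theta> 1 p (\<xi> p) * \<theta> 0 p (\<eta> p)) *\<^sub>R lie_bracket (e 0) (e 1) p
    + (\<xi> p (\<lambda>q. \<theta> 0 q (\<eta> q)) - \<eta> p (\<lambda>q. \<theta> 0 q (\<xi> q))) *\<^sub>R e 0 p
    + (\<xi> p (\<lambda>q. \<theta> 1 q (\<eta> q)) - \<eta> p (\<lambda>q. \<theta> 1 q (\<xi> q))) *\<^sub>R e 1 p"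
proof -
  have e: "e 0 \<in> GH" "e 1 \<in> GH" "\<theta> 0 \<in> lforms" "\<theta> 1 \<in> lforms"
    using F unfolding frame_H_def by blast+
  have ex: "\<forall>\<^sub>F q in nhds p. Z q = (\<Sum>i\<in>{..<2}. \<theta> i q (Z q) *\<^sub>R e i q)" if "Z \<in> GH" for Z
    using frame_H_eventually[OF F]
    by eventually_elim (use frame_H_expansion sectionsD(2)[OF that] in \<open>auto simp: lessThan_2_3_5\<close>)
  have sm: "i \<in> {..<2} \<Longrightarrow> (\<lambda>q. \<theta> i q (Z q)) \<in> S \<and> e i \<in> VF" if "Z \<in> GH" for Z i
    using e that lformsD(2) by (auto simp: less_2_cases')
  have sk: "lie_bracket (e i) (e i) p = 0" "lie_bracket (e 1) (e 0) p = - lie_bracket (e 0) (e 1) p" for i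
    using bracket_skew_at[of "e 1" "e 0" p] by (simp_all add: lie_bracket_def fun_eq_iff)
  from bracket_combination[OF GH_VF[OF xi] sm[OF xi] ex[OF xi] GH_VF[OF eta] sm[OF eta] ex[OF eta]]
  show ?thesis by (simp add: lessThan_2_3_5 sk algebra_simps)
qed

lemma frame_H_D2:
  assumes F: "frame_H p e \<theta>"
  shows "D2 p = span {e 0 p, e 1 p, lie_bracket (e 0) (e 1) p}" (is "_ = span ?B")
proof
  have e: "e 0 \<in> GH" "e 1 \<in> GH" using F unfolding frame_H_def by blast+
  have B: "e 0 p \<in> span ?B" "e 1 p \<in> span ?B" "lie_bracket (e 0) (e 1) p \<in> span ?B"
    by (auto intro: span_base)
  show "D2 p \<subseteq> span ?B"
    unfolding T2_def
  proof (rule span_minimal[OF _ subspace_span], safe)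
    fix \<xi> assume "\<xi> \<in> GH"
    then have "\<xi> p \<in> H p" by (rule sectionsD)
    then show "\<xi> p \<in> span ?B"
      by (subst frame_H_expansion[OF F]) (auto intro!: span_add span_scale B)
  next
    fix \<xi> \<eta> assume "\<xi> \<in> GH" "\<eta> \<in> GH"
    then show "lie_bracket \<xi> \<eta> p \<in> span ?B"
      by (subst frame_H_bracket[OF F]) (auto intro!: span_add span_scale B)
  qed
  show "span ?B \<subseteq> D2 p"
    using e sectionsD(2)[OF GH_G2] sectionsD(2)[OF GH_bracket_G2]
    by (intro span_minimal[OF _ subspace_D2]) auto
qed

text \<open>Genericity speaks of all triple brackets. Expanding \<open>[\<eta>, \<zeta>]\<close> in
  \<open>e 0\<close>, \<open>e 1\<close>, \<open>c\<close> with smooth coefficients and bracketing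
  once more with \<open>\<xi>\<close> yields, modulo \<open>D2\<close>, only multiples of
  \<open>[e 0, c]\<close> and \<open>[e 1, c]\<close>.\<close>

lemma frame_H_T:
  assumes F: "frame_H p e \<theta>" and c: "c = lie_bracket (e 0) (e 1)"
  shows "T p = span {e 0 p, e 1 p, c p, lie_bracket (e 0) c p, lie_bracket (e 1) c p}" (is "_ = span ?B")
proof
  have e: "e 0 \<in> GH" "e 1 \<in> GH" "\<theta> 0 \<in> lforms" "\<theta> 1 \<in> lforms"
    using F unfolding frame_H_def by blast+
  have c2: "c \<in> G2" unfolding c using e by blast
  have B: "e 0 p \<in> span ?B" "e 1 p \<in> span ?B" "c p \<in> span ?B"
    "lie_bracket (e 0) c p \<in> span ?B" "lie_bracket (e 1) c p \<in> span ?B"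
    by (auto intro: span_base)
  have D2: "D2 p \<subseteq> span ?B"
    unfolding frame_H_D2[OF F] c by (rule span_mono) auto
  have "T p = span (
        {\<xi> p |\<xi>. \<xi> \<in> GH} \<union> {lie_bracket \<xi> \<eta> p |\<xi> \<eta>. \<xi> \<in> GH \<and> \<eta> \<in> GH} \<union>
        {lie_bracket \<xi> (lie_bracket \<eta> \<zeta>) p |\<xi> \<eta> \<zeta>. \<xi> \<in> GH \<and> \<eta> \<in> GH \<and> \<zeta> \<in> GH})"
    using generic unfolding generic_distribution_def by blast
  also have "\<dots> \<subseteq> span ?B"
  proof (rule span_minimal[OF _ subspace_span], safe)
    fix \<xi> assume "\<xi> \<in> GH"
    then show "\<xi> p \<in> span ?B" using D2 sectionsD(2)[OF GH_G2] by blast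
  next
    fix \<xi> \<eta> assume "\<xi> \<in> GH" "\<eta> \<in> GH"
    then show "lie_bracket \<xi> \<eta> p \<in> span ?B" using D2 sectionsD(2)[OF GH_bracket_G2] by blast
  next
    fix \<xi> \<eta> \<zeta> assume x: "\<xi> \<in> GH" and y: "\<eta> \<in> GH" "\<zeta> \<in> GH"
    \<comment> \<open>The coefficients of \<open>[\<eta>, \<zeta>]\<close> from
      \<open>frame_H_bracket\<close>, with \<open>c\<close> at index 2.\<close>
    define w where "w i = (if i = 2 then (\<lambda>q. \<theta> 0 q (\<eta> q) * \<theta> 1 q (\<zeta> q) - \<theta> 1 q (\<eta> q) * \<theta> 0 q (\<zeta> q))
      else (\<lambda>q. \<eta> q (\<lambda>q. \<theta> i q (\<zeta> q)) - \<zeta> q (\<lambda>q. \<theta> i q (\<eta> q))))" for i :: nat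
    define e' where "e' i = (if i = 2 then c else e i)" for i :: nat
    have "w i \<in> S \<and> e' i \<in> VF" if "i \<in> {..<3}" for i
      using that e y c2 vector_fieldsD(2) lformsD(2)
      by (auto simp: w_def e'_def lessThan_2_3_5 GH_VF G2_VF)
    moreover have "\<forall>\<^sub>F q in nhds p. lie_bracket \<eta> \<zeta> q = (\<Sum>i\<in>{..<3}. w i q *\<^sub>R e' i q)"
      using frame_H_eventually[OF F]
      by eventually_elim (simp add: frame_H_bracket[OF _ y] w_def e'_def lessThan_2_3_5 c)
    moreover have "\<forall>\<^sub>F q in nhds p. \<xi> q = (\<Sum>i\<in>{..<2}. \<theta> i q (\<xi> q) *\<^sub>R e i q)"
      using frame_H_eventually[OF F]
      by eventually_elim (use frame_H_expansion sectionsD(2)[OF x] in \<open>auto simp: lessThan_2_3_5\<close>)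
    moreover have "(\<lambda>q. \<theta> i q (\<xi> q)) \<in> S \<and> e i \<in> VF" if "i \<in> {..<2}" for i
      using e x that lformsD(2) by (auto simp: less_2_cases')
    ultimately have "lie_bracket \<xi> (lie_bracket \<eta> \<zeta>) p =
      (\<Sum>i<2. \<Sum>j<3. (\<theta> i p (\<xi> p) * w j p) *\<^sub>R lie_bracket (e i) (e' j) p)
      + (\<Sum>j<3. \<xi> p (w j) *\<^sub>R e' j p) - (\<Sum>i<2. lie_bracket \<eta> \<zeta> p (\<lambda>q. \<theta> i q (\<xi> q)) *\<^sub>R e i p)"
      using x y by (intro bracket_combination) auto
    also have "\<dots> \<in> span ?B"
    proof -
      have "lie_bracket (e i) (e' j) p \<in> span ?B" if "i < 2" "j < 3" for i j
      proof (cases "j = 2")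
        case True
        then show ?thesis using B that by (auto simp: e'_def less_2_cases')
      next
        case False
        then have "e i \<in> GH" "e' j \<in> GH" using e that by (auto simp: e'_def less_2_cases' less_3_cases)
        then show ?thesis using D2 sectionsD(2)[OF GH_bracket_G2] by blast
      qed
      moreover have "e' j p \<in> span ?B" if "j < 3" for j
        using B that by (auto simp: e'_def less_3_cases)
      moreover have "e i p \<in> span ?B" if "i < 2" for i
        using B that by (auto simp: less_2_cases')
      ultimately show ?thesis
        by (intro span_add span_diff span_sum span_scale) auto
    qed
    finally show "lie_bracket \<xi> (lie_bracket \<eta> \<zeta>) p \<in> span ?B" .
  qed
  finally show "T p \<subseteq> span ?B" .
  show "span ?B \<subseteq> T p"
    using e c2 by (intro span_minimal[OF _ subspace_tangent_space]) (auto intro!: vector_fieldsD(1))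
qed

lemma T_not_span_4:
  assumes "T p \<subseteq> span B" "finite B" "card B < 5"
  shows False
proof -
  obtain D where D: "D \<subseteq> T p" "independent D" "card D = DIM(real^5)" "finite D"
    by (rule tangent_space_independent)
  then have "card D \<le> card B"
    using independent_span_bound[OF assms(2) D(2)] assms(1) by blast
  then show False using D(3) assms(3) by simp
qed

section \<open>The contact form and the normalization of the Levi bracket\<close>

lemma contact_linear: "linear_over (D2 p) (\<alpha> p)"
  using contact unfolding generalized_contact_form_def by blast

lemma contact_smooth: "\<zeta> \<in> G2 \<Longrightarrow> (\<lambda>p. \<alpha> p (\<zeta> p)) \<in> S"
  using contact unfolding generalized_contact_form_def by blast

lemma contact_kernel: "v \<in> D2 p \<Longrightarrow> \<alpha> p v = 0 \<longleftrightarrow> v \<in> H p"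
  using contact unfolding generalized_contact_form_def by blast

lemma contact_combination:
  assumes "v \<in> D2 p" "w \<in> D2 p"
  shows contact_add: "\<alpha> p (v + w) = \<alpha> p v + \<alpha> p w"
    and contact_diff: "\<alpha> p (v - w) = \<alpha> p v - \<alpha> p w"
    and contact_scale: "\<alpha> p (c *\<^sub>R v) = c * \<alpha> p v"
  using linear_overD[OF contact_linear assms, of 1 1] linear_overD[OF contact_linear assms, of 1 "-1"]
    linear_overD[OF contact_linear assms, of c 0] by simp_all

lemma contact_H: "v \<in> H p \<Longrightarrow> \<alpha> p v = 0"
  using contact_kernel H_subset_D2 by blast

text \<open>If \<open>\<alpha>\<close> vanished on \<open>[e 0, e 1]\<close> at \<open>p\<close>,
  this bracket would lie in \<open>H p\<close> and four vectors would span the tangent space.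
  Rescaling \<open>e 0\<close> by the inverse of the value normalizes it: the derivative term of
  \<open>[h e 0, e 1]\<close> is a multiple of \<open>e 0\<close>, on which \<open>\<alpha>\<close>
  vanishes.\<close>

lemma normalized_frame_H_exists:
  obtains e \<theta> where "frame_H p e \<theta>" "\<forall>\<^sub>F q in nhds p. \<alpha> q (lie_bracket (e 0) (e 1) q) = 1"
proof -
  obtain e \<theta> where F: "frame_H p e \<theta>" by (rule frame_H_exists)
  then have e: "e 0 \<in> GH" "e 1 \<in> GH" "\<theta> 0 \<in> lforms" "\<theta> 1 \<in> lforms"
    unfolding frame_H_def by blast+
  let ?c = "lie_bracket (e 0) (e 1)"
  have c: "?c \<in> G2" using e by blast
  have Hp: "H p = span {e 0 p, e 1 p}"
    using F eventually_nhds_x_imp_x unfolding frame_H_def by fast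
  have "\<alpha> p (?c p) \<noteq> 0"
  proof
    assume "\<alpha> p (?c p) = 0"
    then have "?c p \<in> H p" using contact_kernel sectionsD(2)[OF c] by blast
    then have "?c p \<in> span {e 0 p, e 1 p, lie_bracket (e 0) ?c p, lie_bracket (e 1) ?c p}"
      unfolding Hp using span_mono[of "{e 0 p, e 1 p}"] by blast
    then have "T p \<subseteq> span {e 0 p, e 1 p, lie_bracket (e 0) ?c p, lie_bracket (e 1) ?c p}"
      unfolding frame_H_T[OF F refl] by (intro span_minimal subspace_span) (auto intro: span_base)
    moreover have "card {e 0 p, e 1 p, lie_bracket (e 0) ?c p, lie_bracket (e 1) ?c p} < 5"
      by (rule le_less_trans[OF card_insert_le_m1]) (auto intro!: card_insert_le_m1)
    ultimately show False using T_not_span_4 by blast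
  qed
  then obtain h where h: "h \<in> S" "\<forall>\<^sub>F q in nhds p. h q * \<alpha> q (?c q) = 1"
    using smooth_funs_germ_inverse[OF contact_smooth[OF c]] by blast
  define e' where "e' i = (if i = 0 then fscale h (e 0) else e i)" for i :: nat
  \<comment> \<open>The dual form is rescaled by \<open>\<alpha>([e 0, e 1])\<close>, which is
    smooth globally and inverse to \<open>h\<close> near \<open>p\<close>.\<close>
  define \<theta>' where "\<theta>' i = (if i = 0 then (\<lambda>q v. \<alpha> q (?c q) * \<theta> 0 q v) else \<theta> i)" for i :: nat
  have "\<forall>\<^sub>F q in nhds p. H q = span {e' 0 q, e' 1 q} \<and>
      \<theta>' 0 q (e' 0 q) = 1 \<and> \<theta>' 0 q (e' 1 q) = 0 \<and> \<theta>' 1 q (e' 0 q) = 0 \<and> \<theta>' 1 q (e' 1 q) = 1"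
  proof -
    have "\<forall>\<^sub>F q in nhds p. H q = span {e 0 q, e 1 q} \<and>
      \<theta> 0 q (e 0 q) = 1 \<and> \<theta> 0 q (e 1 q) = 0 \<and> \<theta> 1 q (e 0 q) = 0 \<and> \<theta> 1 q (e 1 q) = 1"
      using F unfolding frame_H_def by blast
    then show ?thesis using h(2)
    proof eventually_elim
      case (elim q)
      have lin: "linear (\<theta> 0 q)" "linear (\<theta> 1 q)" using e lformsD(1) by blast+
      have hq: "h q \<noteq> 0" using elim(2) by auto
      have "span {h q *\<^sub>R e 0 q, e 1 q} = span {e 0 q, e 1 q}"
      proof (rule span_eq[THEN iffD2], safe)
        show "h q *\<^sub>R e 0 q \<in> span {e 0 q, e 1 q}" by (intro span_scale span_base) simp
        have "e 0 q = (1 / h q) *\<^sub>R (h q *\<^sub>R e 0 q)" using hq by simp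
        also have "\<dots> \<in> span {h q *\<^sub>R e 0 q, e 1 q}" by (intro span_scale span_base) simp
        finally show "e 0 q \<in> span {h q *\<^sub>R e 0 q, e 1 q}" .
      qed (auto intro: span_base)
      then show ?case
        using elim by (auto simp: e'_def \<theta>'_def linear_scale[OF lin(1)] linear_scale[OF lin(2)] mult.commute)
    qed
  qed
  moreover have "e' 0 \<in> GH" "e' 1 \<in> GH" "\<theta>' 0 \<in> lforms" "\<theta>' 1 \<in> lforms"
    using e h(1) lforms_scale[OF e(3) contact_smooth[OF c]] by (auto simp: e'_def \<theta>'_def)
  ultimately have "frame_H p e' \<theta>'" unfolding frame_H_def by blast
  moreover have "\<forall>\<^sub>F q in nhds p. \<alpha> q (lie_bracket (e' 0) (e' 1) q) = 1"
    using h(2)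
  proof eventually_elim
    case (elim q)
    have "lie_bracket (e' 0) (e' 1) q = h q *\<^sub>R ?c q - e 1 q h *\<^sub>R e 0 q"
      using bracket_fscale_left[of "e 1" "e 0" h] e h(1) by (simp add: e'_def)
    moreover have "?c q \<in> D2 q" "e 0 q \<in> H q" using c e sectionsD(2) by blast+
    moreover have "e 1 q h *\<^sub>R e 0 q \<in> H q" using calculation(3) subspace_scale[OF subspace_H] by blast
    moreover have "h q *\<^sub>R ?c q \<in> D2 q" using calculation(2) subspace_scale[OF subspace_D2] by blast
    moreover have "\<alpha> q (e 1 q h *\<^sub>R e 0 q) = 0" "e 1 q h *\<^sub>R e 0 q \<in> D2 q"
      using contact_H[OF calculation(4)] H_subset_D2 calculation(4) by auto
    ultimately show ?case
      using elim contact_diff[of "h q *\<^sub>R ?c q" q "e 1 q h *\<^sub>R e 0 q"] contact_scale[of "?c q" q "?c q" "h q"]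
      by simp
  qed
  ultimately show ?thesis by (rule that)
qed

end

section \<open>Adapted frames and the partial connection\<close>

lemma coset_eq_iff:
  fixes a b :: "'v::real_vector"
  assumes "subspace V"
  shows "a +o V = b +o V \<longleftrightarrow> a - b \<in> V"
proof
  assume *: "a +o V = b +o V"
  have "a \<in> a +o V" using subspace_0[OF assms] by (auto simp: elt_set_plus_def)
  then have "a \<in> b +o V" using * by simp
  then obtain v where "v \<in> V" "a = b + v" by (auto simp: elt_set_plus_def)
  then show "a - b \<in> V" by simp
next
  assume *: "a - b \<in> V"
  have "a +o V \<subseteq> b +o V" if "a - b \<in> V" for a b
    using that subspace_add[OF assms, of "a - b"] by (force simp: elt_set_plus_def algebra_simps)
  moreover have "b - a \<in> V" using subspace_neg[OF assms *] by simp
  ultimately show "a +o V = b +o V" using * by blast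
qed

lemma coset_eq_self_iff:
  fixes a :: "'v::real_vector"
  assumes "subspace V"
  shows "a +o V = V \<longleftrightarrow> a \<in> V"
  using coset_eq_iff[OF assms, of a 0] by (simp add: elt_set_plus_def)

lemma coset_plus:
  fixes a b :: "'v::real_vector"
  assumes "subspace V"
  shows "(a +o V) + (b +o V) = (a + b) +o V"
proof -
  have "V + V = V"
    using subspace_add[OF assms] subspace_0[OF assms] by (force simp: set_plus_def)
  then show ?thesis by (simp add: set_plus_rearrange)
qed

lemma eventually_nhds_nhds: "\<forall>\<^sub>F x in nhds p. P x \<Longrightarrow> \<forall>\<^sub>F q in nhds p. \<forall>\<^sub>F x in nhds q. P x"
  by (simp add: eventually_eventually)

context contact_distribution
begin

section \<open>Adapted frames of the tangent bundle\<close>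

lemma tangent_frame_independent:
  assumes span: "T p = span ((\<lambda>i. e i p) ` {..<5::nat})" and i: "i < 5"
  shows "e i p \<notin> span ((\<lambda>j. e j p) ` {..<i})"
proof
  let ?B = "(\<lambda>j. e j p) ` ({..<5} - {i})"
  assume "e i p \<in> span ((\<lambda>j. e j p) ` {..<i})"
  moreover have "(\<lambda>j. e j p) ` {..<i} \<subseteq> ?B" using i by auto
  ultimately have "e i p \<in> span ?B" using span_mono by blast
  moreover have "e j p \<in> span ?B" if "j < 5" "j \<noteq> i" for j
    using that by (intro span_base) auto
  ultimately have "(\<lambda>j. e j p) ` {..<5} \<subseteq> span ?B" by blast
  then have "T p \<subseteq> span ?B" unfolding span by (intro span_minimal subspace_span)
  moreover have "card ?B < 5"
    using card_image_le[of "{..<5} - {i}" "\<lambda>j. e j p"] i by simp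
  ultimately show False using T_not_span_4 by blast
qed

definition adapted_at where
  "adapted_at e \<theta> q \<longleftrightarrow> H q = span {e 0 q, e (1::nat) q} \<and> D2 q = span {e 0 q, e 1 q, e 2 q} \<and>
    T q = span ((\<lambda>i. e i q) ` {..<5}) \<and> \<alpha> q (e 2 q) = 1 \<and> \<alpha> q (lie_bracket (e 0) (e 1) q) = 1 \<and>
    (\<forall>i<5. \<forall>j<5. \<theta> i q (e j q) = (if i = j then 1 else 0))"

text \<open>\<open>e 2\<close> is left free instead of being \<open>[e 0, e 1]\<close>; the two
  agree modulo \<open>H\<close>. The Reeb field itself can then serve as \<open>e 2\<close>, while
  \<open>e 3\<close> and \<open>e 4\<close> represent the Levi brackets of \<open>e 0\<close> and
  \<open>e 1\<close> with the class of \<open>e 2\<close>.\<close>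

definition adapted_frame where
  "adapted_frame p e \<theta> \<longleftrightarrow> e 0 \<in> GH \<and> e (1::nat) \<in> GH \<and> e 2 \<in> G2 \<and>
    e 3 = lie_bracket (e 0) (e 2) \<and> e 4 = lie_bracket (e 1) (e 2) \<and>
    (\<forall>i<5. \<theta> i \<in> lforms) \<and> (\<forall>\<^sub>F q in nhds p. adapted_at e \<theta> q)"

text \<open>Near \<open>q\<close> the difference of \<open>c\<close> and \<open>[e 0, e 1]\<close>
  has values in \<open>H\<close>, so their brackets with \<open>e i\<close> differ by an element of
  \<open>D2\<close>. The normalizations are required near \<open>q\<close> and not only at
  \<open>q\<close> because these brackets differentiate the difference.\<close>

lemma span_change_base:
  assumes F: "frame_H q e \<theta>" and n: "\<forall>\<^sub>F q in nhds q. \<alpha> q (lie_bracket (e 0) (e 1) q) = 1"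
    and c: "c \<in> G2" "\<forall>\<^sub>F q in nhds q. \<alpha> q (c q) = 1"
  shows "D2 q = span {e 0 q, e 1 q, c q}"
    and "T q = span {e 0 q, e 1 q, c q, lie_bracket (e 0) c q, lie_bracket (e 1) c q}" (is "_ = span ?B")
proof -
  have e: "e 0 \<in> GH" "e 1 \<in> GH" using F unfolding frame_H_def by blast+
  have Hq: "H q = span {e 0 q, e 1 q}"
    using F eventually_nhds_x_imp_x unfolding frame_H_def by fast
  let ?c = "lie_bracket (e 0) (e 1)"
  have c0: "?c \<in> G2" using e by blast
  have ev: "\<forall>\<^sub>F q in nhds q. (?c - c) q \<in> H q"
    using n c(2)
  proof eventually_elim
    case (elim q)
    have "?c q \<in> D2 q" "c q \<in> D2 q" using c0 c(1) sectionsD(2) by blast+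
    then show ?case
      using contact_diff[of "?c q" q "c q"] contact_kernel[OF subspace_diff[OF subspace_D2]] elim by auto
  qed
  have d: "?c q - c q \<in> H q" using eventually_nhds_x_imp_x[OF ev] by simp
  have br: "lie_bracket (e i) ?c q - lie_bracket (e i) c q \<in> D2 q" if "e i \<in> GH" for i
  proof -
    have "lie_bracket (e i) (?c - c) q \<in> D2 q"
      by (rule bracket_locally_in_H[OF that vector_fields_diff[OF G2_VF[OF c0] G2_VF[OF c(1)]] ev])
    moreover have "lie_bracket (e i) ?c = lie_bracket (e i) (?c - c) + lie_bracket (e i) c"
      using bracket_add_right[of "e i" "?c - c" c] that c0 c by auto
    ultimately show ?thesis by simp
  qed
  have H1: "H q \<subseteq> span {e 0 q, e 1 q, c q}" unfolding Hq by (rule span_mono) auto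
  have c1: "?c q \<in> span {e 0 q, e 1 q, c q}"
  proof -
    have "?c q = (?c q - c q) + c q" by simp
    also have "\<dots> \<in> span {e 0 q, e 1 q, c q}"
      by (rule span_add[OF subsetD[OF H1 d] span_base]) simp
    finally show ?thesis .
  qed
  show D: "D2 q = span {e 0 q, e 1 q, c q}"
  proof
    show "D2 q \<subseteq> span {e 0 q, e 1 q, c q}"
      unfolding frame_H_D2[OF F] using c1 by (intro span_minimal subspace_span) (auto intro: span_base)
    show "span {e 0 q, e 1 q, c q} \<subseteq> D2 q"
      using e c sectionsD(2)[OF GH_G2] sectionsD(2)[of c D2] by (intro span_minimal subspace_D2) auto
  qed
  have D_B: "D2 q \<subseteq> span ?B" unfolding D by (rule span_mono) auto
  have "lie_bracket (e i) ?c q \<in> span ?B" if "e i \<in> GH" "lie_bracket (e i) c q \<in> ?B" for i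
  proof -
    have "lie_bracket (e i) ?c q = (lie_bracket (e i) ?c q - lie_bracket (e i) c q) + lie_bracket (e i) c q"
      by simp
    also have "\<dots> \<in> span ?B"
      by (rule span_add[OF subsetD[OF D_B br[OF that(1)]] span_base[OF that(2)]])
    finally show ?thesis .
  qed
  moreover have "?c q \<in> span ?B" using c1 D D_B by blast
  ultimately have "T q \<subseteq> span ?B"
    unfolding frame_H_T[OF F refl] using e by (intro span_minimal subspace_span) (auto intro: span_base)
  moreover have "span ?B \<subseteq> T q"
    using e c by (intro span_minimal subspace_tangent_space) (auto intro!: vector_fieldsD(1))
  ultimately show "T q = span ?B" by blast
qed

lemma adapted_frame_exists:
  assumes c: "c \<in> G2" "\<forall>\<^sub>F q in nhds p. \<alpha> q (c q) = 1"
  obtains e \<theta> where "adapted_frame p e \<theta>" "e 2 = c"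
proof -
  obtain f \<phi> where F: "frame_H p f \<phi>" and n: "\<forall>\<^sub>F q in nhds p. \<alpha> q (lie_bracket (f 0) (f 1) q) = 1"
    by (rule normalized_frame_H_exists)
  have f: "f 0 \<in> GH" "f 1 \<in> GH" using F unfolding frame_H_def by blast+
  define e where "e i = (if i = 2 then c else if i = 3 then lie_bracket (f 0) c
    else if i = 4 then lie_bracket (f 1) c else f i)" for i :: nat
  have e: "e 0 = f 0" "e 1 = f 1" "e 2 = c" "e 3 = lie_bracket (f 0) c" "e 4 = lie_bracket (f 1) c"
    by (auto simp: e_def)
  have ev: "\<forall>\<^sub>F q in nhds p. H q = span {e 0 q, e (1::nat) q} \<and> D2 q = span {e 0 q, e 1 q, e 2 q} \<and>
      T q = span ((\<lambda>i. e i q) ` {..<5}) \<and> \<alpha> q (e 2 q) = 1 \<and> \<alpha> q (lie_bracket (e 0) (e 1) q) = 1"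
    using frame_H_eventually[OF F] eventually_nhds_nhds[OF n] eventually_nhds_nhds[OF c(2)]
  proof eventually_elim
    case (elim q)
    have "H q = span {f 0 q, f 1 q}"
      using elim(1) eventually_nhds_x_imp_x unfolding frame_H_def by fast
    moreover note span_change_base[OF elim(1,2) c(1) elim(3)]
    moreover have "\<alpha> q (c q) = 1" "\<alpha> q (lie_bracket (f 0) (f 1) q) = 1"
      using elim(2,3) by (auto dest: eventually_nhds_x_imp_x)
    ultimately show ?case by (simp add: lessThan_2_3_5 e)
  qed
  then have "T p = span ((\<lambda>i. e i p) ` {..<5})" using eventually_nhds_x_imp_x by fast
  then have "e i p \<notin> span ((\<lambda>j. e j p) ` {..<i})" if "i < 5" for i
    using tangent_frame_independent that by blast
  note indep = this
  have "e i \<in> VF" if "i < 5" for i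
    using that f c(1) by (auto simp: less_5_cases e)
  from this indep obtain \<theta> where \<theta>: "\<And>i. i < 5 \<Longrightarrow> \<theta> i \<in> lforms"
    "\<forall>\<^sub>F q in nhds p. \<forall>i<5. \<forall>j<5. \<theta> i q (e j q) = (if i = j then 1 else 0)"
    by (rule dual_coframe[of 5 e p]) blast+
  have "\<forall>\<^sub>F q in nhds p. adapted_at e \<theta> q"
    using ev \<theta>(2) by eventually_elim (simp add: adapted_at_def)
  then have "adapted_frame p e \<theta>"
    unfolding adapted_frame_def using f c(1) \<theta>(1) by (simp add: e)
  then show ?thesis using that e(3) by blast
qed

lemma base_section_exists:
  obtains c where "c \<in> G2" "\<forall>\<^sub>F q in nhds p. \<alpha> q (c q) = 1"
proof -
  obtain e \<theta> where F: "frame_H p e \<theta>" and n: "\<forall>\<^sub>F q in nhds p. \<alpha> q (lie_bracket (e 0) (e 1) q) = 1"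
    by (rule normalized_frame_H_exists)
  have "lie_bracket (e 0) (e 1) \<in> G2" using F unfolding frame_H_def by blast
  then show ?thesis using n by (rule that)
qed

lemma adapted_frame_eventually: "adapted_frame p e \<theta> \<Longrightarrow> \<forall>\<^sub>F q in nhds p. adapted_frame q e \<theta>"
  unfolding adapted_frame_def using eventually_eventually[of _ p] by auto

context
  fixes p e \<theta>
  assumes F: "adapted_frame p e \<theta>"
begin

lemma adapted_frameD:
  "e 0 \<in> GH" "e 1 \<in> GH" "e 2 \<in> G2" "e 3 = lie_bracket (e 0) (e 2)" "e 4 = lie_bracket (e 1) (e 2)"
  using F unfolding adapted_frame_def by blast+

lemma adapted_frame_fields: "i < 5 \<Longrightarrow> e i \<in> VF"
  using adapted_frameD by (auto simp: less_5_cases)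

lemma adapted_frame_forms: "i < 5 \<Longrightarrow> \<theta> i \<in> lforms"
  using F unfolding adapted_frame_def by blast

lemma adapted_frame_linear: "i < 5 \<Longrightarrow> linear (\<theta> i q)"
  using lformsD(1)[OF adapted_frame_forms] .

lemma adapted_frame_at: "adapted_at e \<theta> p"
  using F eventually_nhds_x_imp_x unfolding adapted_frame_def by fast

lemma adapted_frame_dual: "i < 5 \<Longrightarrow> j < 5 \<Longrightarrow> \<theta> i p (e j p) = (if i = j then 1 else 0)"
  using adapted_frame_at unfolding adapted_at_def by blast

lemma adapted_frame_contact: "\<alpha> p (e 2 p) = 1" "\<alpha> p (lie_bracket (e 0) (e 1) p) = 1"
  using adapted_frame_at unfolding adapted_at_def by blast+

lemma adapted_frame_frame_H: "frame_H p e \<theta>"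
proof -
  have "\<forall>\<^sub>F q in nhds p. adapted_at e \<theta> q" using F unfolding adapted_frame_def by blast
  then have "\<forall>\<^sub>F q in nhds p. H q = span {e 0 q, e 1 q} \<and>
      \<theta> 0 q (e 0 q) = 1 \<and> \<theta> 0 q (e 1 q) = 0 \<and> \<theta> 1 q (e 0 q) = 0 \<and> \<theta> 1 q (e 1 q) = 1"
    by eventually_elim (simp add: adapted_at_def)
  then show ?thesis
    unfolding frame_H_def using adapted_frameD adapted_frame_forms[of 0] adapted_frame_forms[of 1] by simp
qed

lemma adapted_frame_expansion: "v \<in> T p \<Longrightarrow> v = (\<Sum>i<5. \<theta> i p v *\<^sub>R e i p)"
  by (rule coframe_expansion)
    (use adapted_frame_linear adapted_frame_dual adapted_frame_at in \<open>auto simp: adapted_at_def\<close>)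

lemma adapted_frame_span_zero:
  assumes "i < 5" "\<And>j. j \<in> J \<Longrightarrow> j < 5 \<and> j \<noteq> i" "v \<in> span ((\<lambda>j. e j p) ` J)"
  shows "\<theta> i p v = 0"
proof (rule linear_eq_0_on_span[OF adapted_frame_linear[OF assms(1)] _ assms(3)])
  fix x assume "x \<in> (\<lambda>j. e j p) ` J"
  then obtain j where "j \<in> J" "x = e j p" by blast
  then show "\<theta> i p x = 0" using assms(1) assms(2)[of j] adapted_frame_dual[of i j] by auto
qed

lemma adapted_frame_D2_iff: "v \<in> T p \<Longrightarrow> v \<in> D2 p \<longleftrightarrow> \<theta> 3 p v = 0 \<and> \<theta> 4 p v = 0"
proof
  assume "v \<in> D2 p"
  then have "v \<in> span ((\<lambda>j. e j p) ` {0, 1, 2})"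
    using adapted_frame_at unfolding adapted_at_def by simp
  then show "\<theta> 3 p v = 0 \<and> \<theta> 4 p v = 0"
    by (intro conjI adapted_frame_span_zero[of _ "{0, 1, 2}"]) auto
next
  assume "v \<in> T p" and z: "\<theta> 3 p v = 0 \<and> \<theta> 4 p v = 0"
  then have v: "v = \<theta> 0 p v *\<^sub>R e 0 p + (\<theta> 1 p v *\<^sub>R e 1 p + \<theta> 2 p v *\<^sub>R e 2 p)"
    using adapted_frame_expansion[of v] by (simp add: lessThan_2_3_5)
  have "\<theta> 0 p v *\<^sub>R e 0 p + (\<theta> 1 p v *\<^sub>R e 1 p + \<theta> 2 p v *\<^sub>R e 2 p) \<in> D2 p"
    using adapted_frameD sectionsD(2)[OF GH_G2] sectionsD(2)[of _ D2]
    by (intro subspace_add subspace_scale subspace_D2) auto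
  then show "v \<in> D2 p" using v by simp
qed

lemma adapted_frame_H: "v \<in> H p \<Longrightarrow> \<theta> 2 p v = 0 \<and> \<theta> 3 p v = 0 \<and> \<theta> 4 p v = 0"
proof -
  assume "v \<in> H p"
  then have "v \<in> span ((\<lambda>j. e j p) ` {0, 1})"
    using adapted_frame_at unfolding adapted_at_def by simp
  then show ?thesis
    by (intro conjI adapted_frame_span_zero[of _ "{0, 1}"]) auto
qed

lemma adapted_frame_H_expansion: "v \<in> H p \<Longrightarrow> v = \<theta> 0 p v *\<^sub>R e 0 p + \<theta> 1 p v *\<^sub>R e 1 p"
  by (rule frame_H_expansion[OF adapted_frame_frame_H])

lemma adapted_frame_contact_form: "v \<in> D2 p \<Longrightarrow> \<alpha> p v = \<theta> 2 p v"
proof -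
  assume v: "v \<in> D2 p"
  then have z: "\<theta> 3 p v = 0" "\<theta> 4 p v = 0" and vT: "v \<in> T p"
    using adapted_frame_D2_iff D2_subset_T by auto
  have e: "e 0 p \<in> H p" "e 1 p \<in> H p" "e 2 p \<in> D2 p" using adapted_frameD sectionsD(2) by auto
  let ?h = "\<theta> 0 p v *\<^sub>R e 0 p + \<theta> 1 p v *\<^sub>R e 1 p"
  have h: "?h \<in> H p" using e by (intro subspace_add subspace_scale subspace_H)
  have "v = ?h + \<theta> 2 p v *\<^sub>R e 2 p"
    using adapted_frame_expansion[OF vT] z by (simp add: lessThan_2_3_5 algebra_simps)
  then have "\<alpha> p v = \<alpha> p (?h + \<theta> 2 p v *\<^sub>R e 2 p)" by simp
  also have "\<dots> = \<alpha> p ?h + \<theta> 2 p v * \<alpha> p (e 2 p)"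
    using h e H_subset_D2 subspace_scale[OF subspace_D2]
    by (subst contact_add) (auto simp: contact_scale[of _ _ "e 2 p"])
  finally show ?thesis using contact_H[OF h] adapted_frame_contact by simp
qed

lemma adapted_frame_D2_expansion:
  "v \<in> D2 p \<Longrightarrow> v = \<theta> 0 p v *\<^sub>R e 0 p + \<theta> 1 p v *\<^sub>R e 1 p + \<alpha> p v *\<^sub>R e 2 p"
  using adapted_frame_expansion[of v] adapted_frame_D2_iff[of v] D2_subset_T adapted_frame_contact_form[of v]
  by (auto simp: lessThan_2_3_5 algebra_simps)

text \<open>The normalization makes \<open>e 0\<close>, \<open>e 1\<close> a symplectic basis, in
  which the Levi form is the standard area form.\<close>

lemma adapted_frame_levi_form:
  assumes "\<xi> \<in> GH" "\<eta> \<in> GH"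
  shows "\<alpha> p (lie_bracket \<xi> \<eta> p) = \<theta> 0 p (\<xi> p) * \<theta> 1 p (\<eta> p) - \<theta> 1 p (\<xi> p) * \<theta> 0 p (\<eta> p)"
proof -
  have e: "e 0 p \<in> H p" "e 1 p \<in> H p" "lie_bracket (e 0) (e 1) p \<in> D2 p"
    using adapted_frameD sectionsD(2) GH_bracket_G2 by blast+
  have "\<theta> 2 p (e 0 p) = 0" "\<theta> 2 p (e 1 p) = 0" "\<theta> 2 p (lie_bracket (e 0) (e 1) p) = 1"
    using adapted_frame_H e adapted_frame_contact_form[OF e(3)] adapted_frame_contact by auto
  moreover have "\<alpha> p (lie_bracket \<xi> \<eta> p) = \<theta> 2 p (lie_bracket \<xi> \<eta> p)"
    using adapted_frame_contact_form sectionsD(2)[OF GH_bracket_G2[OF assms]] by blast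
  moreover have "linear (\<theta> 2 p)" by (rule adapted_frame_linear) simp
  ultimately show ?thesis
    by (simp add: frame_H_bracket[OF adapted_frame_frame_H assms] linear_add linear_scale)
qed

text \<open>Modulo \<open>D2\<close> the bracket is tensorial in both arguments: it is the Levi
  bracket into \<open>gr_-3\<close>. Since \<open>e (3 + i) = [e i, e 2]\<close>, the forms
  \<open>\<theta> 3\<close> and \<open>\<theta> 4\<close> return the two coefficients of
  \<open>\<xi>\<close>, times \<open>\<alpha>(Z)\<close>.\<close>

lemma adapted_frame_bracket:
  assumes xi: "\<xi> \<in> GH" and Z: "Z \<in> G2"
  shows "\<theta> 3 p (lie_bracket \<xi> Z p) = \<theta> 0 p (\<xi> p) * \<alpha> p (Z p)"
    and "\<theta> 4 p (lie_bracket \<xi> Z p) = \<theta> 1 p (\<xi> p) * \<alpha> p (Z p)"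
proof -
  define z where "z j = (if j = 2 then (\<lambda>q. \<alpha> q (Z q)) else (\<lambda>q. \<theta> j q (Z q)))" for j :: nat
  have "\<forall>\<^sub>F q in nhds p. Z q = (\<Sum>j\<in>{..<3}. z j q *\<^sub>R e j q)"
    using adapted_frame_eventually[OF F]
  proof eventually_elim
    case (elim q)
    show ?case
      using contact_distribution.adapted_frame_D2_expansion[OF contact_distribution_axioms elim sectionsD(2)[OF Z]]
      by (simp add: z_def lessThan_2_3_5 algebra_simps)
  qed
  moreover have "\<forall>\<^sub>F q in nhds p. \<xi> q = (\<Sum>i\<in>{..<2}. \<theta> i q (\<xi> q) *\<^sub>R e i q)"
    using frame_H_eventually[OF adapted_frame_frame_H]
    by eventually_elim (use frame_H_expansion sectionsD(2)[OF xi] in \<open>auto simp: lessThan_2_3_5\<close>)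
  moreover have "z j \<in> S \<and> e j \<in> VF" if "j \<in> {..<3}" for j
    using that lformsD(2)[OF adapted_frame_forms] contact_smooth[OF Z] Z adapted_frame_fields[of j]
    by (auto simp: z_def lessThan_2_3_5)
  moreover have "(\<lambda>q. \<theta> i q (\<xi> q)) \<in> S \<and> e i \<in> VF" if "i \<in> {..<2}" for i
    using that lformsD(2)[OF adapted_frame_forms[of i]] xi adapted_frame_fields[of i] by auto
  ultimately have "lie_bracket \<xi> Z p = (\<Sum>i<2. \<Sum>j<3. (\<theta> i p (\<xi> p) * z j p) *\<^sub>R lie_bracket (e i) (e j) p)
    + (\<Sum>j<3. \<xi> p (z j) *\<^sub>R e j p) - (\<Sum>i<2. Z p (\<lambda>q. \<theta> i q (\<xi> q)) *\<^sub>R e i p)"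
    using xi Z by (intro bracket_combination) auto
  \<comment> \<open>Of the frame brackets only those with \<open>e 2\<close> leave
    \<open>D2\<close>.\<close>
  moreover have "\<theta> k p (lie_bracket (e i) (e j) p) = (if j = 2 \<and> k = 3 + i then 1 else 0)"
    if "i < 2" "j < 3" "k = 3 \<or> k = 4" for i j k
  proof (cases "j = 2")
    case True
    have "lie_bracket (e i) (e j) p = e (3 + i) p"
      using that(1) True adapted_frameD(4,5) by (auto simp: less_2_cases')
    then show ?thesis using that adapted_frame_dual[of k "3 + i"] True by auto
  next
    case False
    then have "e i \<in> GH" "e j \<in> GH" using that adapted_frameD by (auto simp: less_2_cases' less_3_cases)
    then have "lie_bracket (e i) (e j) p \<in> D2 p" using sectionsD(2)[OF GH_bracket_G2] by blast
    then show ?thesis using that False adapted_frame_D2_iff D2_subset_T by auto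
  qed
  moreover have "linear (\<theta> 3 p)" "linear (\<theta> 4 p)" by (rule adapted_frame_linear, simp)+
  ultimately show "\<theta> 3 p (lie_bracket \<xi> Z p) = \<theta> 0 p (\<xi> p) * \<alpha> p (Z p)"
    "\<theta> 4 p (lie_bracket \<xi> Z p) = \<theta> 1 p (\<xi> p) * \<alpha> p (Z p)"
    by (simp_all add: linear_add linear_diff linear_scale lessThan_2_3_5 adapted_frame_dual z_def)
qed

end

text \<open>\<open>solve r X\<close> is the section \<open>\<xi>\<close> of \<open>H\<close> with \<open>[\<xi>, r] = X\<close> modulo \<open>D2\<close>; since this condition is tensorial
  in \<open>\<xi>\<close>, it can be imposed pointwise.\<close>

definition solve :: "'a vfield \<Rightarrow> 'a vfield \<Rightarrow> 'a vfield" where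
  "solve r X = (\<lambda>p. THE v. \<exists>Z\<in>GH. Z p = v \<and> lie_bracket Z r p - X p \<in> D2 p)"

text \<open>The frame may have any \<open>e 2\<close>: modulo \<open>D2\<close> the bracket
  \<open>[Z, r]\<close> depends on \<open>r\<close> only through \<open>\<alpha>(r) = 1\<close>.
  Solving amounts to copying the coordinates 3 and 4 to the positions 0 and 1.\<close>

lemma solve_frame:
  assumes F: "adapted_frame p e \<theta>" and r: "r \<in> G2" "\<alpha> p (r p) = 1" and X: "X \<in> VF"
  shows "solve r X p = \<theta> 3 p (X p) *\<^sub>R e 0 p + \<theta> 4 p (X p) *\<^sub>R e 1 p"
proof -
  note fr = adapted_frameD[OF F]
  have lin: "linear (\<theta> i p)" if "i < 5" for i by (rule adapted_frame_linear[OF F that])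
  have iff: "lie_bracket Z r p - X p \<in> D2 p \<longleftrightarrow> \<theta> 0 p (Z p) = \<theta> 3 p (X p) \<and> \<theta> 1 p (Z p) = \<theta> 4 p (X p)"
    if "Z \<in> GH" for Z
  proof -
    have "lie_bracket Z r p - X p \<in> T p"
      using that r X by (intro subspace_diff[OF subspace_tangent_space] vector_fieldsD(1)) auto
    then show ?thesis
      using adapted_frame_D2_iff[OF F] adapted_frame_bracket[OF F that r(1)] r(2)
      by (auto simp: linear_diff[OF lin])
  qed
  let ?Z = "\<theta> 3 p (X p) *\<^sub>R e 0 + \<theta> 4 p (X p) *\<^sub>R e 1"
  show ?thesis
    unfolding solve_def
  proof (rule the_equality)
    have "?Z \<in> GH" using fr by blast
    moreover have "\<theta> 0 p (?Z p) = \<theta> 3 p (X p)" "\<theta> 1 p (?Z p) = \<theta> 4 p (X p)"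
      by (simp_all add: linear_add[OF lin] linear_scale[OF lin] adapted_frame_dual[OF F])
    ultimately have "lie_bracket ?Z r p - X p \<in> D2 p" using iff by blast
    then show "\<exists>Z\<in>GH. Z p = \<theta> 3 p (X p) *\<^sub>R e 0 p + \<theta> 4 p (X p) *\<^sub>R e 1 p \<and> lie_bracket Z r p - X p \<in> D2 p"
      using \<open>?Z \<in> GH\<close> by (intro bexI[of _ ?Z]) auto
  next
    fix v assume "\<exists>Z\<in>GH. Z p = v \<and> lie_bracket Z r p - X p \<in> D2 p"
    then obtain Z where Z: "Z \<in> GH" "Z p = v" "lie_bracket Z r p - X p \<in> D2 p" by blast
    then show "v = \<theta> 3 p (X p) *\<^sub>R e 0 p + \<theta> 4 p (X p) *\<^sub>R e 1 p"
      using adapted_frame_H_expansion[OF F sectionsD(2)[OF Z(1)]] iff[OF Z(1)] by simp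
  qed
qed

section \<open>Inverting the Levi bracket with a normalized section\<close>

definition normalized :: "'a vfield \<Rightarrow> bool" where
  "normalized r \<longleftrightarrow> r \<in> G2 \<and> (\<forall>p. \<alpha> p (r p) = 1)"

lemma normalizedD: "normalized r \<Longrightarrow> r \<in> G2" "normalized r \<Longrightarrow> \<alpha> p (r p) = 1" "normalized r \<Longrightarrow> r \<in> VF"
  by (auto simp: normalized_def)

lemma normalized_frame:
  assumes "normalized r"
  obtains e \<theta> where "adapted_frame p e \<theta>" "e 2 = r"
  by (rule adapted_frame_exists[OF normalizedD(1)[OF assms], of p]) (simp add: normalizedD(2)[OF assms], rule that)

context
  fixes r
  assumes r: "normalized r"
begin

lemma solve_GH [simp, intro]:
  assumes X: "X \<in> VF"
  shows "solve r X \<in> GH"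
proof (rule sectionsI)
  have *: "\<exists>Z\<in>GH. \<forall>\<^sub>F q in nhds p. solve r X q = Z q" for p
  proof -
    obtain e \<theta> where F: "adapted_frame p e \<theta>" using normalized_frame[OF r] by metis
    let ?Z = "fscale (\<lambda>q. \<theta> 3 q (X q)) (e 0) + fscale (\<lambda>q. \<theta> 4 q (X q)) (e 1)"
    have "?Z \<in> GH"
      using adapted_frameD[OF F] lformsD(2)[OF adapted_frame_forms[OF F, of 3] X]
        lformsD(2)[OF adapted_frame_forms[OF F, of 4] X] by auto
    moreover have "\<forall>\<^sub>F q in nhds p. solve r X q = ?Z q"
      using adapted_frame_eventually[OF F]
      by eventually_elim (simp add: solve_frame normalizedD[OF r] X)
    ultimately show ?thesis by blast
  qed
  then show "solve r X \<in> VF" by (intro vector_fields_local) (use sectionsD in blast)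
  show "solve r X p \<in> H p" for p
  proof -
    obtain Z where Z: "Z \<in> GH" "\<forall>\<^sub>F q in nhds p. solve r X q = Z q" using * by blast
    then have "solve r X p = Z p" using eventually_nhds_x_imp_x by fast
    then show ?thesis using sectionsD(2)[OF Z(1)] by simp
  qed
qed

lemma solve_cong:
  assumes "X \<in> VF" "Y \<in> VF" "X p - Y p \<in> D2 p"
  shows "solve r X p = solve r Y p"
proof -
  obtain e \<theta> where F: "adapted_frame p e \<theta>" using normalized_frame[OF r] by metis
  have "\<theta> 3 p (X p - Y p) = 0" "\<theta> 4 p (X p - Y p) = 0"
    using adapted_frame_D2_iff[OF F] assms(3) D2_subset_T by blast+
  then have "\<theta> 3 p (X p) = \<theta> 3 p (Y p)" "\<theta> 4 p (X p) = \<theta> 4 p (Y p)"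
    using linear_diff[OF adapted_frame_linear[OF F]] by auto
  then show ?thesis using solve_frame[OF F] normalizedD[OF r] assms by simp
qed

lemma solve_add: "X \<in> VF \<Longrightarrow> Y \<in> VF \<Longrightarrow> solve r (X + Y) = solve r X + solve r Y"
proof
  fix p assume X: "X \<in> VF" "Y \<in> VF"
  obtain e \<theta> where F: "adapted_frame p e \<theta>" using normalized_frame[OF r] by metis
  show "solve r (X + Y) p = (solve r X + solve r Y) p"
    using X by (simp add: solve_frame[OF F] normalizedD[OF r] linear_add[OF adapted_frame_linear[OF F]] algebra_simps)
qed

lemma solve_fscale: "X \<in> VF \<Longrightarrow> h \<in> S \<Longrightarrow> solve r (fscale h X) = fscale h (solve r X)"
proof
  fix p assume X: "X \<in> VF" "h \<in> S"
  obtain e \<theta> where F: "adapted_frame p e \<theta>" using normalized_frame[OF r] by metis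
  show "solve r (fscale h X) p = fscale h (solve r X) p"
    using X by (simp add: solve_frame[OF F] normalizedD[OF r] linear_scale[OF adapted_frame_linear[OF F]] algebra_simps)
qed

lemma solve_bracket: "\<xi> \<in> GH \<Longrightarrow> solve r (lie_bracket \<xi> r) = \<xi>"
proof
  fix p assume X: "\<xi> \<in> GH"
  obtain e \<theta> where F: "adapted_frame p e \<theta>" using normalized_frame[OF r] by metis
  show "solve r (lie_bracket \<xi> r) p = \<xi> p"
    using X adapted_frame_H_expansion[OF F sectionsD(2)[OF X]]
    by (simp add: solve_frame[OF F] normalizedD[OF r] adapted_frame_bracket[OF F])
qed

lemma bracket_solve: "X \<in> VF \<Longrightarrow> lie_bracket (solve r X) r p - X p \<in> D2 p"
proof -
  assume X: "X \<in> VF"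
  obtain e \<theta> where F: "adapted_frame p e \<theta>" using normalized_frame[OF r] by metis
  have Z: "solve r X \<in> GH" using X by (rule solve_GH)
  have "\<theta> 0 p (solve r X p) = \<theta> 3 p (X p)" "\<theta> 1 p (solve r X p) = \<theta> 4 p (X p)"
    using X by (simp_all add: solve_frame[OF F] normalizedD[OF r] linear_scale[OF adapted_frame_linear[OF F]]
      linear_add[OF adapted_frame_linear[OF F]] adapted_frame_dual[OF F])
  moreover have "lie_bracket (solve r X) r p - X p \<in> T p"
    using Z normalizedD[OF r] X by (intro subspace_diff[OF subspace_tangent_space] vector_fieldsD(1)) auto
  ultimately show ?thesis
    using adapted_frame_bracket[OF F Z normalizedD(1)[OF r]] normalizedD(2)[OF r]
    by (simp add: adapted_frame_D2_iff[OF F] linear_diff[OF adapted_frame_linear[OF F]])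
qed

lemma solve_unique:
  assumes "X \<in> VF" "\<delta> \<in> GH" "\<And>p. lie_bracket \<delta> r p - X p \<in> D2 p"
  shows "\<delta> = solve r X"
proof -
  have "solve r (lie_bracket \<delta> r) = solve r X"
    by (rule ext, rule solve_cong) (use assms normalizedD[OF r] in auto)
  then show ?thesis using solve_bracket assms(2) by simp
qed

end

section \<open>The partial connection as a solution of a Levi bracket equation\<close>

lemma q2_eq_iff: "q2 H X = q2 H Y \<longleftrightarrow> (\<forall>p. X p - Y p \<in> H p)"
  unfolding q2_def by (simp add: fun_eq_iff coset_eq_iff[OF subspace_H])

lemma q3_eq_iff: "q3 A H X = q3 A H Y \<longleftrightarrow> (\<forall>p. X p - Y p \<in> D2 p)"
  unfolding q3_def by (simp add: fun_eq_iff coset_eq_iff[OF subspace_D2])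

text \<open>Two sections of \<open>D2\<close> with the same class in \<open>gr_-2\<close> differ by
  a section of \<open>H\<close>, whose bracket with \<open>\<xi>\<close> stays in \<open>D2\<close>;
  so the description in \<open>levi2\<close> does not depend on the representative.\<close>

lemma levi2_q2:
  assumes "\<xi> \<in> GH" "r \<in> G2"
  shows "levi2 A H \<xi> (q2 H r) = q3 A H (lie_bracket \<xi> r)"
  unfolding levi2_def
proof (rule the_equality)
  show "\<exists>\<zeta>\<in>G2. q2 H \<zeta> = q2 H r \<and> q3 A H (lie_bracket \<xi> r) = q3 A H (lie_bracket \<xi> \<zeta>)"
    using assms by blast
next
  fix \<tau> assume "\<exists>\<zeta>\<in>G2. q2 H \<zeta> = q2 H r \<and> \<tau> = q3 A H (lie_bracket \<xi> \<zeta>)"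
  then obtain \<zeta> where z: "\<zeta> \<in> G2" "q2 H \<zeta> = q2 H r" "\<tau> = q3 A H (lie_bracket \<xi> \<zeta>)" by blast
  have d: "\<zeta> - r \<in> GH" using z(1,2) assms(2) by (intro sectionsI) (auto simp: q2_eq_iff)
  have "lie_bracket \<xi> \<zeta> = lie_bracket \<xi> (\<zeta> - r) + lie_bracket \<xi> r"
    using bracket_add_right[of \<xi> "\<zeta> - r" r] assms z(1) by auto
  then show "\<tau> = q3 A H (lie_bracket \<xi> r)"
    unfolding z(3) q3_eq_iff using sectionsD(2)[OF GH_bracket_G2[OF assms(1) d]] by simp
qed

text \<open>Both \<open>nabla\<close> and \<open>Psi\<close> are descriptions of this shape. They
  become instances of \<open>solve\<close>, for which smoothness and tensoriality are known.\<close>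

lemma the_levi2_solve:
  assumes r: "normalized r" and X: "X \<in> VF"
  shows "(THE \<delta>. \<delta> \<in> GH \<and> levi2 A H \<delta> (q2 H r) = q3 A H X) = solve r X"
proof (rule the_equality)
  show "solve r X \<in> GH \<and> levi2 A H (solve r X) (q2 H r) = q3 A H X"
    using solve_GH[OF r X] bracket_solve[OF r X] levi2_q2 normalizedD(1)[OF r] by (simp add: q3_eq_iff)
next
  fix \<delta> assume "\<delta> \<in> GH \<and> levi2 A H \<delta> (q2 H r) = q3 A H X"
  then show "\<delta> = solve r X"
    using levi2_q2 normalizedD(1)[OF r] by (intro solve_unique[OF r X]) (auto simp: q3_eq_iff)
qed

lemma nabla_eq_solve:
  assumes "normalized r" "\<xi> \<in> GH" "\<eta> \<in> GH"
  shows "nabla A H r \<xi> \<eta> = solve r (lie_bracket \<xi> (lie_bracket \<eta> r))"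
  unfolding nabla_def using assms normalizedD[OF assms(1)] by (intro the_levi2_solve) auto

end

section \<open>The Reeb field\<close>

context contact_distribution
begin

text \<open>The trace of the connection form: by \<open>solve_frame\<close>, the forms
  \<open>\<theta> 3\<close> and \<open>\<theta> 4\<close> of \<open>[\<gamma>, [e i, r]]\<close> are
  the components of \<open>\<nabla>\<^sub>\<gamma> e i\<close>. The trace is what acts on the second
  exterior power of \<open>H\<close>, that is, on \<open>gr_-2\<close>.\<close>

definition frame_trace where
  "frame_trace e \<theta> r \<gamma> q =
     \<theta> 3 q (lie_bracket \<gamma> (lie_bracket (e 0) r) q) + \<theta> (4::nat) q (lie_bracket \<gamma> (lie_bracket (e (1::nat)) r) q)"

context
  fixes p e \<theta>
  assumes F: "adapted_frame p e \<theta>"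
begin

text \<open>The Leibniz rule of the partial connection in coordinates. Differentiating the
  coefficients of \<open>\<xi>\<close> along \<open>r\<close> produces the section \<open>K\<close>
  of \<open>H\<close>; its bracket with \<open>\<gamma>\<close> lies in \<open>D2\<close> and is
  invisible to \<open>\<theta> 3\<close> and \<open>\<theta> 4\<close>. Only the derivative along
  \<open>\<gamma>\<close> survives.\<close>

lemma frame_iterated_bracket:
  assumes r: "r \<in> G2" "\<alpha> p (r p) = 1" and g: "\<gamma> \<in> GH" and x: "\<xi> \<in> GH"
  shows "\<theta> 3 p (lie_bracket \<gamma> (lie_bracket \<xi> r) p) =
      \<theta> 0 p (\<xi> p) * \<theta> 3 p (lie_bracket \<gamma> (lie_bracket (e 0) r) p)
      + \<theta> 1 p (\<xi> p) * \<theta> 3 p (lie_bracket \<gamma> (lie_bracket (e 1) r) p) + \<gamma> p (\<lambda>q. \<theta> 0 q (\<xi> q))" (is ?A)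
    and "\<theta> 4 p (lie_bracket \<gamma> (lie_bracket \<xi> r) p) =
      \<theta> 0 p (\<xi> p) * \<theta> 4 p (lie_bracket \<gamma> (lie_bracket (e 0) r) p)
      + \<theta> 1 p (\<xi> p) * \<theta> 4 p (lie_bracket \<gamma> (lie_bracket (e 1) r) p) + \<gamma> p (\<lambda>q. \<theta> 1 q (\<xi> q))" (is ?B)
proof -
  note fr = adapted_frameD[OF F]
  define x0 x1 where "x0 = (\<lambda>q. \<theta> 0 q (\<xi> q))" and "x1 = (\<lambda>q. \<theta> 1 q (\<xi> q))"
  have xS: "x0 \<in> S" "x1 \<in> S"
    using x lformsD(2)[OF adapted_frame_forms[OF F]] by (auto simp: x0_def x1_def)
  have rx: "(\<lambda>q. r q x0) \<in> S" "(\<lambda>q. r q x1) \<in> S"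
    using vector_fieldsD(2) r xS by blast+
  let ?E0 = "lie_bracket (e 0) r" and ?E1 = "lie_bracket (e 1) r"
  define K where "K = fscale (\<lambda>q. r q x0) (e 0) + fscale (\<lambda>q. r q x1) (e 1)"
  let ?X = "fscale x0 (e 0) + fscale x1 (e 1)"
  have VF: "?E0 \<in> VF" "?E1 \<in> VF" "e 0 \<in> VF" "e 1 \<in> VF" "r \<in> VF" "\<gamma> \<in> VF" using fr r g by auto
  have K: "K \<in> GH" unfolding K_def using fr rx by auto
  have br: "lie_bracket ?X r = (fscale x0 ?E0 + fscale x1 ?E1) - K"
    unfolding K_def using VF xS by (simp add: bracket_add_left bracket_fscale_left algebra_simps)
  have "\<forall>\<^sub>F q in nhds p. \<xi> q = ?X q"
    using adapted_frame_eventually[OF F]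
  proof eventually_elim
    case (elim q)
    show ?case using adapted_frame_H_expansion[OF elim sectionsD(2)[OF x]] by (simp add: x0_def x1_def)
  qed
  from eventually_nhds_nhds[OF this] have "\<forall>\<^sub>F q in nhds p. lie_bracket \<xi> r q = lie_bracket ?X r q"
    by (rule eventually_mono) (rule bracket_local_left, use VF x fr xS in auto)
  then have "lie_bracket \<gamma> (lie_bracket \<xi> r) p = lie_bracket \<gamma> (lie_bracket ?X r) p"
    using VF x xS by (intro bracket_local_right) auto
  also have "lie_bracket \<gamma> (lie_bracket ?X r) =
      lie_bracket \<gamma> (fscale x0 ?E0) + lie_bracket \<gamma> (fscale x1 ?E1) + lie_bracket \<gamma> (- K)"
    unfolding br using VF xS K bracket_add_right[of \<gamma> "fscale x0 ?E0 + fscale x1 ?E1" "- K"]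
    by (simp add: bracket_add_right)
  also have "\<dots> p = x0 p *\<^sub>R lie_bracket \<gamma> ?E0 p + \<gamma> p x0 *\<^sub>R ?E0 p
      + (x1 p *\<^sub>R lie_bracket \<gamma> ?E1 p + \<gamma> p x1 *\<^sub>R ?E1 p) + lie_bracket \<gamma> (- K) p"
    using VF xS by (simp add: bracket_fscale_right)
  finally have eq: "lie_bracket \<gamma> (lie_bracket \<xi> r) p = \<dots>" .
  have "lie_bracket \<gamma> (- K) p \<in> D2 p"
    using sectionsD(2)[OF GH_bracket_G2[OF g]] GH_closed(4)[OF K] by blast
  then have K0: "\<theta> 3 p (lie_bracket \<gamma> (- K) p) = 0" "\<theta> 4 p (lie_bracket \<gamma> (- K) p) = 0"
    using adapted_frame_D2_iff[OF F] D2_subset_T by blast+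
  have "\<theta> 3 p (?E0 p) = 1" "\<theta> 4 p (?E0 p) = 0" "\<theta> 3 p (?E1 p) = 0" "\<theta> 4 p (?E1 p) = 1"
    using adapted_frame_bracket[OF F fr(1) r(1)] adapted_frame_bracket[OF F fr(2) r(1)]
    by (simp_all add: r(2) adapted_frame_dual[OF F])
  moreover have "linear (\<theta> 3 p)" "linear (\<theta> 4 p)" by (rule adapted_frame_linear[OF F], simp)+
  ultimately show ?A ?B
    unfolding eq by (simp_all only: linear_add linear_scale K0) (simp_all add: x0_def x1_def)
qed

text \<open>The partial connection determined by \<open>r\<close> satisfies the Leibniz rule for the Levi form up to the trace
  of its connection form in a frame.\<close>

lemma frame_trace_formula:
  assumes r: "r \<in> G2" "\<alpha> p (r p) = 1" and g: "\<gamma> \<in> GH" and x: "\<xi> \<in> GH" and y: "\<eta> \<in> GH"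
    and X: "X \<in> GH" "X p = solve r (lie_bracket \<gamma> (lie_bracket \<xi> r)) p"
    and Y: "Y \<in> GH" "Y p = solve r (lie_bracket \<gamma> (lie_bracket \<eta> r)) p"
  shows "\<alpha> p (lie_bracket X \<eta> p) + \<alpha> p (lie_bracket \<xi> Y p) =
    \<gamma> p (\<lambda>q. \<alpha> q (lie_bracket \<xi> \<eta> q)) + frame_trace e \<theta> r \<gamma> p * \<alpha> p (lie_bracket \<xi> \<eta> p)"
proof -
  note fr = adapted_frameD[OF F]
  have lin: "linear (\<theta> 0 p)" "linear (\<theta> 1 p)" by (rule adapted_frame_linear[OF F], simp)+
  have comp: "\<theta> 0 p (Z p) = \<theta> 3 p (W p) \<and> \<theta> 1 p (Z p) = \<theta> 4 p (W p)"
    if "Z p = solve r W p" "W \<in> VF" for Z W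
    unfolding that(1) solve_frame[OF F r that(2)]
    by (simp add: linear_add[OF lin(1)] linear_add[OF lin(2)] linear_scale[OF lin(1)] linear_scale[OF lin(2)]
        adapted_frame_dual[OF F])
  have VF: "lie_bracket \<gamma> (lie_bracket \<xi> r) \<in> VF" "lie_bracket \<gamma> (lie_bracket \<eta> r) \<in> VF"
    using g x y r by auto
  note cX = comp[of X "lie_bracket \<gamma> (lie_bracket \<xi> r)", OF X(2) VF(1)]
    and cY = comp[of Y "lie_bracket \<gamma> (lie_bracket \<eta> r)", OF Y(2) VF(2)]
  define x0 x1 y0 y1 where "x0 = (\<lambda>q. \<theta> 0 q (\<xi> q))" and "x1 = (\<lambda>q. \<theta> 1 q (\<xi> q))"
    and "y0 = (\<lambda>q. \<theta> 0 q (\<eta> q))" and "y1 = (\<lambda>q. \<theta> 1 q (\<eta> q))"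
  have sm: "x0 \<in> S" "x1 \<in> S" "y0 \<in> S" "y1 \<in> S"
    using x y lformsD(2)[OF adapted_frame_forms[OF F]] by (auto simp: x0_def x1_def y0_def y1_def)
  have gp: "\<gamma> p \<in> T p" using g vector_fieldsD(1) by blast
  have "\<gamma> p (\<lambda>q. \<alpha> q (lie_bracket \<xi> \<eta> q)) = \<gamma> p (\<lambda>q. x0 q * y1 q - x1 q * y0 q)"
  proof (rule tangent_local[OF gp])
    show "\<forall>\<^sub>F q in nhds p. \<alpha> q (lie_bracket \<xi> \<eta> q) = x0 q * y1 q - x1 q * y0 q"
      using adapted_frame_eventually[OF F]
      by eventually_elim (simp add: adapted_frame_levi_form x y x0_def x1_def y0_def y1_def)
  qed (use sm contact_smooth[OF GH_bracket_G2[OF x y]] in auto)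
  also have "\<dots> = x0 p * \<gamma> p y1 + y1 p * \<gamma> p x0 - (x1 p * \<gamma> p y0 + y0 p * \<gamma> p x1)"
    using sm by (simp add: tangent_diff[OF gp] tangent_mult[OF gp])
  finally show ?thesis
    unfolding adapted_frame_levi_form[OF F X(1) y] adapted_frame_levi_form[OF F x Y(1)]
      adapted_frame_levi_form[OF F x y] frame_trace_def cX[THEN conjunct1] cX[THEN conjunct2]
      cY[THEN conjunct1] cY[THEN conjunct2] frame_iterated_bracket[OF r g x] frame_iterated_bracket[OF r g y]
    by (simp add: x0_def x1_def y0_def y1_def algebra_simps)
qed

text \<open>Derivatives of the coefficients of \<open>\<gamma>\<close> multiply \<open>e 0\<close>
  and \<open>e 1\<close>, which \<open>\<theta> 3\<close> and \<open>\<theta> 4\<close>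
  annihilate.\<close>

lemma frame_trace_tensorial:
  assumes r: "r \<in> G2" and g: "\<gamma> \<in> GH"
  shows "frame_trace e \<theta> r \<gamma> p =
    \<theta> 0 p (\<gamma> p) * frame_trace e \<theta> r (e 0) p + \<theta> 1 p (\<gamma> p) * frame_trace e \<theta> r (e 1) p"
proof -
  note fr = adapted_frameD[OF F]
  define x0 x1 where "x0 = (\<lambda>q. \<theta> 0 q (\<gamma> q))" and "x1 = (\<lambda>q. \<theta> 1 q (\<gamma> q))"
  have sm: "x0 \<in> S" "x1 \<in> S"
    using g lformsD(2)[OF adapted_frame_forms[OF F]] by (auto simp: x0_def x1_def)
  let ?X = "fscale x0 (e 0) + fscale x1 (e 1)"
  have "\<forall>\<^sub>F q in nhds p. \<gamma> q = ?X q"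
    using adapted_frame_eventually[OF F]
  proof eventually_elim
    case (elim q)
    show ?case using adapted_frame_H_expansion[OF elim sectionsD(2)[OF g]] by (simp add: x0_def x1_def)
  qed
  then have "lie_bracket \<gamma> W p = lie_bracket ?X W p" if "W \<in> VF" for W
    using that g fr sm by (intro bracket_local_left) auto
  then have *: "lie_bracket \<gamma> W p = x0 p *\<^sub>R lie_bracket (e 0) W p + x1 p *\<^sub>R lie_bracket (e 1) W p
      + ((- W p x0) *\<^sub>R e 0 p + (- W p x1) *\<^sub>R e 1 p)" if "W \<in> VF" for W
    using that fr sm by (simp add: bracket_add_left bracket_fscale_left algebra_simps)
  have lin: "linear (\<theta> 3 p)" "linear (\<theta> 4 p)" by (rule adapted_frame_linear[OF F], simp)+
  have "lie_bracket (e 0) r \<in> VF" "lie_bracket (e 1) r \<in> VF" using fr r by auto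
  then show ?thesis
    unfolding frame_trace_def
    by (simp add: * linear_add[OF lin(1)] linear_add[OF lin(2)] linear_scale[OF lin(1)] linear_scale[OF lin(2)]
        linear_diff[OF lin(1)] linear_diff[OF lin(2)] linear_neg[OF lin(1)] linear_neg[OF lin(2)]
        adapted_frame_dual[OF F]) (simp add: x0_def x1_def algebra_simps)
qed

text \<open>Let \<open>r = e 2 + a e 0 + b e 1\<close> near \<open>p\<close>. The first summand of
  the trace gains the \<open>\<theta> 3\<close>-part of \<open>b [\<gamma>, [e 0, e 1]]\<close>, the
  second the \<open>\<theta> 4\<close>-part of \<open>a [\<gamma>, [e 1, e 0]]\<close>. Terms in
  which \<open>a\<close> or \<open>b\<close> is differentiated lie in \<open>D2\<close> and drop
  out.\<close>

lemma frame_trace_base_change: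
  assumes r: "r \<in> G2" "\<forall>\<^sub>F q in nhds p. \<alpha> q (r q) = 1" and g: "\<gamma> \<in> GH"
  shows "frame_trace e \<theta> r \<gamma> p = frame_trace e \<theta> (e 2) \<gamma> p
    + \<theta> 1 p (r p) * \<theta> 0 p (\<gamma> p) - \<theta> 0 p (r p) * \<theta> 1 p (\<gamma> p)"
proof -
  note fr = adapted_frameD[OF F]
  define a b where "a = (\<lambda>q. \<theta> 0 q (r q))" and "b = (\<lambda>q. \<theta> 1 q (r q))"
  have sm: "a \<in> S" "b \<in> S"
    using r(1) lformsD(2)[OF adapted_frame_forms[OF F]] by (auto simp: a_def b_def)
  let ?r = "e 2 + (fscale a (e 0) + fscale b (e 1))"
  have ev: "\<forall>\<^sub>F q in nhds p. r q = ?r q"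
    using adapted_frame_eventually[OF F] r(2)
  proof eventually_elim
    case (elim q)
    show ?case using adapted_frame_D2_expansion[OF elim(1) sectionsD(2)[OF r(1)]] elim(2)
      by (simp add: a_def b_def ac_simps)
  qed
  \<comment> \<open>\<open>w\<close> gathers every term with a differentiated coefficient.\<close>
  have br: "lie_bracket \<gamma> (lie_bracket (e i) r) p = lie_bracket \<gamma> (lie_bracket (e i) (e 2)) p
      + (a p *\<^sub>R lie_bracket \<gamma> (lie_bracket (e i) (e 0)) p + b p *\<^sub>R lie_bracket \<gamma> (lie_bracket (e i) (e 1)) p) + w"
    if e: "e i \<in> GH" and w: "w = \<gamma> p a *\<^sub>R lie_bracket (e i) (e 0) p + \<gamma> p b *\<^sub>R lie_bracket (e i) (e 1) p
      + lie_bracket \<gamma> (fscale (\<lambda>q. e i q a) (e 0) + fscale (\<lambda>q. e i q b) (e 1)) p" for i w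
  proof -
    have VF: "e i \<in> VF" "e 0 \<in> VF" "e 1 \<in> VF" "e 2 \<in> VF" "r \<in> VF" "\<gamma> \<in> VF" using e fr r g by auto
    have ab: "(\<lambda>q. e i q a) \<in> S" "(\<lambda>q. e i q b) \<in> S" using vector_fieldsD(2) VF sm by blast+
    have "\<forall>\<^sub>F q in nhds p. lie_bracket (e i) r q = lie_bracket (e i) ?r q"
      using eventually_nhds_nhds[OF ev]
      by (rule eventually_mono) (rule bracket_local_right, use VF sm in auto)
    then have "lie_bracket \<gamma> (lie_bracket (e i) r) p = lie_bracket \<gamma> (lie_bracket (e i) ?r) p"
      using VF sm by (intro bracket_local_right) auto
    also have "lie_bracket (e i) ?r = lie_bracket (e i) (e 2) + (fscale a (lie_bracket (e i) (e 0))
        + fscale b (lie_bracket (e i) (e 1))) + (fscale (\<lambda>q. e i q a) (e 0) + fscale (\<lambda>q. e i q b) (e 1))"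
      using VF sm by (simp add: bracket_add_right bracket_fscale_right algebra_simps)
    also have "lie_bracket \<gamma> \<dots> p = lie_bracket \<gamma> (lie_bracket (e i) (e 2)) p
        + (lie_bracket \<gamma> (fscale a (lie_bracket (e i) (e 0))) p + lie_bracket \<gamma> (fscale b (lie_bracket (e i) (e 1))) p)
        + lie_bracket \<gamma> (fscale (\<lambda>q. e i q a) (e 0) + fscale (\<lambda>q. e i q b) (e 1)) p"
      using VF sm ab
      by (subst bracket_add_right, simp_all)+
    finally show ?thesis
      unfolding w using VF sm by (simp add: bracket_fscale_right algebra_simps)
  qed
  have lin: "linear (\<theta> 3 p)" "linear (\<theta> 4 p)" by (rule adapted_frame_linear[OF F], simp)+
  have w: "\<theta> 3 p w = 0 \<and> \<theta> 4 p w = 0"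
    if e: "e i \<in> GH" and w: "w = \<gamma> p a *\<^sub>R lie_bracket (e i) (e 0) p + \<gamma> p b *\<^sub>R lie_bracket (e i) (e 1) p
      + lie_bracket \<gamma> (fscale (\<lambda>q. e i q a) (e 0) + fscale (\<lambda>q. e i q b) (e 1)) p" for i w
  proof -
    have "(\<lambda>q. e i q a) \<in> S" "(\<lambda>q. e i q b) \<in> S" using vector_fieldsD(2) e sm by blast+
    then have "fscale (\<lambda>q. e i q a) (e 0) + fscale (\<lambda>q. e i q b) (e 1) \<in> GH" using fr by auto
    then have "w \<in> D2 p"
      unfolding w
      by (intro subspace_add[OF subspace_D2] subspace_scale[OF subspace_D2]
          sectionsD(2)[OF GH_bracket_G2[OF e fr(1)]] sectionsD(2)[OF GH_bracket_G2[OF e fr(2)]]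
          sectionsD(2)[OF GH_bracket_G2[OF g]])
    then show ?thesis using adapted_frame_D2_iff[OF F] D2_subset_T by blast
  qed
  have self: "lie_bracket (e i) (e i) = 0" for i by (simp add: lie_bracket_def fun_eq_iff)
  have sk: "lie_bracket \<gamma> (lie_bracket (e 1) (e 0)) p = - lie_bracket \<gamma> (lie_bracket (e 0) (e 1)) p"
  proof -
    have "lie_bracket (e 1) (e 0) = fscale (\<lambda>q. -1) (lie_bracket (e 0) (e 1))"
      using bracket_skew[of "e 1" "e 0"] by (simp add: fun_eq_iff)
    then show ?thesis
      using fr g by (simp add: bracket_fscale_right tangent_const[OF vector_fieldsD(1)])
  qed
  have l: "\<theta> 3 p (lie_bracket \<gamma> (lie_bracket (e 0) (e 1)) p) = \<theta> 0 p (\<gamma> p)"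
    "\<theta> 4 p (lie_bracket \<gamma> (lie_bracket (e 0) (e 1)) p) = \<theta> 1 p (\<gamma> p)"
    using adapted_frame_bracket[OF F g GH_bracket_G2[OF fr(1,2)]] adapted_frame_contact[OF F] by simp_all
  have z: "lie_bracket \<gamma> 0 p = 0" using bracket_zero_right g by simp
  show ?thesis
    unfolding frame_trace_def br[OF fr(1) refl] br[OF fr(2) refl]
    using w[OF fr(1) refl] w[OF fr(2) refl]
    by (simp add: linear_add[OF lin(1)] linear_add[OF lin(2)] linear_scale[OF lin(1)] linear_scale[OF lin(2)]
        linear_diff[OF lin(1)] linear_diff[OF lin(2)] linear_neg[OF lin(1)] linear_neg[OF lin(2)] self sk l z linear_0[OF lin(1)] linear_0[OF lin(2)])
      (simp add: a_def b_def algebra_simps)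
qed

lemma frame_trace_smooth:
  assumes "r \<in> VF" "\<gamma> \<in> VF"
  shows "frame_trace e \<theta> r \<gamma> \<in> S"
  unfolding frame_trace_def
  using assms adapted_frameD[OF F]
  by (intro smooth_funs_add lformsD(2)[OF adapted_frame_forms[OF F]] vector_fields_bracket) auto

end

text \<open>The partial connection of \<open>r\<close> preserves the Levi form at \<open>p\<close>.
  Arbitrary sections \<open>X\<close>, \<open>Y\<close> with the right value at \<open>p\<close>
  replace the derivatives, because \<open>nabla\<close> describes global sections while
  \<open>r\<close> is normalized only near \<open>p\<close>.\<close>

definition reeb_at :: "'a \<Rightarrow> 'a vfield \<Rightarrow> bool" where
  "reeb_at p r \<longleftrightarrow> r \<in> G2 \<and> (\<forall>\<^sub>F q in nhds p. \<alpha> q (r q) = 1) \<and>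
    (\<forall>\<gamma>\<in>GH. \<forall>\<xi>\<in>GH. \<forall>\<eta>\<in>GH. \<forall>X\<in>GH. \<forall>Y\<in>GH.
       X p = solve r (lie_bracket \<gamma> (lie_bracket \<xi> r)) p \<longrightarrow>
       Y p = solve r (lie_bracket \<gamma> (lie_bracket \<eta> r)) p \<longrightarrow>
       \<alpha> p (lie_bracket X \<eta> p) + \<alpha> p (lie_bracket \<xi> Y p) = \<gamma> p (\<lambda>q. \<alpha> q (lie_bracket \<xi> \<eta> q)))"

text \<open>By the trace formula the failure of invariance is the trace times
  \<open>\<alpha>([\<xi>, \<eta>])\<close>; the pair \<open>e 0\<close>, \<open>e 1\<close>, where
  this value is 1, detects it.\<close>

lemma reeb_at_iff:
  assumes F: "adapted_frame p e \<theta>" and r: "r \<in> G2" "\<forall>\<^sub>F q in nhds p. \<alpha> q (r q) = 1"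
  shows "reeb_at p r \<longleftrightarrow> (\<forall>\<gamma>\<in>GH. frame_trace e \<theta> r \<gamma> p = 0)"
proof
  note fr = adapted_frameD[OF F]
  have rp: "\<alpha> p (r p) = 1" using r(2) eventually_nhds_x_imp_x by fast
  have ex: "\<exists>Z\<in>GH. Z p = solve r W p" if "W \<in> VF" for W
    using fr that by (intro bexI[of _ "\<theta> 3 p (W p) *\<^sub>R e 0 + \<theta> 4 p (W p) *\<^sub>R e 1"])
      (auto simp: solve_frame[OF F r(1) rp])
  assume *: "reeb_at p r"
  show "\<forall>\<gamma>\<in>GH. frame_trace e \<theta> r \<gamma> p = 0"
  proof
    fix \<gamma> assume g: "\<gamma> \<in> GH"
    obtain X where X: "X \<in> GH" "X p = solve r (lie_bracket \<gamma> (lie_bracket (e 0) r)) p"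
      using ex[of "lie_bracket \<gamma> (lie_bracket (e 0) r)"] fr r g by auto
    obtain Y where Y: "Y \<in> GH" "Y p = solve r (lie_bracket \<gamma> (lie_bracket (e 1) r)) p"
      using ex[of "lie_bracket \<gamma> (lie_bracket (e 1) r)"] fr r g by auto
    have "\<alpha> p (lie_bracket X (e 1) p) + \<alpha> p (lie_bracket (e 0) Y p) = \<gamma> p (\<lambda>q. \<alpha> q (lie_bracket (e 0) (e 1) q))"
      using * g fr X Y unfolding reeb_at_def by blast
    then show "frame_trace e \<theta> r \<gamma> p = 0"
      using frame_trace_formula[OF F r(1) rp g fr(1,2) X Y] adapted_frame_contact[OF F] by simp
  qed
next
  have rp: "\<alpha> p (r p) = 1" using r(2) eventually_nhds_x_imp_x by fast
  assume "\<forall>\<gamma>\<in>GH. frame_trace e \<theta> r \<gamma> p = 0"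
  then show "reeb_at p r"
    unfolding reeb_at_def using r frame_trace_formula[OF F r(1) rp] by simp
qed

text \<open>Setting the shifted trace to zero for \<open>\<gamma> = e 0\<close> yields
  \<open>\<theta> 1\<close> of \<open>r\<close>, and for \<open>\<gamma> = e 1\<close> it yields
  \<open>\<theta> 0\<close>. The right-hand side does not involve \<open>r\<close>: this is the
  uniqueness of the Reeb field.\<close>

lemma reeb_at_value:
  assumes F: "adapted_frame p e \<theta>" and r: "reeb_at p r"
  shows "r p = frame_trace e \<theta> (e 2) (e 1) p *\<^sub>R e 0 p - frame_trace e \<theta> (e 2) (e 0) p *\<^sub>R e 1 p + e 2 p"
proof -
  note fr = adapted_frameD[OF F]
  have r': "r \<in> G2" "\<forall>\<^sub>F q in nhds p. \<alpha> q (r q) = 1" using r unfolding reeb_at_def by blast+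
  have rp: "\<alpha> p (r p) = 1" using r'(2) eventually_nhds_x_imp_x by fast
  have "frame_trace e \<theta> r (e 0) p = 0" "frame_trace e \<theta> r (e 1) p = 0"
    using r reeb_at_iff[OF F r'] fr by blast+
  then have "\<theta> 1 p (r p) = - frame_trace e \<theta> (e 2) (e 0) p" "\<theta> 0 p (r p) = frame_trace e \<theta> (e 2) (e 1) p"
    using frame_trace_base_change[OF F r' fr(1)] frame_trace_base_change[OF F r' fr(2)]
    by (auto simp: adapted_frame_dual[OF F])
  then show ?thesis
    using adapted_frame_D2_expansion[OF F sectionsD(2)[OF r'(1)]] rp by simp
qed

section \<open>Existence and gluing of the Reeb field\<close>

lemma reeb_at_exists:
  obtains r where "r \<in> G2" "\<forall>\<^sub>F q in nhds p. reeb_at q r"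
proof -
  obtain c where c: "c \<in> G2" "\<forall>\<^sub>F q in nhds p. \<alpha> q (c q) = 1" by (rule base_section_exists)
  obtain e \<theta> where F: "adapted_frame p e \<theta>" by (rule adapted_frame_exists[OF c])
  note fr = adapted_frameD[OF F]
  \<comment> \<open>The coefficients forced by \<open>reeb_at_value\<close>, now as smooth
    functions, so that the condition holds at all points near \<open>p\<close>.\<close>
  define a b where "a = frame_trace e \<theta> (e 2) (e 1)" and "b = (\<lambda>q. - frame_trace e \<theta> (e 2) (e 0) q)"
  have sm: "a \<in> S" "b \<in> S"
    unfolding a_def b_def using frame_trace_smooth[OF F] fr by auto
  define r where "r = e 2 + (fscale a (e 0) + fscale b (e 1))"
  have r: "r \<in> G2" unfolding r_def using fr sm by auto
  have ev: "\<forall>\<^sub>F q in nhds p. \<alpha> q (r q) = 1"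
    using adapted_frame_eventually[OF F]
  proof eventually_elim
    case (elim q)
    have "a q *\<^sub>R e 0 q + b q *\<^sub>R e 1 q \<in> H q"
      using fr sectionsD(2) by (intro subspace_add subspace_scale subspace_H) blast+
    then show ?case
      unfolding r_def using contact_add[of "e 2 q" q "a q *\<^sub>R e 0 q + b q *\<^sub>R e 1 q"] contact_H
        H_subset_D2 sectionsD(2)[OF fr(3)] adapted_frame_contact[OF elim] by auto
  qed
  have "\<forall>\<^sub>F q in nhds p. reeb_at q r"
    using adapted_frame_eventually[OF F] eventually_nhds_nhds[OF ev]
  proof eventually_elim
    case (elim q)
    have lin: "linear (\<theta> 0 q)" "linear (\<theta> 1 q)" by (rule adapted_frame_linear[OF elim(1)], simp)+
    have "\<theta> 0 q (r q) = a q" "\<theta> 1 q (r q) = b q"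
      by (simp_all add: r_def linear_add[OF lin(1)] linear_add[OF lin(2)] linear_scale[OF lin(1)]
          linear_scale[OF lin(2)] adapted_frame_dual[OF elim(1)])
    then show ?case
      unfolding reeb_at_iff[OF elim(1) r elim(2)]
      by (simp add: frame_trace_base_change[OF elim(1) r elim(2)] frame_trace_tensorial[OF elim(1) fr(3)]
          a_def b_def algebra_simps)
  qed
  with r show ?thesis by (rule that)
qed

lemma reeb_at_cong:
  assumes "reeb_at p r" "r' \<in> G2" "\<forall>\<^sub>F q in nhds p. r' q = r q"
  shows "reeb_at p r'"
proof -
  have r: "r \<in> G2" "\<forall>\<^sub>F q in nhds p. \<alpha> q (r q) = 1" using assms(1) unfolding reeb_at_def by blast+
  have r': "\<forall>\<^sub>F q in nhds p. \<alpha> q (r' q) = 1"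
    using assms(3) r(2) by eventually_elim simp
  obtain e \<theta> where F: "adapted_frame p e \<theta>" using adapted_frame_exists[OF r] .
  note fr = adapted_frameD[OF F]
  have "frame_trace e \<theta> r' \<gamma> p = frame_trace e \<theta> r \<gamma> p" if g: "\<gamma> \<in> GH" for \<gamma>
  proof -
    have "lie_bracket \<gamma> (lie_bracket (e i) r') p = lie_bracket \<gamma> (lie_bracket (e i) r) p" if "e i \<in> GH" for i
    proof (rule bracket_local_right)
      show "\<forall>\<^sub>F q in nhds p. lie_bracket (e i) r' q = lie_bracket (e i) r q"
        using eventually_nhds_nhds[OF assms(3)]
        by (rule eventually_mono) (rule bracket_local_right, use that assms(2) r in auto)
    qed (use g that assms(2) r in auto)
    then show ?thesis unfolding frame_trace_def using fr by simp
  qed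
  then show ?thesis
    using assms(1) unfolding reeb_at_iff[OF F r] reeb_at_iff[OF F assms(2) r'] by simp
qed

text \<open>Local solutions agree at each point by \<open>reeb_at_value\<close>, so choosing their
  values pointwise is unambiguous. Near each point the result coincides with a smooth solution and
  inherits the condition, which depends on germs.\<close>

lemma reeb_exists: obtains r where "\<forall>p. reeb_at p r" "normalized r"
proof -
  define R where "R p = (THE v. \<exists>r. reeb_at p r \<and> r p = v)" for p
  have R: "R p = r p" if "reeb_at p r" for p r
    unfolding R_def
  proof (rule the_equality)
    fix v assume "\<exists>r. reeb_at p r \<and> r p = v"
    then obtain r' where r': "reeb_at p r'" "r' p = v" by blast
    have "r \<in> G2" "\<forall>\<^sub>F q in nhds p. \<alpha> q (r q) = 1" using that unfolding reeb_at_def by blast+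
    then obtain e \<theta> where "adapted_frame p e \<theta>" by (rule adapted_frame_exists)
    then show "v = r p" using reeb_at_value that r' by metis
  qed (use that in blast)
  have loc: "\<exists>r\<in>G2. reeb_at p r \<and> (\<forall>\<^sub>F q in nhds p. R q = r q)" for p
  proof -
    obtain r where r: "r \<in> G2" "\<forall>\<^sub>F q in nhds p. reeb_at q r" by (rule reeb_at_exists)
    have "\<forall>\<^sub>F q in nhds p. R q = r q" using r(2) by eventually_elim (rule R)
    then show ?thesis using r eventually_nhds_x_imp_x[OF r(2)] by blast
  qed
  have R2: "R \<in> G2"
  proof (rule sectionsI)
    show "R \<in> VF" by (rule vector_fields_local) (use loc in blast)
    show "R p \<in> D2 p" for p
    proof -
      obtain r where "r \<in> G2" "reeb_at p r" using loc by blast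
      then show ?thesis using R[of p r] sectionsD(2)[of r D2 p] by simp
    qed
  qed
  have all: "\<forall>p. reeb_at p R"
  proof
    fix p
    obtain r where "reeb_at p r" "\<forall>\<^sub>F q in nhds p. R q = r q" using loc by blast
    then show "reeb_at p R" using reeb_at_cong[OF _ R2] by blast
  qed
  have "\<alpha> p (R p) = 1" for p
  proof -
    have "\<forall>\<^sub>F q in nhds p. \<alpha> q (R q) = 1" using all unfolding reeb_at_def by simp
    then show ?thesis by (rule eventually_nhds_x_imp_x)
  qed
  with R2 have "normalized R" unfolding normalized_def by simp
  with all show ?thesis by (rule that)
qed

text \<open>In any representation of \<open>q2 H r\<close> as \<open>{\<xi>, \<eta>}\<close> near
  \<open>p\<close>, the function \<open>\<alpha>([\<xi>, \<eta>])\<close> is constantly 1 there. Its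
  derivative in the trace formula vanishes, so every representation gives the trace times the class
  of \<open>r\<close>.\<close>

lemma nabla_gr_frame:
  assumes r: "normalized r" and g: "\<gamma> \<in> GH" and F: "adapted_frame p e \<theta>"
  shows "nabla_gr A H r \<gamma> (q2 H r) p = (frame_trace e \<theta> r \<gamma> p *\<^sub>R r p) +o H p"
  unfolding nabla_gr_def
proof (rule the_equality)
  note fr = adapted_frameD[OF F] and r' = normalizedD[OF r]
  have nab: "nabla A H r \<gamma> \<xi> \<in> GH" if "\<xi> \<in> GH" for \<xi>
    unfolding nabla_eq_solve[OF r g that] using solve_GH[OF r] g that r' by auto
  have val: "levi1 H (nabla A H r \<gamma> \<xi>) \<eta> p + levi1 H \<xi> (nabla A H r \<gamma> \<eta>) p
      = (frame_trace e \<theta> r \<gamma> p *\<^sub>R r p) +o H p"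
    if x: "\<xi> \<in> GH" and y: "\<eta> \<in> GH" and U: "open U" "p \<in> U" "\<forall>q\<in>U. q2 H r q = levi1 H \<xi> \<eta> q"
    for \<xi> \<eta> U
  proof -
    have one: "\<alpha> q (lie_bracket \<xi> \<eta> q) = 1" if "q \<in> U" for q
    proof -
      have "r q - lie_bracket \<xi> \<eta> q \<in> H q"
        using U(3) that unfolding levi1_def q2_def by (simp add: coset_eq_iff[OF subspace_H])
      then have "\<alpha> q (r q - lie_bracket \<xi> \<eta> q) = 0" by (rule contact_H)
      then show ?thesis
        using contact_diff[of "r q" q "lie_bracket \<xi> \<eta> q"] r' sectionsD(2) GH_bracket_G2[OF x y] by auto
    qed
    have gp: "\<gamma> p \<in> T p" using g vector_fieldsD(1) by blast
    have "\<gamma> p (\<lambda>q. \<alpha> q (lie_bracket \<xi> \<eta> q)) = \<gamma> p (\<lambda>q. 1)"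
      by (rule tangent_local[OF gp])
        (use one U contact_smooth[OF GH_bracket_G2[OF x y]] in \<open>auto simp: eventually_nhds\<close>)
    then have z: "\<gamma> p (\<lambda>q. \<alpha> q (lie_bracket \<xi> \<eta> q)) = 0" using tangent_const[OF gp] by simp
    let ?v = "lie_bracket (nabla A H r \<gamma> \<xi>) \<eta> p" and ?w = "lie_bracket \<xi> (nabla A H r \<gamma> \<eta>) p"
    have vw: "?v \<in> D2 p" "?w \<in> D2 p" using nab x y sectionsD(2)[OF GH_bracket_G2] by blast+
    have tr: "frame_trace e \<theta> r \<gamma> p *\<^sub>R r p \<in> D2 p"
      using r' sectionsD(2) by (intro subspace_scale subspace_D2) blast
    have "\<alpha> p ?v + \<alpha> p ?w = frame_trace e \<theta> r \<gamma> p"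
      using frame_trace_formula[OF F r'(1) r'(2) g x y nab[OF x] _ nab[OF y]] one[OF U(2)] z
      by (simp add: nabla_eq_solve[OF r g] x y)
    then have "\<alpha> p (?v + ?w - frame_trace e \<theta> r \<gamma> p *\<^sub>R r p) = 0"
      using vw tr r' sectionsD(2)[OF r'(1)] subspace_add[OF subspace_D2 vw]
      by (simp add: contact_diff contact_add contact_scale[of "r p" p "r p"])
    then have "?v + ?w - frame_trace e \<theta> r \<gamma> p *\<^sub>R r p \<in> H p"
      using contact_kernel subspace_diff[OF subspace_D2 subspace_add[OF subspace_D2 vw] tr] by blast
    then show ?thesis
      unfolding levi1_def q2_def coset_plus[OF subspace_H] by (simp add: coset_eq_iff[OF subspace_H])
  qed
  show "C = (frame_trace e \<theta> r \<gamma> p *\<^sub>R r p) +o H p"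
    if "\<exists>\<xi>\<in>GH. \<exists>\<eta>\<in>GH. \<exists>U. open U \<and> p \<in> U \<and> (\<forall>q\<in>U. q2 H r q = levi1 H \<xi> \<eta> q) \<and>
      C = levi1 H (nabla A H r \<gamma> \<xi>) \<eta> p + levi1 H \<xi> (nabla A H r \<gamma> \<eta>) p" for C
    using that val by blast
  \<comment> \<open>A representation exists: \<open>[e 0, e 1]\<close> and \<open>r\<close> both
    have \<open>\<alpha>\<close>-value 1 and hence agree modulo \<open>H\<close>.\<close>
  have "\<forall>\<^sub>F q in nhds p. q2 H r q = levi1 H (e 0) (e 1) q"
    using adapted_frame_eventually[OF F]
  proof eventually_elim
    case (elim q)
    have D: "r q \<in> D2 q" "lie_bracket (e 0) (e 1) q \<in> D2 q"
      using r' fr sectionsD(2)[of _ D2] by blast+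
    have "\<alpha> q (r q - lie_bracket (e 0) (e 1) q) = 0"
      using contact_diff[OF D] r' adapted_frame_contact[OF elim] by simp
    then have "r q - lie_bracket (e 0) (e 1) q \<in> H q"
      using contact_kernel[OF subspace_diff[OF subspace_D2 D]] by blast
    then show ?case unfolding levi1_def q2_def by (simp add: coset_eq_iff[OF subspace_H])
  qed
  then obtain U where U: "open U" "p \<in> U" "\<forall>q\<in>U. q2 H r q = levi1 H (e 0) (e 1) q"
    unfolding eventually_nhds by blast
  show "\<exists>\<xi>\<in>GH. \<exists>\<eta>\<in>GH. \<exists>U. open U \<and> p \<in> U \<and> (\<forall>q\<in>U. q2 H r q = levi1 H \<xi> \<eta> q) \<and>
      (frame_trace e \<theta> r \<gamma> p *\<^sub>R r p) +o H p = levi1 H (nabla A H r \<gamma> \<xi>) \<eta> p + levi1 H \<xi> (nabla A H r \<gamma> \<eta>) p"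
    by (intro bexI[OF _ fr(1)] bexI[OF _ fr(2)] exI[of _ U] conjI U val[OF fr(1,2) U, symmetric])
qed

lemma parallel_iff_reeb_at:
  assumes r: "normalized r"
  shows "(\<forall>\<gamma>\<in>GH. nabla_gr A H r \<gamma> (q2 H r) = H) \<longleftrightarrow> (\<forall>p. reeb_at p r)"
proof -
  have "(nabla_gr A H r \<gamma> (q2 H r) p = H p) \<longleftrightarrow> frame_trace e \<theta> r \<gamma> p = 0"
    if "\<gamma> \<in> GH" "adapted_frame p e \<theta>" for \<gamma> p e \<theta>
  proof -
    have "frame_trace e \<theta> r \<gamma> p *\<^sub>R r p \<in> H p \<longleftrightarrow> \<alpha> p (frame_trace e \<theta> r \<gamma> p *\<^sub>R r p) = 0"
      using contact_kernel normalizedD[OF r] subspace_scale[OF subspace_D2] sectionsD(2) by blast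
    also have "\<dots> \<longleftrightarrow> frame_trace e \<theta> r \<gamma> p = 0"
      using contact_scale[of "r p" p "r p"] normalizedD[OF r] sectionsD(2)[OF normalizedD(1)[OF r]] by simp
    finally show ?thesis
      unfolding nabla_gr_frame[OF r that] coset_eq_self_iff[OF subspace_H] .
  qed
  note * = this
  show ?thesis
  proof (intro iffI allI ballI ext)
    fix p assume a: "\<forall>\<gamma>\<in>GH. nabla_gr A H r \<gamma> (q2 H r) = H"
    obtain e \<theta> where F: "adapted_frame p e \<theta>" by (rule normalized_frame[OF r])
    show "reeb_at p r"
      using a *[OF _ F] normalizedD[OF r] by (subst reeb_at_iff[OF F]) auto
  next
    fix \<gamma> p assume a: "\<forall>p. reeb_at p r" and g: "\<gamma> \<in> GH"
    obtain e \<theta> where F: "adapted_frame p e \<theta>" by (rule normalized_frame[OF r])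
    have "\<forall>\<gamma>\<in>GH. frame_trace e \<theta> r \<gamma> p = 0"
      by (rule iffD1[OF reeb_at_iff[OF F]]) (use a normalizedD[OF r] in auto)
    then have "frame_trace e \<theta> r \<gamma> p = 0" using g by blast
    then show "nabla_gr A H r \<gamma> (q2 H r) p = H p" using *[OF g F] by simp
  qed
qed

lemma normalized_reeb: "normalized (reeb A H \<alpha>)"
proof -
  obtain R where R: "\<forall>p. reeb_at p R" "normalized R" by (rule reeb_exists)
  have "reeb A H \<alpha> = R"
    unfolding reeb_def
  proof (rule the_equality)
    show "R \<in> G2 \<and> (\<forall>p. \<alpha> p (R p) = 1) \<and> (\<forall>\<gamma>\<in>GH. nabla_gr A H R \<gamma> (q2 H R) = H)"
      using R parallel_iff_reeb_at[OF R(2)] normalizedD[OF R(2)] by blast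
  next
    fix r assume "r \<in> G2 \<and> (\<forall>p. \<alpha> p (r p) = 1) \<and> (\<forall>\<gamma>\<in>GH. nabla_gr A H r \<gamma> (q2 H r) = H)"
    then have "normalized r" "\<forall>\<gamma>\<in>GH. nabla_gr A H r \<gamma> (q2 H r) = H" unfolding normalized_def by blast+
    then have r: "\<forall>p. reeb_at p r" using parallel_iff_reeb_at by blast
    show "r = R"
    proof
      fix p
      obtain e \<theta> where F: "adapted_frame p e \<theta>" by (rule normalized_frame[OF R(2)])
      show "r p = R p" using reeb_at_value[OF F] r R(1) by simp
    qed
  qed
  then show ?thesis using R(2) by simp
qed

end

section \<open>Canonical extension, decomposition and projection\<close>

text \<open>The vector arithmetic of \<open>Psi_fscale\<close>: two equal cross terms are halved and
  add up to one, and the remainder is a multiple of \<open>g\<close>, which there lies in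
  \<open>H\<close>.\<close>

lemma half_combination:
  fixes u w g :: "'v::real_vector"
  shows "(1/2) *\<^sub>R (h *\<^sub>R u + k *\<^sub>R w + (k *\<^sub>R w + m *\<^sub>R - g)) - (h *\<^sub>R (1/2) *\<^sub>R u + k *\<^sub>R w)
    = (- (1/2) * m) *\<^sub>R g"
proof -
  have "(1/2) *\<^sub>R (h *\<^sub>R u + k *\<^sub>R w + (k *\<^sub>R w + m *\<^sub>R - g))
      = h *\<^sub>R (1/2) *\<^sub>R u + ((k/2) *\<^sub>R w + (k/2) *\<^sub>R w) - (m/2) *\<^sub>R g"
    by (simp add: algebra_simps)
  also have "(k/2) *\<^sub>R w + (k/2) *\<^sub>R w = k *\<^sub>R w" by (simp flip: scaleR_add_left)
  finally show ?thesis by simp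
qed

context contact_distribution
begin

abbreviation "reebf \<equiv> reeb A H \<alpha>"
abbreviation "\<omega> \<equiv> canonical_extension A H \<alpha>"

lemma reeb_section [simp, intro]: "reebf \<in> G2" "reebf \<in> VF"
  using normalizedD[OF normalized_reeb] by blast+

lemma contact_reeb [simp]: "\<alpha> p (reebf p) = 1"
  using normalizedD[OF normalized_reeb] by blast

lemma reeb_frame: obtains e \<theta> where "adapted_frame p e \<theta>" "e 2 = reebf"
  by (rule normalized_frame[OF normalized_reeb])

text \<open>The bracket of \<open>e 2\<close> with \<open>x0 e 0 + x1 e 1\<close> involves only
  \<open>e 3\<close>, \<open>e 4\<close>, \<open>e 0\<close> and \<open>e 1\<close>. When
  \<open>e 2\<close> is the Reeb field, \<open>\<theta> 2\<close> thus satisfies the condition that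
  singles out the canonical extension.\<close>

lemma frame_base_bracket:
  assumes F: "adapted_frame p e \<theta>" and xi: "\<xi> \<in> GH"
  shows "\<theta> 2 p (lie_bracket (e 2) \<xi> p) = 0"
proof -
  note fr = adapted_frameD[OF F]
  define x0 x1 where "x0 = (\<lambda>q. \<theta> 0 q (\<xi> q))" and "x1 = (\<lambda>q. \<theta> 1 q (\<xi> q))"
  have sm: "x0 \<in> S" "x1 \<in> S"
    using xi lformsD(2)[OF adapted_frame_forms[OF F]] by (auto simp: x0_def x1_def)
  have "\<forall>\<^sub>F q in nhds p. \<xi> q = (fscale x0 (e 0) + fscale x1 (e 1)) q"
    using adapted_frame_eventually[OF F]
  proof eventually_elim
    case (elim q)
    show ?case using adapted_frame_H_expansion[OF elim sectionsD(2)[OF xi]] by (simp add: x0_def x1_def)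
  qed
  then have "lie_bracket (e 2) \<xi> p = lie_bracket (e 2) (fscale x0 (e 0) + fscale x1 (e 1)) p"
    using xi fr sm by (intro bracket_local_right) auto
  also have "\<dots> = x0 p *\<^sub>R lie_bracket (e 2) (e 0) p + e 2 p x0 *\<^sub>R e 0 p
      + (x1 p *\<^sub>R lie_bracket (e 2) (e 1) p + e 2 p x1 *\<^sub>R e 1 p)"
    using fr sm by (simp add: bracket_add_right bracket_fscale_right)
  also have "lie_bracket (e 2) (e 0) p = - e 3 p" unfolding fr by (rule bracket_skew_at)
  also have "lie_bracket (e 2) (e 1) p = - e 4 p" unfolding fr by (rule bracket_skew_at)
  finally have eq: "lie_bracket (e 2) \<xi> p =
      x0 p *\<^sub>R - e 3 p + e 2 p x0 *\<^sub>R e 0 p + (x1 p *\<^sub>R - e 4 p + e 2 p x1 *\<^sub>R e 1 p)" .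
  have lin: "linear (\<theta> 2 p)" by (rule adapted_frame_linear[OF F]) simp
  show ?thesis
    unfolding eq
    by (simp add: linear_add[OF lin] linear_diff[OF lin] linear_neg[OF lin] linear_scale[OF lin]
        adapted_frame_dual[OF F])
qed

section \<open>The canonical extension of the contact form\<close>

lemma tangent_decomposition:
  assumes "v \<in> T p"
  obtains \<xi> u where "\<xi> \<in> GH" "u \<in> D2 p" "v = lie_bracket reebf \<xi> p + u"
proof -
  obtain e \<theta> where F: "adapted_frame p e \<theta>" "e 2 = reebf" by (rule reeb_frame)
  note fr = adapted_frameD[OF F(1)]
  \<comment> \<open>The signs come from \<open>e 3 = [e 0, r] = - [r, e 0]\<close>, and likewise for
    \<open>e 4\<close>.\<close>
  define \<xi> where "\<xi> = (- \<theta> 3 p v) *\<^sub>R e 0 + (- \<theta> 4 p v) *\<^sub>R e 1"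
  define u where "u = \<theta> 0 p v *\<^sub>R e 0 p + (\<theta> 1 p v *\<^sub>R e 1 p + \<theta> 2 p v *\<^sub>R e 2 p)"
  have xi: "\<xi> \<in> GH" unfolding \<xi>_def using fr by blast
  have u: "u \<in> D2 p"
    unfolding u_def using fr
    by (intro subspace_add[OF subspace_D2] subspace_scale[OF subspace_D2] sectionsD(2)[of _ D2]) auto
  have br: "lie_bracket reebf (c *\<^sub>R X) = c *\<^sub>R lie_bracket reebf X" if "X \<in> GH" for c X
    unfolding scaleR_eq_fscale using that
    by (simp add: bracket_fscale_right fun_eq_iff tangent_const[OF vector_fieldsD(1)])
  have "lie_bracket reebf \<xi> p = - \<theta> 3 p v *\<^sub>R lie_bracket reebf (e 0) p + - \<theta> 4 p v *\<^sub>R lie_bracket reebf (e 1) p"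
    unfolding \<xi>_def using fr by (simp only: bracket_add_right GH_VF GH_closed(6) reeb_section br plus_fun_apply scaleR_fun_apply)
  also have "\<dots> = \<theta> 3 p v *\<^sub>R e 3 p + \<theta> 4 p v *\<^sub>R e 4 p"
    unfolding fr(4,5) F(2) bracket_skew_at[of reebf "e 0"] bracket_skew_at[of reebf "e 1"] by simp
  finally have "v = lie_bracket reebf \<xi> p + u"
    unfolding u_def using adapted_frame_expansion[OF F(1) assms] by (simp add: lessThan_2_3_5 algebra_simps)
  then show ?thesis using that xi u by blast
qed

lemma canonical_extension_frame:
  assumes F: "adapted_frame p e \<theta>" "e 2 = reebf" and u: "u \<in> D2 p" and x: "\<xi> \<in> GH"
  shows "\<theta> 2 p (lie_bracket reebf \<xi> p + u) = \<alpha> p u"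
  using frame_base_bracket[OF F(1) x] adapted_frame_contact_form[OF F(1) u] F(2)
    linear_add[OF adapted_frame_linear[OF F(1), of 2]] by simp

lemma one_forms_linear:
  assumes "\<tau> \<in> one_forms A" "v \<in> T p" "w \<in> T p"
  shows "\<tau> p (a *\<^sub>R v + b *\<^sub>R w) = a * \<tau> p v + b * \<tau> p w"
  using assms linear_overD[of "T p" "\<tau> p" v w a b] unfolding one_forms_def by auto

lemma one_forms_smooth: "\<tau> \<in> one_forms A \<Longrightarrow> X \<in> VF \<Longrightarrow> (\<lambda>p. \<tau> p (X p)) \<in> S"
  unfolding one_forms_def by blast

text \<open>As \<open>\<alpha>(r) = 1\<close> and \<open>\<alpha>\<close> vanishes on
  \<open>H\<close>, the condition \<open>d\<alpha>(r, \<xi>) = 0\<close> says that the extension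
  vanishes on every \<open>[r, \<xi>]\<close>; together with \<open>D2\<close> these vectors span.
  In a frame with \<open>e 2 = r\<close> the extension is \<open>\<theta> 2\<close>, which makes it
  smooth.\<close>

lemma canonical_extension:
  shows canonical_extension_one_form: "\<omega> \<in> one_forms A"
    and canonical_extension_D2: "\<And>p v. v \<in> D2 p \<Longrightarrow> \<omega> p v = \<alpha> p v"
    and canonical_extension_reeb_bracket: "\<And>\<xi> p. \<xi> \<in> GH \<Longrightarrow> \<omega> p (lie_bracket reebf \<xi> p) = 0"
proof -
  define W where "W p v = (if v \<in> T p then (THE c. \<exists>e \<theta>. adapted_frame p e \<theta> \<and> e 2 = reebf \<and> c = \<theta> 2 p v) else 0)"
    for p v
  have W: "W p v = \<theta> 2 p v" if F: "adapted_frame p e \<theta>" "e 2 = reebf" and v: "v \<in> T p" for p e \<theta> v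
  proof -
    obtain \<xi> u where d: "\<xi> \<in> GH" "u \<in> D2 p" "v = lie_bracket reebf \<xi> p + u" by (rule tangent_decomposition[OF v])
    have *: "\<theta>' 2 p v = \<alpha> p u" if "adapted_frame p e' \<theta>'" "e' 2 = reebf" for e' \<theta>'
      unfolding d(3) by (rule canonical_extension_frame[OF that d(2,1)])
    have "(THE c. \<exists>e \<theta>. adapted_frame p e \<theta> \<and> e 2 = reebf \<and> c = \<theta> 2 p v) = \<theta> 2 p v"
    proof (rule the_equality)
      show "\<exists>e' \<theta>'. adapted_frame p e' \<theta>' \<and> e' 2 = reebf \<and> \<theta> 2 p v = \<theta>' 2 p v" using F by blast
    qed (use * *[OF F] in force)
    then show ?thesis using v unfolding W_def by simp
  qed
  have W_form: "W \<in> one_forms A"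
    unfolding one_forms_def linear_over_def
  proof (intro CollectI conjI allI ballI impI)
    fix p v w a b assume vw: "v \<in> T p" "w \<in> T p"
    obtain e \<theta> where F: "adapted_frame p e \<theta>" "e 2 = reebf" by (rule reeb_frame)
    have "a *\<^sub>R v + b *\<^sub>R w \<in> T p"
      using vw by (intro subspace_add[OF subspace_tangent_space] subspace_scale[OF subspace_tangent_space])
    then show "W p (a *\<^sub>R v + b *\<^sub>R w) = a *\<^sub>R W p v + b *\<^sub>R W p w"
      using W[OF F] vw linear_add[OF adapted_frame_linear[OF F(1), of 2]]
        linear_scale[OF adapted_frame_linear[OF F(1), of 2]] by simp
  next
    fix X assume X: "X \<in> VF"
    show "(\<lambda>p. W p (X p)) \<in> S"
    proof (rule smooth_funs_local)
      fix p
      obtain e \<theta> where F: "adapted_frame p e \<theta>" "e 2 = reebf" by (rule reeb_frame)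
      have "(\<lambda>q. \<theta> 2 q (X q)) \<in> S" by (rule lformsD(2)[OF adapted_frame_forms[OF F(1)] X]) simp
      moreover have "\<forall>\<^sub>F q in nhds p. W q (X q) = \<theta> 2 q (X q)"
        using adapted_frame_eventually[OF F(1)]
      proof eventually_elim
        case (elim q)
        show ?case by (rule W[OF elim F(2) vector_fieldsD(1)[OF X]])
      qed
      ultimately show "\<exists>g\<in>S. \<forall>\<^sub>F q in nhds p. W q (X q) = g q"
        by (intro bexI[of _ "\<lambda>q. \<theta> 2 q (X q)"])
    qed
  qed (simp add: W_def)
  have W_D2: "W p v = \<alpha> p v" if "v \<in> D2 p" for p v
  proof -
    obtain e \<theta> where F: "adapted_frame p e \<theta>" "e 2 = reebf" by (rule reeb_frame)
    show ?thesis using W[OF F] that D2_subset_T adapted_frame_contact_form[OF F(1) that] by auto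
  qed
  have W_br: "W p (lie_bracket reebf \<xi> p) = 0" if "\<xi> \<in> GH" for p \<xi>
  proof -
    obtain e \<theta> where F: "adapted_frame p e \<theta>" "e 2 = reebf" by (rule reeb_frame)
    have "lie_bracket reebf \<xi> p \<in> T p"
      by (rule vector_fieldsD(1)[OF vector_fields_bracket[OF reeb_section(2) GH_VF[OF that]]])
    then show ?thesis using W[OF F] frame_base_bracket[OF F(1) that] F(2) by simp
  qed
  have dr: "ext_deriv \<tau> reebf \<xi> p = - \<tau> p (lie_bracket reebf \<xi> p)"
    if "\<forall>p. \<forall>v\<in>D2 p. \<tau> p v = \<alpha> p v" "\<xi> \<in> GH" for \<tau> \<xi> p
  proof -
    have "\<tau> q (\<xi> q) = 0" for q
      using that sectionsD(2)[OF that(2)] H_subset_D2 contact_H by force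
    moreover have "\<tau> q (reebf q) = 1" for q using that(1) sectionsD(2)[OF reeb_section(1)] by simp
    ultimately show ?thesis
      unfolding ext_deriv_def using that(2)
      by (simp add: tangent_const[OF vector_fieldsD(1)[OF reeb_section(2)]] tangent_const[OF vector_fieldsD(1)[OF GH_VF]])
  qed
  have "\<omega> = W"
    unfolding canonical_extension_def
  proof (rule the_equality)
    show "W \<in> one_forms A \<and> (\<forall>p. \<forall>v\<in>D2 p. W p v = \<alpha> p v) \<and> (\<forall>\<xi>\<in>GH. ext_deriv W reebf \<xi> = (\<lambda>p. 0))"
      using W_form W_D2 W_br dr[of W] by (simp add: fun_eq_iff)
  next
    fix \<tau> assume *: "\<tau> \<in> one_forms A \<and> (\<forall>p. \<forall>v\<in>D2 p. \<tau> p v = \<alpha> p v) \<and> (\<forall>\<xi>\<in>GH. ext_deriv \<tau> reebf \<xi> = (\<lambda>p. 0))"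
    show "\<tau> = W"
    proof (intro ext)
      fix p v
      show "\<tau> p v = W p v"
      proof (cases "v \<in> T p")
        case True
        then obtain \<xi> u where d: "\<xi> \<in> GH" "u \<in> D2 p" "v = lie_bracket reebf \<xi> p + u"
          by (rule tangent_decomposition)
        have T: "lie_bracket reebf \<xi> p \<in> T p" "u \<in> T p"
          using d vector_fieldsD(1) D2_subset_T by blast+
        have "\<tau> p (lie_bracket reebf \<xi> p) = 0" using * dr[of \<tau> \<xi> p] d(1) by simp
        then show ?thesis
          using one_forms_linear[OF _ T, of \<tau> 1 1] one_forms_linear[OF W_form T, of 1 1] * W_form
            W_br[OF d(1)] W_D2[OF d(2)] d(2,3) by simp
      next
        case False
        then show ?thesis using * W_form unfolding one_forms_def by auto
      qed
    qed
  qed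
  then show "\<omega> \<in> one_forms A" "\<And>p v. v \<in> D2 p \<Longrightarrow> \<omega> p v = \<alpha> p v"
    "\<And>\<xi> p. \<xi> \<in> GH \<Longrightarrow> \<omega> p (lie_bracket reebf \<xi> p) = 0"
    using W_form W_D2 W_br by simp_all
qed

section \<open>The extended form and the decomposition of vector fields\<close>

lemmas omega_linear = one_forms_linear[OF canonical_extension_one_form]

lemma omega_combination:
  assumes "v \<in> T p" "w \<in> T p"
  shows omega_add: "\<omega> p (v + w) = \<omega> p v + \<omega> p w"
    and omega_diff: "\<omega> p (v - w) = \<omega> p v - \<omega> p w"
    and omega_scale: "\<omega> p (c *\<^sub>R v) = c * \<omega> p v"
  using omega_linear[OF assms, of 1 1] omega_linear[OF assms, of 1 "-1"] omega_linear[OF assms, of c 0] by simp_all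

lemma omega_smooth [simp, intro]: "X \<in> VF \<Longrightarrow> (\<lambda>p. \<omega> p (X p)) \<in> S"
  by (rule one_forms_smooth[OF canonical_extension_one_form])

lemma omega_GH: "\<xi> \<in> GH \<Longrightarrow> \<omega> p (\<xi> p) = 0"
  using canonical_extension_D2[of "\<xi> p" p] contact_H sectionsD(2) H_subset_D2 by auto

lemma omega_reeb [simp]: "\<omega> p (reebf p) = 1"
  using canonical_extension_D2[OF sectionsD(2)[OF reeb_section(1)]] by simp

lemma ext_deriv_GH:
  assumes "\<xi> \<in> GH" "\<eta> \<in> GH"
  shows "ext_deriv \<omega> \<xi> \<eta> p = - \<alpha> p (lie_bracket \<xi> \<eta> p)"
  unfolding ext_deriv_def
  using assms canonical_extension_D2[OF sectionsD(2)[OF GH_bracket_G2[OF assms]]]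
  by (simp add: omega_GH tangent_const[OF vector_fieldsD(1)[OF GH_VF]])

text \<open>The two components \<open>\<zeta>\<^sub>1\<close>, \<open>\<zeta>\<^sub>2\<close> of \<open>\<zeta> = [r, \<zeta>\<^sub>1] + \<alpha>(\<zeta>) r + \<zeta>\<^sub>2\<close>.\<close>

definition comp1 :: "'a vfield \<Rightarrow> 'a vfield" where
  "comp1 \<zeta> = - solve reebf \<zeta>"

definition comp2 :: "'a vfield \<Rightarrow> 'a vfield" where
  "comp2 \<zeta> = \<zeta> - lie_bracket reebf (comp1 \<zeta>) - fscale (\<lambda>p. \<omega> p (\<zeta> p)) reebf"

lemma comp1_GH [simp, intro]: "\<zeta> \<in> VF \<Longrightarrow> comp1 \<zeta> \<in> GH"
  unfolding comp1_def using solve_GH[OF normalized_reeb] by blast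

lemma bracket_minus_right: "lie_bracket X (- Y) = - lie_bracket X Y" if "X \<in> VF" "Y \<in> VF"
  unfolding minus_eq_fscale using that
  by (simp add: bracket_fscale_right fun_eq_iff tangent_const[OF vector_fieldsD(1)])

lemma bracket_comp1: "\<zeta> \<in> VF \<Longrightarrow> \<zeta> p - lie_bracket reebf (comp1 \<zeta>) p \<in> D2 p"
proof -
  assume z: "\<zeta> \<in> VF"
  have s: "solve reebf \<zeta> \<in> GH" by (rule solve_GH[OF normalized_reeb z])
  have "lie_bracket reebf (comp1 \<zeta>) p = lie_bracket (solve reebf \<zeta>) reebf p"
    unfolding comp1_def using s bracket_skew_at[of reebf "solve reebf \<zeta>" p] by (simp add: bracket_minus_right)
  then show ?thesis
    using subspace_neg[OF subspace_D2 bracket_solve[OF normalized_reeb z, of p]] by simp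
qed

lemma comp2_GH [simp, intro]:
  assumes z: "\<zeta> \<in> VF"
  shows "comp2 \<zeta> \<in> GH"
proof (rule sectionsI)
  have VF: "lie_bracket reebf (comp1 \<zeta>) \<in> VF" "fscale (\<lambda>p. \<omega> p (\<zeta> p)) reebf \<in> VF" using z by auto
  show "comp2 \<zeta> \<in> VF" unfolding comp2_def using z VF by blast
  fix p
  let ?x = "\<zeta> p - lie_bracket reebf (comp1 \<zeta>) p"
  have x: "?x \<in> D2 p" by (rule bracket_comp1[OF z])
  have y: "\<omega> p (\<zeta> p) *\<^sub>R reebf p \<in> D2 p"
    using sectionsD(2)[OF reeb_section(1)] subspace_scale[OF subspace_D2] by blast
  have "\<alpha> p ?x = \<omega> p (\<zeta> p)"
    using canonical_extension_D2[OF x] omega_diff[OF vector_fieldsD(1)[OF z, of p] vector_fieldsD(1)[OF VF(1), of p]]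
      canonical_extension_reeb_bracket[OF comp1_GH[OF z]] by simp
  then have "\<alpha> p (?x - \<omega> p (\<zeta> p) *\<^sub>R reebf p) = 0"
    using contact_diff[OF x y] contact_scale[OF sectionsD(2)[OF reeb_section(1)] sectionsD(2)[OF reeb_section(1)], of p]
    by simp
  then show "comp2 \<zeta> p \<in> H p"
    unfolding comp2_def using contact_kernel[OF subspace_diff[OF subspace_D2 x y]] by simp
qed

lemma decomposition_eq:
  assumes z: "\<zeta> \<in> VF"
  shows "decomposition A H \<alpha> \<zeta> = (comp1 \<zeta>, comp2 \<zeta>)"
  unfolding decomposition_def alpha_eval_def
proof (rule the_equality)
  show "case (comp1 \<zeta>, comp2 \<zeta>) of (\<zeta>1, \<zeta>2) \<Rightarrow> \<zeta>1 \<in> GH \<and> \<zeta>2 \<in> GH \<and>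
      \<zeta> = lie_bracket reebf \<zeta>1 + fscale (\<lambda>p. \<omega> p (\<zeta> p)) reebf + \<zeta>2"
    using z by (simp add: comp1_GH comp2_GH) (simp add: comp2_def)
next
  fix x assume "case x of (\<zeta>1, \<zeta>2) \<Rightarrow> \<zeta>1 \<in> GH \<and> \<zeta>2 \<in> GH \<and>
      \<zeta> = lie_bracket reebf \<zeta>1 + fscale (\<lambda>p. \<omega> p (\<zeta> p)) reebf + \<zeta>2"
  then obtain a b where x: "x = (a, b)" and ab: "a \<in> GH" "b \<in> GH"
    and eq: "\<zeta> = lie_bracket reebf a + fscale (\<lambda>p. \<omega> p (\<zeta> p)) reebf + b" by (cases x) auto
  have "- a = solve reebf \<zeta>"
  proof (rule solve_unique[OF normalized_reeb z])
    show "- a \<in> GH" using ab by blast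
    fix p
    have "lie_bracket (- a) reebf p = lie_bracket reebf a p"
      using bracket_minus_right[of reebf a] ab bracket_skew_at[of "- a" reebf p] by simp
    moreover have "\<zeta> p = lie_bracket reebf a p + \<omega> p (\<zeta> p) *\<^sub>R reebf p + b p"
      using fun_cong[OF eq, of p] by simp
    moreover have "x = y + w + z \<Longrightarrow> y - x = - (w + z)" for x y w z :: "'a tvec" by simp
    ultimately have "lie_bracket (- a) reebf p - \<zeta> p = - (\<omega> p (\<zeta> p) *\<^sub>R reebf p + b p)" by metis
    also have "\<dots> \<in> D2 p"
      using sectionsD(2)[OF reeb_section(1)] sectionsD(2)[OF GH_G2[OF ab(2)]]
      by (intro subspace_neg[OF subspace_D2] subspace_add[OF subspace_D2] subspace_scale[OF subspace_D2])
    finally show "lie_bracket (- a) reebf p - \<zeta> p \<in> D2 p" .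
  qed
  then have "a = comp1 \<zeta>" unfolding comp1_def by (metis add.inverse_inverse)
  moreover have "b = comp2 \<zeta>"
  proof -
    have "b = \<zeta> - lie_bracket reebf a - fscale (\<lambda>p. \<omega> p (\<zeta> p)) reebf" by (subst eq) simp
    then show ?thesis unfolding comp2_def \<open>a = comp1 \<zeta>\<close> .
  qed
  ultimately show "x = (comp1 \<zeta>, comp2 \<zeta>)" using x by simp
qed

lemma comp1_add: "X \<in> VF \<Longrightarrow> Y \<in> VF \<Longrightarrow> comp1 (X + Y) = comp1 X + comp1 Y"
  unfolding comp1_def by (simp add: solve_add[OF normalized_reeb])

lemma comp1_fscale: "X \<in> VF \<Longrightarrow> h \<in> S \<Longrightarrow> comp1 (fscale h X) = fscale h (comp1 X)"
  unfolding comp1_def by (simp add: solve_fscale[OF normalized_reeb] fun_eq_iff)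

lemma comp2_add: "X \<in> VF \<Longrightarrow> Y \<in> VF \<Longrightarrow> comp2 (X + Y) = comp2 X + comp2 Y"
  unfolding comp2_def
  by (simp add: comp1_add bracket_add_right fun_eq_iff omega_add[OF vector_fieldsD(1) vector_fieldsD(1)] algebra_simps)

text \<open>The bracket \<open>[r, h \<zeta>\<^sub>1]\<close> contains
  \<open>(r h) \<zeta>\<^sub>1\<close>, which the second component absorbs with the opposite sign.
  This defect is what \<Phi> and \<Psi> compensate in the projection.\<close>

lemma comp2_fscale:
  "X \<in> VF \<Longrightarrow> h \<in> S \<Longrightarrow> comp2 (fscale h X) = fscale h (comp2 X) - fscale (\<lambda>p. reebf p h) (comp1 X)"
  unfolding comp2_def
  by (simp add: comp1_fscale bracket_fscale_right fun_eq_iff omega_scale[OF vector_fieldsD(1) vector_fieldsD(1)] algebra_simps)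

lemma comp_GH:
  assumes "\<xi> \<in> GH"
  shows "comp1 \<xi> = 0" "comp2 \<xi> = \<xi>"
proof -
  have "solve reebf (fscale (\<lambda>p. 0) \<xi>) = fscale (\<lambda>p. 0) (solve reebf \<xi>)"
    using assms by (intro solve_fscale[OF normalized_reeb]) auto
  moreover have "fscale (\<lambda>p. 0) X = 0" for X :: "'a vfield" by (simp add: fun_eq_iff)
  ultimately have z: "solve reebf 0 = 0" by metis
  have "solve reebf \<xi> p = solve reebf 0 p" for p
    using assms sectionsD(2)[OF GH_G2] by (intro solve_cong[OF normalized_reeb]) auto
  then show c1: "comp1 \<xi> = 0" unfolding comp1_def using z by (simp add: fun_eq_iff)
  show "comp2 \<xi> = \<xi>"
    unfolding comp2_def c1 by (simp add: bracket_zero_right fun_eq_iff omega_GH[OF assms])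
qed

lemma comp_reeb: "comp1 reebf = 0" "comp2 reebf = 0"
proof -
  have "solve reebf reebf p = solve reebf 0 p" for p
    using sectionsD(2)[OF reeb_section(1)] by (intro solve_cong[OF normalized_reeb]) auto
  moreover have "solve reebf 0 = 0" using comp_GH(1)[OF GH_closed(1)] unfolding comp1_def by simp
  ultimately show c1: "comp1 reebf = 0" unfolding comp1_def by (simp add: fun_eq_iff)
  show "comp2 reebf = 0"
    unfolding comp2_def c1 by (simp add: bracket_zero_right fun_eq_iff)
qed

lemma comp_reeb_bracket:
  assumes "\<xi> \<in> GH"
  shows "comp1 (lie_bracket reebf \<xi>) = \<xi>" "comp2 (lie_bracket reebf \<xi>) = 0"
proof -
  have "lie_bracket reebf \<xi> = lie_bracket (- \<xi>) reebf"
    using bracket_minus_right[of reebf \<xi>] bracket_skew[of "- \<xi>" reebf] assms by simp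
  then show c1: "comp1 (lie_bracket reebf \<xi>) = \<xi>"
    unfolding comp1_def using solve_bracket[OF normalized_reeb, of "- \<xi>"] assms by simp
  show "comp2 (lie_bracket reebf \<xi>) = 0"
    unfolding comp2_def c1 by (simp add: fun_eq_iff canonical_extension_reeb_bracket[OF assms])
qed

section \<open>The partial connection of the Reeb field and its curvature\<close>

abbreviation "conn \<equiv> nabla A H reebf"

lemma conn_eq: "\<xi> \<in> GH \<Longrightarrow> \<eta> \<in> GH \<Longrightarrow> conn \<xi> \<eta> = solve reebf (lie_bracket \<xi> (lie_bracket \<eta> reebf))"
  by (rule nabla_eq_solve[OF normalized_reeb])

lemma conn_GH [simp, intro]: "\<xi> \<in> GH \<Longrightarrow> \<eta> \<in> GH \<Longrightarrow> conn \<xi> \<eta> \<in> GH"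
  using conn_eq solve_GH[OF normalized_reeb] by auto

lemma solve_eqI:
  assumes "X \<in> VF" "Y \<in> VF" "\<And>p. X p - Y p \<in> D2 p"
  shows "solve reebf X = solve reebf Y"
  by (rule ext, rule solve_cong[OF normalized_reeb assms])

lemma conn_add_left: "\<xi> \<in> GH \<Longrightarrow> \<xi>' \<in> GH \<Longrightarrow> \<eta> \<in> GH \<Longrightarrow> conn (\<xi> + \<xi>') \<eta> = conn \<xi> \<eta> + conn \<xi>' \<eta>"
  by (simp add: conn_eq bracket_add_left solve_add[OF normalized_reeb])

lemma conn_add_right: "\<xi> \<in> GH \<Longrightarrow> \<eta> \<in> GH \<Longrightarrow> \<eta>' \<in> GH \<Longrightarrow> conn \<xi> (\<eta> + \<eta>') = conn \<xi> \<eta> + conn \<xi> \<eta>'"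
  by (simp add: conn_eq bracket_add_left bracket_add_right solve_add[OF normalized_reeb])

text \<open>The term that differentiates \<open>h\<close> is a multiple of \<open>\<xi>\<close>, and
  \<open>solve\<close> ignores \<open>D2\<close>.\<close>

lemma conn_fscale_left:
  assumes "\<xi> \<in> GH" "\<eta> \<in> GH" "h \<in> S"
  shows "conn (fscale h \<xi>) \<eta> = fscale h (conn \<xi> \<eta>)"
proof -
  let ?W = "lie_bracket \<eta> reebf"
  have "solve reebf (lie_bracket (fscale h \<xi>) ?W) = solve reebf (fscale h (lie_bracket \<xi> ?W))"
  proof (rule solve_eqI)
    fix p
    have "lie_bracket (fscale h \<xi>) ?W p - fscale h (lie_bracket \<xi> ?W) p = (- ?W p h) *\<^sub>R \<xi> p"
      using assms by (simp add: bracket_fscale_left)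
    also have "\<dots> \<in> D2 p"
      using sectionsD(2)[OF GH_G2[OF assms(1)]] by (rule subspace_scale[OF subspace_D2])
    finally show "lie_bracket (fscale h \<xi>) ?W p - fscale h (lie_bracket \<xi> ?W) p \<in> D2 p" .
  qed (use assms in auto)
  then show ?thesis using assms by (simp add: conn_eq solve_fscale[OF normalized_reeb])
qed

text \<open>\<open>[h \<eta>, r]\<close> contributes \<open>- (r h) \<eta>\<close>, whose bracket
  with \<open>\<xi>\<close> lies in \<open>D2\<close> and is lost. The derivative that remains is
  \<open>(\<xi> h) [\<eta>, r]\<close>, which \<open>solve\<close> turns into
  \<open>(\<xi> h) \<eta>\<close>.\<close>

lemma conn_fscale_right:
  assumes "\<xi> \<in> GH" "\<eta> \<in> GH" "h \<in> S"
  shows "conn \<xi> (fscale h \<eta>) = fscale h (conn \<xi> \<eta>) + fscale (\<lambda>p. \<xi> p h) \<eta>"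
proof -
  let ?W = "lie_bracket \<eta> reebf"
  have sm: "(\<lambda>p. \<xi> p h) \<in> S" "(\<lambda>p. reebf p h) \<in> S" using assms vector_fieldsD(2) by blast+
  let ?Y = "fscale h (lie_bracket \<xi> ?W) + fscale (\<lambda>p. \<xi> p h) ?W"
  let ?K = "fscale (\<lambda>p. reebf p h) \<eta>"
  have K: "?K \<in> GH" using sm assms by blast
  have e: "lie_bracket \<xi> (fscale h ?W - ?K) = ?Y - lie_bracket \<xi> ?K"
    using bracket_add_right[of \<xi> "fscale h ?W" "- ?K"] bracket_minus_right[of \<xi> ?K] assms sm
    by (simp add: bracket_fscale_right)
  have "solve reebf (lie_bracket \<xi> (lie_bracket (fscale h \<eta>) reebf)) = solve reebf ?Y"
  proof (rule solve_eqI)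
    fix p
    have "lie_bracket \<xi> (lie_bracket (fscale h \<eta>) reebf) p - ?Y p = - lie_bracket \<xi> ?K p"
      using assms e by (simp add: bracket_fscale_left)
    also have "\<dots> \<in> D2 p"
      using sectionsD(2)[OF GH_bracket_G2[OF assms(1) K]] by (rule subspace_neg[OF subspace_D2])
    finally show "lie_bracket \<xi> (lie_bracket (fscale h \<eta>) reebf) p - ?Y p \<in> D2 p" .
  qed (use assms sm in auto)
  also have "\<dots> = fscale h (solve reebf (lie_bracket \<xi> ?W)) + fscale (\<lambda>p. \<xi> p h) \<eta>"
    using assms sm by (simp add: solve_add[OF normalized_reeb] solve_fscale[OF normalized_reeb] solve_bracket[OF normalized_reeb])
  finally show ?thesis using assms by (simp add: conn_eq)
qed

definition Hpart :: "'a vfield \<Rightarrow> 'a vfield \<Rightarrow> 'a vfield" where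
  "Hpart \<xi> \<eta> = lie_bracket \<xi> \<eta> - fscale (\<lambda>p. \<alpha> p (lie_bracket \<xi> \<eta> p)) reebf"

text \<open>The curvature of a partial connection, the left-hand side of the equation for
  \<open>Phi\<close>. Only derivatives along \<open>H\<close> are available, so the bracket is
  replaced by its projection \<open>Hpart\<close> along the Reeb field.\<close>

definition curv :: "'a vfield \<Rightarrow> 'a vfield \<Rightarrow> 'a vfield \<Rightarrow> 'a vfield" where
  "curv \<xi> \<eta> \<gamma> = conn \<xi> (conn \<eta> \<gamma>) - conn \<eta> (conn \<xi> \<gamma>) - conn (Hpart \<xi> \<eta>) \<gamma>"

lemma Hpart_GH [simp, intro]:
  assumes "\<xi> \<in> GH" "\<eta> \<in> GH"
  shows "Hpart \<xi> \<eta> \<in> GH"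
proof (rule sectionsI)
  have B: "lie_bracket \<xi> \<eta> \<in> G2" using assms by blast
  show "Hpart \<xi> \<eta> \<in> VF" unfolding Hpart_def using B contact_smooth[OF B] by auto
  fix p
  have x: "lie_bracket \<xi> \<eta> p \<in> D2 p" "reebf p \<in> D2 p" using B sectionsD(2) reeb_section(1) by blast+
  have y: "\<alpha> p (lie_bracket \<xi> \<eta> p) *\<^sub>R reebf p \<in> D2 p" using x(2) subspace_scale[OF subspace_D2] by blast
  have "\<alpha> p (lie_bracket \<xi> \<eta> p - \<alpha> p (lie_bracket \<xi> \<eta> p) *\<^sub>R reebf p) = 0"
    using contact_diff[OF x(1) y] contact_scale[OF x(2,2)] by simp
  then show "Hpart \<xi> \<eta> p \<in> H p"
    unfolding Hpart_def using contact_kernel[OF subspace_diff[OF subspace_D2 x(1) y]] by simp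
qed

lemma curv_GH [simp, intro]: "\<xi> \<in> GH \<Longrightarrow> \<eta> \<in> GH \<Longrightarrow> \<gamma> \<in> GH \<Longrightarrow> curv \<xi> \<eta> \<gamma> \<in> GH"
  unfolding curv_def by blast

lemma fscale_neg_one: "fscale (\<lambda>p. -1) X = - X"
  by (simp add: fun_eq_iff)

lemma conn_minus_left: "\<xi> \<in> GH \<Longrightarrow> \<eta> \<in> GH \<Longrightarrow> conn (- \<xi>) \<eta> = - conn \<xi> \<eta>"
  using conn_fscale_left[of \<xi> \<eta> "\<lambda>p. -1"] by (simp add: fscale_neg_one)

lemma curv_skew:
  assumes "\<xi> \<in> GH" "\<eta> \<in> GH" "\<gamma> \<in> GH"
  shows "curv \<eta> \<xi> \<gamma> = - curv \<xi> \<eta> \<gamma>"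
proof -
  have "Hpart \<eta> \<xi> = - Hpart \<xi> \<eta>"
  proof
    fix p
    have "\<alpha> p (- lie_bracket \<xi> \<eta> p) = - \<alpha> p (lie_bracket \<xi> \<eta> p)"
      using contact_scale[of "lie_bracket \<xi> \<eta> p" p "lie_bracket \<xi> \<eta> p" "-1"]
        sectionsD(2)[OF GH_bracket_G2[OF assms(1,2)]] by simp
    then show "Hpart \<eta> \<xi> p = (- Hpart \<xi> \<eta>) p"
      unfolding Hpart_def by (simp add: bracket_skew_at[of \<eta> \<xi> p])
  qed
  then show ?thesis unfolding curv_def using assms by (simp add: conn_minus_left)
qed

lemma contact_bracket_add:
  assumes "\<xi> \<in> GH" "\<xi>' \<in> GH" "\<eta> \<in> GH"
  shows "\<alpha> p (lie_bracket (\<xi> + \<xi>') \<eta> p) = \<alpha> p (lie_bracket \<xi> \<eta> p) + \<alpha> p (lie_bracket \<xi>' \<eta> p)"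
  using assms contact_add sectionsD(2)[OF GH_bracket_G2] by (simp add: bracket_add_left)

lemma contact_bracket_fscale:
  assumes "\<xi> \<in> GH" "\<eta> \<in> GH" "h \<in> S"
  shows "\<alpha> p (lie_bracket (fscale h \<xi>) \<eta> p) = h p * \<alpha> p (lie_bracket \<xi> \<eta> p)"
proof -
  have B: "lie_bracket \<xi> \<eta> p \<in> D2 p" using sectionsD(2)[OF GH_bracket_G2[OF assms(1,2)]] .
  have x: "\<eta> p h *\<^sub>R \<xi> p \<in> H p" using sectionsD(2)[OF assms(1)] by (rule subspace_scale[OF subspace_H])
  have "\<alpha> p (h p *\<^sub>R lie_bracket \<xi> \<eta> p - \<eta> p h *\<^sub>R \<xi> p) = h p * \<alpha> p (lie_bracket \<xi> \<eta> p)"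
    using contact_diff[OF subspace_scale[OF subspace_D2 B, of "h p"] subsetD[OF H_subset_D2 x]] contact_H[OF x]
      contact_scale[OF B B] by simp
  then show ?thesis using assms by (simp add: bracket_fscale_left)
qed

lemma curv_add_left:
  assumes "\<xi> \<in> GH" "\<xi>' \<in> GH" "\<eta> \<in> GH" "\<gamma> \<in> GH"
  shows "curv (\<xi> + \<xi>') \<eta> \<gamma> = curv \<xi> \<eta> \<gamma> + curv \<xi>' \<eta> \<gamma>"
proof -
  have "Hpart (\<xi> + \<xi>') \<eta> = Hpart \<xi> \<eta> + Hpart \<xi>' \<eta>"
    unfolding Hpart_def using assms contact_bracket_add[OF assms(1-3)]
    by (simp add: bracket_add_left fun_eq_iff algebra_simps)
  then show ?thesis
    unfolding curv_def using assms by (simp add: conn_add_left conn_add_right)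
qed

text \<open>The term \<open>(\<eta> h) \<nabla>\<^sub>\<xi> \<gamma>\<close> arises from the
  iterated derivative and from \<open>Hpart\<close>, with opposite signs.\<close>

lemma curv_fscale_left:
  assumes "\<xi> \<in> GH" "\<eta> \<in> GH" "\<gamma> \<in> GH" and h: "h \<in> S"
  shows "curv (fscale h \<xi>) \<eta> \<gamma> = fscale h (curv \<xi> \<eta> \<gamma>)"
proof -
  have sm: "(\<lambda>p. \<eta> p h) \<in> S" using assms vector_fieldsD(2) by blast
  have "Hpart (fscale h \<xi>) \<eta> = fscale h (Hpart \<xi> \<eta>) + fscale (\<lambda>p. \<eta> p h) (- \<xi>)"
    unfolding Hpart_def using assms contact_bracket_fscale[OF assms(1,2) h]
    by (simp add: bracket_fscale_left fun_eq_iff algebra_simps)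
  then have "conn (Hpart (fscale h \<xi>) \<eta>) \<gamma> = fscale h (conn (Hpart \<xi> \<eta>) \<gamma>) - fscale (\<lambda>p. \<eta> p h) (conn \<xi> \<gamma>)"
    using assms sm by (simp add: conn_add_left conn_fscale_left conn_minus_left) (simp add: fun_eq_iff)
  then show ?thesis
    unfolding curv_def using assms
    by (simp add: conn_fscale_left conn_fscale_right) (simp add: fun_eq_iff algebra_simps)
qed

lemma curv_add_right:
  assumes "\<xi> \<in> GH" "\<eta> \<in> GH" "\<gamma> \<in> GH" "\<gamma>' \<in> GH"
  shows "curv \<xi> \<eta> (\<gamma> + \<gamma>') = curv \<xi> \<eta> \<gamma> + curv \<xi> \<eta> \<gamma>'"
  unfolding curv_def using assms by (simp add: conn_add_right)

text \<open>Not tensorial in \<open>\<gamma>\<close>, unlike a full curvature: the second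
  derivatives of \<open>h\<close> combine to \<open>[\<xi>, \<eta>] h\<close>, of which
  \<open>Hpart\<close> cancels all but \<open>\<alpha>([\<xi>, \<eta>]) (r h)\<close>. This is the
  source of the Leibniz rule of \<open>Phi\<close> along the Reeb field.\<close>

lemma curv_fscale_right:
  assumes "\<xi> \<in> GH" "\<eta> \<in> GH" "\<gamma> \<in> GH" and h: "h \<in> S"
  shows "curv \<xi> \<eta> (fscale h \<gamma>) = fscale h (curv \<xi> \<eta> \<gamma>) + fscale (\<lambda>p. \<alpha> p (lie_bracket \<xi> \<eta> p) * reebf p h) \<gamma>"
proof -
  have sm: "(\<lambda>p. \<xi> p h) \<in> S" "(\<lambda>p. \<eta> p h) \<in> S" using assms vector_fieldsD(2) by blast+
  have two: "conn \<xi> (conn \<eta> (fscale h \<gamma>)) = fscale h (conn \<xi> (conn \<eta> \<gamma>)) + fscale (\<lambda>p. \<xi> p h) (conn \<eta> \<gamma>)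
      + (fscale (\<lambda>p. \<eta> p h) (conn \<xi> \<gamma>) + fscale (\<lambda>p. \<xi> p (\<lambda>q. \<eta> q h)) \<gamma>)"
    if "\<xi> \<in> GH" "\<eta> \<in> GH" "(\<lambda>p. \<eta> p h) \<in> S" for \<xi> \<eta>
    using that assms(3) h by (simp add: conn_fscale_right conn_add_right)
  have "Hpart \<xi> \<eta> p h = \<xi> p (\<lambda>q. \<eta> q h) - \<eta> p (\<lambda>q. \<xi> q h) - \<alpha> p (lie_bracket \<xi> \<eta> p) * reebf p h" for p
    unfolding Hpart_def by (simp add: lie_bracket_def)
  then show ?thesis
    unfolding curv_def two[OF assms(1,2) sm(2)] two[OF assms(2,1) sm(1)]
    using assms by (simp add: conn_fscale_right) (simp add: fun_eq_iff algebra_simps)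
qed

section \<open>Tensorial operators and the reduction of the curvature to \<Phi>\<close>

definition tensorial :: "'a vfield set \<Rightarrow> ('a vfield \<Rightarrow> 'a \<Rightarrow> 'b::real_vector) \<Rightarrow> bool" where
  "tensorial M F \<longleftrightarrow> (\<forall>X\<in>M. \<forall>Y\<in>M. \<forall>p. F (X + Y) p = F X p + F Y p) \<and>
     (\<forall>h\<in>S. \<forall>X\<in>M. \<forall>p. F (fscale h X) p = h p *\<^sub>R F X p)"

lemma tensorialI:
  assumes "\<And>X Y p. X \<in> M \<Longrightarrow> Y \<in> M \<Longrightarrow> F (X + Y) p = F X p + F Y p"
    "\<And>h X p. h \<in> S \<Longrightarrow> X \<in> M \<Longrightarrow> F (fscale h X) p = h p *\<^sub>R F X p"
  shows "tensorial M F"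
  using assms unfolding tensorial_def by blast

lemma tensorialD:
  assumes "tensorial M F"
  shows "X \<in> M \<Longrightarrow> Y \<in> M \<Longrightarrow> F (X + Y) p = F X p + F Y p"
    and "h \<in> S \<Longrightarrow> X \<in> M \<Longrightarrow> F (fscale h X) p = h p *\<^sub>R F X p"
  using assms unfolding tensorial_def by blast+

lemma tensorial_local:
  assumes F: "tensorial (sections A E) F" and E: "\<And>p. subspace (E p)"
    and X: "X \<in> sections A E" and Y: "Y \<in> sections A E" and eq: "\<forall>\<^sub>F q in nhds p. X q = Y q"
  shows "F X p = F Y p"
proof -
  obtain W where W: "open W" "p \<in> W" "\<And>q. q \<in> W \<Longrightarrow> X q = Y q"
    using eq unfolding eventually_nhds by blast
  obtain b V where b: "b \<in> S" "\<forall>\<^sub>F q in nhds p. b q = 1" "open V" "- W \<subseteq> V" "\<And>q. q \<in> V \<Longrightarrow> b q = 0"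
    using bump_function[OF W(1,2)] by blast
  have bp: "b p = 1" by (rule eventually_nhds_x_imp_x[OF b(2)])
  have "fscale b X = fscale b Y"
  proof
    fix q show "fscale b X q = fscale b Y q"
      using W(3)[of q] b(4) b(5)[of q] by (cases "q \<in> W") auto
  qed
  then show ?thesis using tensorialD(2)[OF F b(1) X, of p] tensorialD(2)[OF F b(1) Y, of p] bp by simp
qed

lemma tensorial_frame_H:
  assumes F: "adapted_frame p e \<theta>" and t: "tensorial GH f" and x: "\<xi> \<in> GH"
  shows "f \<xi> p = \<theta> 0 p (\<xi> p) *\<^sub>R f (e 0) p + \<theta> 1 p (\<xi> p) *\<^sub>R f (e 1) p"
proof -
  note fr = adapted_frameD[OF F]
  have sm: "(\<lambda>q. \<theta> 0 q (\<xi> q)) \<in> S" "(\<lambda>q. \<theta> 1 q (\<xi> q)) \<in> S"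
    using x lformsD(2)[OF adapted_frame_forms[OF F]] by auto
  let ?X = "fscale (\<lambda>q. \<theta> 0 q (\<xi> q)) (e 0) + fscale (\<lambda>q. \<theta> 1 q (\<xi> q)) (e 1)"
  have "\<forall>\<^sub>F q in nhds p. \<xi> q = ?X q"
    using adapted_frame_eventually[OF F]
  proof eventually_elim
    case (elim q)
    show ?case using adapted_frame_H_expansion[OF elim sectionsD(2)[OF x]] by simp
  qed
  then have "f \<xi> p = f ?X p"
    using fr sm x by (intro tensorial_local[OF t subspace_H]) auto
  then show ?thesis using fr sm by (simp add: tensorialD[OF t])
qed

text \<open>The curvature is alternating and tensorial in \<open>\<xi>\<close> and
  \<open>\<eta>\<close>. As \<open>H\<close> has rank two, such a map is a multiple of the Levi
  form, and the multiple is its value on a pair with Levi form 1.\<close>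

lemma curv_levi_form:
  assumes x: "\<xi> \<in> GH" and y: "\<eta> \<in> GH" and c: "\<gamma> \<in> GH" and F: "adapted_frame p e \<theta>"
  shows "curv \<xi> \<eta> \<gamma> p = \<alpha> p (lie_bracket \<xi> \<eta> p) *\<^sub>R curv (e 0) (e 1) \<gamma> p"
proof -
  note fr = adapted_frameD[OF F]
  have left: "tensorial GH (\<lambda>\<xi>. curv \<xi> \<eta> \<gamma>)" if "\<eta> \<in> GH" for \<eta>
    using that c by (intro tensorialI) (simp_all add: curv_add_left curv_fscale_left)
  have expand: "curv \<xi> \<eta> \<gamma> p = \<theta> 0 p (\<xi> p) *\<^sub>R curv (e 0) \<eta> \<gamma> p + \<theta> 1 p (\<xi> p) *\<^sub>R curv (e 1) \<eta> \<gamma> p"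
    if "\<xi> \<in> GH" "\<eta> \<in> GH" for \<xi> \<eta>
    using tensorial_frame_H[OF F left[OF that(2)] that(1)] .
  have sk: "curv \<eta> \<xi> \<gamma> p = - curv \<xi> \<eta> \<gamma> p" if "\<xi> \<in> GH" "\<eta> \<in> GH" for \<xi> \<eta>
    using curv_skew[OF that c] by simp
  have diag: "curv \<xi> \<xi> \<gamma> p = 0" if "\<xi> \<in> GH" for \<xi>
    using sk[OF that that] scaleR_2[of "curv \<xi> \<xi> \<gamma> p"] by (simp add: eq_neg_iff_add_eq_0)
  have "curv (e 0) \<eta> \<gamma> p = \<theta> 1 p (\<eta> p) *\<^sub>R curv (e 0) (e 1) \<gamma> p"
    unfolding sk[OF y fr(1)] expand[OF y fr(1)] sk[OF fr(1) fr(2)] diag[OF fr(1)] by simp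
  moreover have "curv (e 1) \<eta> \<gamma> p = - \<theta> 0 p (\<eta> p) *\<^sub>R curv (e 0) (e 1) \<gamma> p"
    unfolding sk[OF y fr(2)] expand[OF y fr(2)] diag[OF fr(2)] by simp
  ultimately show ?thesis
    unfolding expand[OF x y] adapted_frame_levi_form[OF F x y] using fr by (simp add: algebra_simps)
qed

text \<open>\<open>Phi\<close> is the factor in \<open>curv_levi_form\<close>. Its values in two
  adapted frames agree because both are normalized, and near each point it is the smooth section
  \<open>curv (e 0) (e 1) \<gamma>\<close>. Uniqueness holds since the Levi form attains 1 at every
  point.\<close>

lemma Phi_properties:
  assumes c: "\<gamma> \<in> GH"
  shows Phi_GH: "Phi A H \<alpha> \<gamma> \<in> GH"
    and Phi_frame: "\<And>p e \<theta>. adapted_frame p e \<theta> \<Longrightarrow> Phi A H \<alpha> \<gamma> p = curv (e 0) (e 1) \<gamma> p"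
proof -
  define P where "P q = (THE v. \<exists>e \<theta>. adapted_frame q e \<theta> \<and> v = curv (e 0) (e 1) \<gamma> q)" for q
  have P: "P q = curv (e 0) (e 1) \<gamma> q" if F: "adapted_frame q e \<theta>" for q e \<theta>
    unfolding P_def
  proof (rule the_equality)
    fix v assume "\<exists>e \<theta>. adapted_frame q e \<theta> \<and> v = curv (e 0) (e 1) \<gamma> q"
    then obtain e' \<theta>' where F': "adapted_frame q e' \<theta>'" "v = curv (e' 0) (e' 1) \<gamma> q" by blast
    then show "v = curv (e 0) (e 1) \<gamma> q"
      using curv_levi_form[OF adapted_frameD(1,2)[OF F'(1)] c F] adapted_frame_contact(2)[OF F'(1)] by simp
  qed (use F in blast)
  have loc: "\<exists>Z\<in>GH. \<forall>\<^sub>F q in nhds p. P q = Z q" for p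
  proof -
    obtain e \<theta> where F: "adapted_frame p e \<theta>" by (rule reeb_frame)
    have "\<forall>\<^sub>F q in nhds p. P q = curv (e 0) (e 1) \<gamma> q"
      using adapted_frame_eventually[OF F] by eventually_elim (rule P)
    then show ?thesis using curv_GH[OF adapted_frameD(1,2)[OF F] c] by blast
  qed
  have PGH: "P \<in> GH"
  proof (rule sectionsI)
    show "P \<in> VF" by (rule vector_fields_local) (use loc in blast)
    fix p
    obtain Z where Z: "Z \<in> GH" "\<forall>\<^sub>F q in nhds p. P q = Z q" using loc by blast
    show "P p \<in> H p" using eventually_nhds_x_imp_x[OF Z(2)] sectionsD(2)[OF Z(1)] by simp
  qed
  have al: "alpha_eval A H \<alpha> (lie_bracket \<xi> \<eta>) = (\<lambda>p. \<alpha> p (lie_bracket \<xi> \<eta> p))" if "\<xi> \<in> GH" "\<eta> \<in> GH" for \<xi> \<eta>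
    unfolding alpha_eval_def using canonical_extension_D2[OF sectionsD(2)[OF GH_bracket_G2[OF that]]] by simp
  have "Phi A H \<alpha> \<gamma> = (THE \<delta>. \<delta> \<in> GH \<and> (\<forall>\<xi>\<in>GH. \<forall>\<eta>\<in>GH.
      curv \<xi> \<eta> \<gamma> = fscale (\<lambda>p. \<alpha> p (lie_bracket \<xi> \<eta> p)) \<delta>))"
    unfolding Phi_def Let_def curv_def Hpart_def using al by (intro arg_cong[of _ _ The] ext) auto
  also have "\<dots> = P"
  proof (rule the_equality)
    show "P \<in> GH \<and> (\<forall>\<xi>\<in>GH. \<forall>\<eta>\<in>GH. curv \<xi> \<eta> \<gamma> = fscale (\<lambda>p. \<alpha> p (lie_bracket \<xi> \<eta> p)) P)"
    proof (intro conjI PGH ballI, rule ext)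
      fix \<xi> \<eta> p assume "\<xi> \<in> GH" "\<eta> \<in> GH"
      obtain e \<theta> where F: "adapted_frame p e \<theta>" by (rule reeb_frame)
      show "curv \<xi> \<eta> \<gamma> p = fscale (\<lambda>p. \<alpha> p (lie_bracket \<xi> \<eta> p)) P p"
        using curv_levi_form[OF \<open>\<xi> \<in> GH\<close> \<open>\<eta> \<in> GH\<close> c F] P[OF F] by simp
    qed
  next
    fix \<delta> assume *: "\<delta> \<in> GH \<and> (\<forall>\<xi>\<in>GH. \<forall>\<eta>\<in>GH. curv \<xi> \<eta> \<gamma> = fscale (\<lambda>p. \<alpha> p (lie_bracket \<xi> \<eta> p)) \<delta>)"
    show "\<delta> = P"
    proof
      fix p
      obtain e \<theta> where F: "adapted_frame p e \<theta>" by (rule reeb_frame)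
      have "curv (e 0) (e 1) \<gamma> = fscale (\<lambda>p. \<alpha> p (lie_bracket (e 0) (e 1) p)) \<delta>"
        using * adapted_frameD(1,2)[OF F] by blast
      then have "curv (e 0) (e 1) \<gamma> p = \<delta> p" using adapted_frame_contact(2)[OF F] by simp
      then show "\<delta> p = P p" using P[OF F] by simp
    qed
  qed
  finally have eq: "Phi A H \<alpha> \<gamma> = P" .
  show "Phi A H \<alpha> \<gamma> \<in> GH" unfolding eq by (rule PGH)
  show "Phi A H \<alpha> \<gamma> p = curv (e 0) (e 1) \<gamma> p" if "adapted_frame p e \<theta>" for p e \<theta>
    unfolding eq by (rule P[OF that])
qed

section \<open>Leibniz rules for \<Phi> and \<Psi> along the Reeb field\<close>

lemma Phi_add:
  assumes "\<gamma> \<in> GH" "\<gamma>' \<in> GH"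
  shows "Phi A H \<alpha> (\<gamma> + \<gamma>') = Phi A H \<alpha> \<gamma> + Phi A H \<alpha> \<gamma>'"
proof
  fix p
  obtain e \<theta> where F: "adapted_frame p e \<theta>" by (rule reeb_frame)
  show "Phi A H \<alpha> (\<gamma> + \<gamma>') p = (Phi A H \<alpha> \<gamma> + Phi A H \<alpha> \<gamma>') p"
    using assms adapted_frameD[OF F] by (simp add: Phi_frame[OF _ F] curv_add_right)
qed

lemma Phi_fscale:
  assumes "\<gamma> \<in> GH" "h \<in> S"
  shows "Phi A H \<alpha> (fscale h \<gamma>) = fscale h (Phi A H \<alpha> \<gamma>) + fscale (\<lambda>p. reebf p h) \<gamma>"
proof
  fix p
  obtain e \<theta> where F: "adapted_frame p e \<theta>" by (rule reeb_frame)
  show "Phi A H \<alpha> (fscale h \<gamma>) p = (fscale h (Phi A H \<alpha> \<gamma>) + fscale (\<lambda>p. reebf p h) \<gamma>) p"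
    using assms adapted_frameD[OF F] adapted_frame_contact[OF F] by (simp add: Phi_frame[OF _ F] curv_fscale_right)
qed

lemma Psi_eq: "\<gamma> \<in> GH \<Longrightarrow> Psi A H \<alpha> \<gamma> = solve reebf ((1/2) *\<^sub>R lie_bracket reebf (lie_bracket \<gamma> reebf))"
  unfolding Psi_def Let_def by (intro the_levi2_solve[OF normalized_reeb]) auto

lemma Psi_GH: "\<gamma> \<in> GH \<Longrightarrow> Psi A H \<alpha> \<gamma> \<in> GH"
  unfolding Psi_eq by (intro solve_GH[OF normalized_reeb]) auto

lemma Psi_add:
  assumes "\<gamma> \<in> GH" "\<gamma>' \<in> GH"
  shows "Psi A H \<alpha> (\<gamma> + \<gamma>') = Psi A H \<alpha> \<gamma> + Psi A H \<alpha> \<gamma>'"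
  using assms by (simp add: Psi_eq bracket_add_left bracket_add_right scaleR_add_right solve_add[OF normalized_reeb])

text \<open>Modulo \<open>D2\<close>, \<open>[r, [h \<gamma>, r]]\<close> equals
  \<open>h [r, [\<gamma>, r]] + 2 (r h) [\<gamma>, r]\<close>, since each of the two brackets
  differentiates \<open>h\<close> once. The factor \<open>1/2\<close> in \<open>Psi\<close> reduces
  the coefficient to one, and \<open>solve\<close> recovers \<open>\<gamma>\<close> from
  \<open>[\<gamma>, r]\<close>.\<close>

lemma Psi_fscale:
  assumes c: "\<gamma> \<in> GH" and h: "h \<in> S"
  shows "Psi A H \<alpha> (fscale h \<gamma>) = fscale h (Psi A H \<alpha> \<gamma>) + fscale (\<lambda>p. reebf p h) \<gamma>"
proof -
  let ?W = "lie_bracket \<gamma> reebf" and ?k = "\<lambda>p. reebf p h"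
  have k: "?k \<in> S" "(\<lambda>p. reebf p ?k) \<in> S" using vector_fieldsD(2) h reeb_section(2) by blast+
  let ?Y = "fscale h ((1/2) *\<^sub>R lie_bracket reebf ?W) + fscale ?k ?W"
  have VF: "?W \<in> VF" "\<gamma> \<in> VF" using c by auto
  have e1: "lie_bracket (fscale h \<gamma>) reebf = fscale h ?W + fscale ?k (- \<gamma>)"
    using VF h by (simp add: bracket_fscale_left fun_eq_iff)
  have e2: "lie_bracket reebf (fscale h ?W + fscale ?k (- \<gamma>)) =
      fscale h (lie_bracket reebf ?W) + fscale ?k ?W + (fscale ?k (- lie_bracket reebf \<gamma>) + fscale (\<lambda>p. reebf p ?k) (- \<gamma>))"
    using VF h k by (simp add: bracket_add_right bracket_fscale_right bracket_minus_right)
  have "solve reebf ((1/2) *\<^sub>R lie_bracket reebf (lie_bracket (fscale h \<gamma>) reebf)) = solve reebf ?Y"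
  proof (rule solve_eqI)
    fix p
    have "((1/2) *\<^sub>R lie_bracket reebf (lie_bracket (fscale h \<gamma>) reebf)) p - ?Y p = (- (1/2) * reebf p ?k) *\<^sub>R \<gamma> p"
      unfolding e1 e2
      using half_combination[of "h p" "lie_bracket reebf ?W p" "?k p" "?W p" "reebf p ?k" "\<gamma> p"]
        bracket_skew_at[of \<gamma> reebf p] by (simp only: fscale_apply plus_fun_apply scaleR_fun_apply uminus_apply)
    also have "\<dots> \<in> D2 p"
      using sectionsD(2)[OF GH_G2[OF c]] by (rule subspace_scale[OF subspace_D2])
    finally show "((1/2) *\<^sub>R lie_bracket reebf (lie_bracket (fscale h \<gamma>) reebf)) p - ?Y p \<in> D2 p" .
  qed (use c h k in auto)
  also have "\<dots> = fscale h (solve reebf ((1/2) *\<^sub>R lie_bracket reebf ?W)) + fscale ?k \<gamma>"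
    using VF c h k by (simp add: solve_add[OF normalized_reeb] solve_fscale[OF normalized_reeb] solve_bracket[OF normalized_reeb])
  finally show ?thesis using c h by (simp add: Psi_eq)
qed

section \<open>The projection to \<open>H\<close>\<close>

abbreviation "proj \<equiv> proj1 A H \<alpha>"

lemma proj_eq: "\<zeta> \<in> VF \<Longrightarrow>
  proj \<zeta> = (- 2/5) *\<^sub>R Phi A H \<alpha> (comp1 \<zeta>) + (7/5) *\<^sub>R Psi A H \<alpha> (comp1 \<zeta>) + comp2 \<zeta>"
  unfolding proj1_def by (simp add: decomposition_eq)

lemma proj_GH [simp, intro]: "\<zeta> \<in> VF \<Longrightarrow> proj \<zeta> \<in> GH"
  unfolding proj_eq using Phi_GH[OF comp1_GH] Psi_GH[OF comp1_GH] by blast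

lemma proj_add: "X \<in> VF \<Longrightarrow> Y \<in> VF \<Longrightarrow> proj (X + Y) = proj X + proj Y"
  by (simp add: proj_eq comp1_add comp2_add Phi_add Psi_add algebra_simps)

text \<open>The coefficients of \<open>\<Phi>\<close> and \<open>\<Psi>\<close> add up to \<open>1\<close>, which cancels the derivative of \<open>h\<close> in \<open>\<zeta>\<^sub>2\<close>.\<close>

lemma proj_fscale:
  assumes "X \<in> VF" "h \<in> S"
  shows "proj (fscale h X) = fscale h (proj X)"
proof
  fix p
  show "proj (fscale h X) p = fscale h (proj X) p"
    using assms
    by (simp add: proj_eq comp1_fscale comp2_fscale Phi_fscale Psi_fscale algebra_simps flip: scaleR_add_left)
qed

lemma Phi_zero: "Phi A H \<alpha> 0 = 0" and Psi_zero: "Psi A H \<alpha> 0 = 0"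
  using Phi_add[of 0 0] Psi_add[of 0 0] by simp_all

lemma proj_H: "\<xi> \<in> GH \<Longrightarrow> proj \<xi> = \<xi>"
  by (simp add: proj_eq comp_GH Phi_zero Psi_zero)

lemma proj_reeb: "proj reebf = 0"
  by (simp add: proj_eq comp_reeb Phi_zero Psi_zero)

lemma g_alpha_eq:
  assumes "X \<in> VF" "Y \<in> VF"
  shows "g_alpha A H \<alpha> X Y p = - \<alpha> p (lie_bracket (comp1 X) (proj Y) p)
    - 4/3 * \<omega> p (X p) * \<omega> p (Y p) - \<alpha> p (lie_bracket (comp1 Y) (proj X) p)"
  unfolding g_alpha_def Let_def using assms by (simp add: decomposition_eq ext_deriv_GH)

end

section \<open>The metric\<close>

lemma linear_over_sum:
  assumes f: "linear_over V f" and V: "subspace V" and x: "\<And>i. i \<in> I \<Longrightarrow> x i \<in> V"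
  shows "f (\<Sum>i\<in>I. u i *\<^sub>R x i) = (\<Sum>i\<in>I. u i *\<^sub>R f (x i))"
  using x
proof (induction I rule: infinite_finite_induct)
  case (insert i I)
  have "(\<Sum>i\<in>I. u i *\<^sub>R x i) \<in> V"
    using insert.prems by (intro subspace_sum[OF V] subspace_scale[OF V]) auto
  then have "f (u i *\<^sub>R x i + 1 *\<^sub>R (\<Sum>i\<in>I. u i *\<^sub>R x i)) = u i *\<^sub>R f (x i) + 1 *\<^sub>R f (\<Sum>i\<in>I. u i *\<^sub>R x i)"
    using insert.prems by (intro linear_overD[OF f]) auto
  then show ?case using insert by simp
qed (use linear_overD[OF f subspace_0[OF V] subspace_0[OF V], of 0 0] in simp_all)

text \<open>Orthonormality gives independence, and counting against \<open>B\<close> gives the span: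
  a vector outside it would produce \<open>m + n + 1\<close> independent vectors in the span of at
  most \<open>m + n\<close>.\<close>

lemma orthonormal_basisI:
  fixes b :: "'v::real_vector \<Rightarrow> 'v \<Rightarrow> real"
  assumes V: "subspace V" and B: "V \<subseteq> span B" "finite B" "card B \<le> m + n"
    and lin: "\<And>v. v \<in> V \<Longrightarrow> linear_over V (b v)"
    and eV: "\<And>i. i < m + n \<Longrightarrow> e i \<in> V"
    and orth: "\<And>i j. i < m + n \<Longrightarrow> j < m + n \<Longrightarrow> b (e i) (e j) = (if i \<noteq> j then 0 else if i < m then 1 else -1)"
  shows "orthonormal_basis V b m n e"
proof -
  have inj: "inj_on e {..<m+n}"
  proof (rule inj_onI)
    fix i j assume "i \<in> {..<m+n}" "j \<in> {..<m+n}" "e i = e j"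
    then show "i = j" using orth[of i i] orth[of i j] by (auto split: if_splits)
  qed
  have indep: "independent (e ` {..<m+n})"
    unfolding dependent_finite[OF finite_imageI[OF finite_lessThan]]
  proof clarify
    fix u v i assume s: "(\<Sum>v\<in>e ` {..<m+n}. u v *\<^sub>R v) = 0" and i: "i < m + n" "u (e i) \<noteq> 0"
    have "0 = (\<Sum>j<m+n. u (e j) *\<^sub>R e j)" using s by (simp add: sum.reindex[OF inj])
    then have "b (e i) 0 = (\<Sum>j<m+n. u (e j) *\<^sub>R b (e i) (e j))"
      using linear_over_sum[OF lin[OF eV[OF i(1)]] V, of "{..<m+n}" e "\<lambda>j. u (e j)"] eV by simp
    also have "\<dots> = (\<Sum>j<m+n. if j = i then u (e i) * b (e i) (e i) else 0)"
      using i orth by (intro sum.cong) auto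
    also have "\<dots> = u (e i) * b (e i) (e i)" using i by simp
    also have "b (e i) 0 = 0"
      using linear_overD[OF lin[OF eV[OF i(1)]] subspace_0[OF V] subspace_0[OF V], of 0 0] by simp
    finally show False using i orth[of i i] by (auto split: if_splits)
  qed
  have "V \<subseteq> span (e ` {..<m+n})"
  proof
    fix v assume v: "v \<in> V"
    show "v \<in> span (e ` {..<m+n})"
    proof (rule ccontr)
      assume *: "v \<notin> span (e ` {..<m+n})"
      then have "independent (insert v (e ` {..<m+n}))" using indep by (simp add: independent_insertI)
      moreover have "insert v (e ` {..<m+n}) \<subseteq> span B" using v eV B(1) by auto
      ultimately have "card (insert v (e ` {..<m+n})) \<le> card B"
        using independent_span_bound[OF B(2)] by blast
      moreover have "card (insert v (e ` {..<m+n})) = Suc (m + n)"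
      proof (subst card_insert_disjoint)
        show "v \<notin> e ` {..<m+n}" using * span_base[of v "e ` {..<m+n}"] by blast
        show "Suc (card (e ` {..<m+n})) = Suc (m + n)" using card_image[OF inj] by simp
      qed simp
      ultimately show False using B(3) by simp
    qed
  qed
  moreover have "span (e ` {..<m+n}) \<subseteq> V" using eV by (intro span_minimal V) auto
  ultimately show ?thesis unfolding orthonormal_basis_def using inj indep orth by auto
qed

text \<open>Pairing with \<open>e i\<close> isolates the \<open>i\<close>-th coefficient of
  \<open>v\<close> up to sign.\<close>

lemma orthonormal_basis_nondegenerate:
  assumes ob: "orthonormal_basis V b m n e"
    and lin: "\<And>v. v \<in> V \<Longrightarrow> linear_over V (b v)" and sym: "\<And>v w. v \<in> V \<Longrightarrow> w \<in> V \<Longrightarrow> b v w = b w v"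
    and v: "v \<in> V" "v \<noteq> 0"
  shows "\<exists>w\<in>V. b v w \<noteq> 0"
proof -
  have inj: "inj_on e {..<m+n}" and V: "V = span (e ` {..<m+n})"
    and orth: "\<And>i j. i < m + n \<Longrightarrow> j < m + n \<Longrightarrow> b (e i) (e j) = (if i \<noteq> j then 0 else if i < m then 1 else -1)"
    using ob unfolding orthonormal_basis_def by auto
  have sV: "subspace V" unfolding V by (rule subspace_span)
  have eV: "e i \<in> V" if "i < m + n" for i unfolding V using that by (auto intro: span_base)
  obtain u where "v = (\<Sum>w\<in>e ` {..<m+n}. u w *\<^sub>R w)"
    using v(1) unfolding V span_finite[OF finite_imageI[OF finite_lessThan]] by blast
  then have v': "v = (\<Sum>j<m+n. u (e j) *\<^sub>R e j)" by (simp add: sum.reindex[OF inj])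
  obtain i where i: "i < m + n" "u (e i) \<noteq> 0"
    using v(2) v' by (metis (no_types, lifting) lessThan_iff scaleR_zero_left sum.neutral)
  have "b v (e i) = b (e i) v" by (rule sym[OF v(1) eV[OF i(1)]])
  also have "\<dots> = (\<Sum>j<m+n. u (e j) *\<^sub>R b (e i) (e j))"
    unfolding v' using eV by (intro linear_over_sum[OF lin[OF eV[OF i(1)]] sV]) auto
  also have "\<dots> = (\<Sum>j<m+n. if j = i then u (e i) * b (e i) (e i) else 0)"
    using i orth by (intro sum.cong) auto
  also have "\<dots> = u (e i) * b (e i) (e i)" using i by simp
  finally have "b v (e i) \<noteq> 0" using i orth[of i i] by auto
  then show ?thesis using eV[OF i(1)] by blast
qed

context contact_distribution
begin

abbreviation "g \<equiv> g_alpha A H \<alpha>"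

section \<open>Pointwise values of the metric\<close>

lemma vector_fields_eq_sections: "VF = sections A T"
  unfolding sections_def using vector_fieldsD(1) by auto

text \<open>Near \<open>p\<close> a field equals its frame expansion, to which tensoriality applies
  term by term; the resulting formula involves the field only through its value at
  \<open>p\<close>.\<close>

lemma tensorial_value:
  fixes F :: "'a vfield \<Rightarrow> 'a \<Rightarrow> 'b::real_vector"
  assumes t: "tensorial VF F" and X: "X \<in> VF" and Y: "Y \<in> VF" and eq: "X p = Y p"
  shows "F X p = F Y p"
proof -
  obtain e \<theta> where fr: "adapted_frame p e \<theta>" by (rule reeb_frame)
  have eVF: "e i \<in> VF" if "i < 5" for i by (rule adapted_frame_fields[OF fr that])
  have expand: "F Z p = (\<Sum>i<5. \<theta> i p (Z p) *\<^sub>R F (e i) p)" if Z: "Z \<in> VF" for Z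
  proof -
    have sm: "(\<lambda>q. \<theta> i q (Z q)) \<in> S" if "i < 5" for i
      by (rule lformsD(2)[OF adapted_frame_forms[OF fr that] Z])
    let ?Z = "\<lambda>i. fscale (\<lambda>q. \<theta> i q (Z q)) (e i)"
    have ZVF: "?Z i \<in> VF" if "i < 5" for i using sm[OF that] eVF[OF that] by blast
    have "\<forall>\<^sub>F q in nhds p. Z q = (\<Sum>i<5. ?Z i) q"
      using adapted_frame_eventually[OF fr]
    proof eventually_elim
      case (elim q)
      show ?case using adapted_frame_expansion[OF elim vector_fieldsD(1)[OF Z]] by (simp add: sum_fun_apply)
    qed
    moreover have "(\<Sum>i<5. ?Z i) \<in> VF" using ZVF by (intro vector_fields_sum) auto
    ultimately have "F Z p = F (\<Sum>i<5. ?Z i) p"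
      using tensorial_local[of T F Z "\<Sum>i<5. ?Z i" p] t Z subspace_tangent_space
      unfolding vector_fields_eq_sections[symmetric] by blast
    also have "(\<Sum>i<5. ?Z i) = ?Z 0 + (?Z 1 + (?Z 2 + (?Z 3 + ?Z 4)))"
      by (simp add: lessThan_2_3_5)
    also have "F \<dots> p = (\<Sum>i<5. F (?Z i) p)"
      using ZVF by (simp add: tensorialD(1)[OF t] vector_fields_add lessThan_2_3_5)
    also have "\<dots> = (\<Sum>i<5. \<theta> i p (Z p) *\<^sub>R F (e i) p)"
      using sm eVF by (intro sum.cong refl) (simp add: tensorialD(2)[OF t])
    finally show ?thesis .
  qed
  show ?thesis unfolding expand[OF X] expand[OF Y] eq ..
qed

lemma g_symmetric: "X \<in> VF \<Longrightarrow> Y \<in> VF \<Longrightarrow> g X Y p = g Y X p"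
  by (simp add: g_alpha_eq)

lemma contact_bracket_skew:
  assumes "\<xi> \<in> GH" "\<eta> \<in> GH"
  shows "\<alpha> p (lie_bracket \<xi> \<eta> p) = - \<alpha> p (lie_bracket \<eta> \<xi> p)"
proof -
  obtain e \<theta> where F: "adapted_frame p e \<theta>" by (rule reeb_frame)
  show ?thesis using adapted_frame_levi_form[OF F assms] adapted_frame_levi_form[OF F assms(2,1)] by simp
qed

text \<open>The operators \<open>comp1\<close>, \<open>\<omega>\<close> and \<open>proj\<close> are
  tensorial, and so is \<open>\<alpha>([\<xi>, \<eta>])\<close> on \<open>H\<close>. The component
  \<open>comp2\<close> is not, which is why the metric is built with the projection.\<close>

lemma g_tensorial:
  assumes Y: "Y \<in> VF"
  shows "tensorial VF (\<lambda>X. g X Y)"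
proof (rule tensorialI)
  fix X X' p assume X: "X \<in> VF" "X' \<in> VF"
  have "\<omega> p ((X + X') p) = \<omega> p (X p) + \<omega> p (X' p)"
    using omega_add[OF vector_fieldsD(1)[OF X(1)] vector_fieldsD(1)[OF X(2)]] by simp
  moreover have "\<alpha> p (lie_bracket (comp1 Y) (proj X + proj X') p) =
      \<alpha> p (lie_bracket (comp1 Y) (proj X) p) + \<alpha> p (lie_bracket (comp1 Y) (proj X') p)"
    using contact_bracket_add[OF proj_GH[OF X(1)] proj_GH[OF X(2)] comp1_GH[OF Y]]
      contact_bracket_skew[OF comp1_GH[OF Y]] X by (simp add: proj_GH)
  ultimately show "g (X + X') Y p = g X Y p + g X' Y p"
    using X Y contact_bracket_add[OF comp1_GH[OF X(1)] comp1_GH[OF X(2)] proj_GH[OF Y]]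
    by (simp add: g_alpha_eq proj_add comp1_add algebra_simps)
next
  fix h X p assume h: "h \<in> S" and X: "X \<in> VF"
  have "\<omega> p (fscale h X p) = h p * \<omega> p (X p)"
    using omega_scale[OF vector_fieldsD(1)[OF X] vector_fieldsD(1)[OF X]] by simp
  moreover have "\<alpha> p (lie_bracket (comp1 Y) (fscale h (proj X)) p) = h p * \<alpha> p (lie_bracket (comp1 Y) (proj X) p)"
    using contact_bracket_fscale[OF proj_GH[OF X] comp1_GH[OF Y] h]
      contact_bracket_skew[OF comp1_GH[OF Y]] X h by (simp add: proj_GH)
  ultimately show "g (fscale h X) Y p = h p *\<^sub>R g X Y p"
    using X Y h contact_bracket_fscale[OF comp1_GH[OF X] proj_GH[OF Y] h]
    by (simp add: g_alpha_eq proj_fscale comp1_fscale algebra_simps)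
qed

lemma g_smooth:
  assumes "X \<in> VF" "Y \<in> VF"
  shows "g X Y \<in> S"
proof -
  have B: "(\<lambda>p. \<alpha> p (lie_bracket \<xi> \<eta> p)) \<in> S" if "\<xi> \<in> GH" "\<eta> \<in> GH" for \<xi> \<eta>
    by (rule contact_smooth[OF GH_bracket_G2[OF that]])
  have "g X Y = (\<lambda>p. - \<alpha> p (lie_bracket (comp1 X) (proj Y) p)
    - 4/3 * \<omega> p (X p) * \<omega> p (Y p) - \<alpha> p (lie_bracket (comp1 Y) (proj X) p))"
    using assms by (simp add: g_alpha_eq fun_eq_iff)
  also have "\<dots> \<in> S"
    by (intro smooth_funs_diff smooth_funs_minus smooth_funs_mult smooth_funs_const B omega_smooth
        comp1_GH proj_GH assms)
  finally show ?thesis .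
qed

definition extend :: "'a \<Rightarrow> 'a tvec \<Rightarrow> 'a vfield" where
  "extend p v = (SOME X. X \<in> VF \<and> X p = v)"

lemma extend:
  assumes v: "v \<in> T p"
  shows extend_VF: "extend p v \<in> VF" and extend_value: "extend p v p = v"
proof -
  obtain e \<theta> where F: "adapted_frame p e \<theta>" by (rule reeb_frame)
  let ?X = "\<Sum>i<5. \<theta> i p v *\<^sub>R e i"
  have "?X \<in> VF" using adapted_frame_fields[OF F] by (intro vector_fields_sum vector_fields_scaleR) auto
  moreover have "?X p = v" using adapted_frame_expansion[OF F v] by (simp add: sum_fun_apply)
  ultimately have "extend p v \<in> VF \<and> extend p v p = v"
    unfolding extend_def by (intro someI[of "\<lambda>X. X \<in> VF \<and> X p = v" ?X]) blast
  then show "extend p v \<in> VF" "extend p v p = v" by blast+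
qed

text \<open>The two vectors are extended by an arbitrary choice; \<open>metric_value\<close> shows
  that the choice does not matter.\<close>

definition metric :: "'a \<Rightarrow> 'a tvec \<Rightarrow> 'a tvec \<Rightarrow> real" where
  "metric p v w = g (extend p v) (extend p w) p"

text \<open>Tensoriality is proved in the first argument; symmetry carries it over to the
  second.\<close>

lemma metric_value:
  assumes "X \<in> VF" "Y \<in> VF"
  shows "metric p (X p) (Y p) = g X Y p"
proof -
  have XT: "X p \<in> T p" "Y p \<in> T p" using assms vector_fieldsD(1) by blast+
  note eX = extend[OF XT(1)] and eY = extend[OF XT(2)]
  have "metric p (X p) (Y p) = g X (extend p (Y p)) p"
    unfolding metric_def by (rule tensorial_value[OF g_tensorial[OF eY(1)] eX(1) assms(1) eX(2)])
  also have "\<dots> = g (extend p (Y p)) X p" by (rule g_symmetric[OF assms(1) eY(1)])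
  also have "\<dots> = g Y X p"
    by (rule tensorial_value[OF g_tensorial[OF assms(1)] eY(1) assms(2) eY(2)])
  finally show ?thesis using g_symmetric assms by simp
qed

lemma metric_linear:
  assumes v: "v \<in> T p"
  shows "linear_over (T p) (metric p v)"
  unfolding linear_over_def
proof (intro ballI allI)
  fix w w' a b assume w: "w \<in> T p" "w' \<in> T p"
  obtain X Y Y' where X: "X \<in> VF" "X p = v" and Y: "Y \<in> VF" "Y p = w" and Y': "Y' \<in> VF" "Y' p = w'"
    using extend[OF v] extend[OF w(1)] extend[OF w(2)] by blast
  let ?Z = "fscale (\<lambda>q. a) Y + fscale (\<lambda>q. b) Y'"
  have Z: "?Z \<in> VF" using Y Y' by blast
  have "metric p v (a *\<^sub>R w + b *\<^sub>R w') = metric p (X p) (?Z p)" using X Y Y' by simp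
  also have "\<dots> = g ?Z X p" unfolding metric_value[OF X(1) Z] by (rule g_symmetric[OF X(1) Z])
  also have "\<dots> = a *\<^sub>R g Y X p + b *\<^sub>R g Y' X p"
    using Y Y' tensorialD[OF g_tensorial[OF X(1)]] by simp
  also have "g Y X p = metric p v w" using metric_value[OF X(1) Y(1), of p] g_symmetric[OF X(1) Y(1), of p] X Y by simp
  also have "g Y' X p = metric p v w'" using metric_value[OF X(1) Y'(1), of p] g_symmetric[OF X(1) Y'(1), of p] X Y' by simp
  finally show "metric p v (a *\<^sub>R w + b *\<^sub>R w') = a *\<^sub>R metric p v w + b *\<^sub>R metric p v w'" .
qed

lemma metric_symmetric:
  assumes "v \<in> T p" "w \<in> T p"
  shows "metric p v w = metric p w v"
  unfolding metric_def by (rule g_symmetric[OF extend_VF[OF assms(1)] extend_VF[OF assms(2)]])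

text \<open>The vector field with components \<open>\<zeta>\<^sub>1 = \<xi>\<close>, \<open>\<alpha>(\<zeta>) = s\<close> and \<open>\<pi>\<^sub>-\<^sub>1(\<zeta>) = \<eta>\<close>: these three
  identify the tangent space with \<open>H \<oplus> \<real> \<oplus> H\<close>.\<close>

definition with_components :: "'a vfield \<Rightarrow> real \<Rightarrow> 'a vfield \<Rightarrow> 'a vfield" where
  "with_components \<xi> s \<eta> = lie_bracket reebf \<xi> + (fscale (\<lambda>q. s) reebf + (\<eta> - proj (lie_bracket reebf \<xi>)))"

lemma with_components:
  assumes x: "\<xi> \<in> GH" and y: "\<eta> \<in> GH"
  shows "with_components \<xi> s \<eta> \<in> VF" "comp1 (with_components \<xi> s \<eta>) = \<xi>"
    "\<omega> p (with_components \<xi> s \<eta> p) = s" "proj (with_components \<xi> s \<eta>) = \<eta>"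
proof -
  let ?B = "lie_bracket reebf \<xi>" and ?R = "fscale (\<lambda>q. s) reebf"
  let ?K = "\<eta> - proj ?B"
  have B: "?B \<in> VF" using x by blast
  have K: "?K \<in> GH" using y B by blast
  have R: "?R \<in> VF" by blast
  have RK: "?R + ?K \<in> VF" using R K by blast
  show "with_components \<xi> s \<eta> \<in> VF" unfolding with_components_def using B RK by blast
  show "comp1 (with_components \<xi> s \<eta>) = \<xi>"
    unfolding with_components_def
    using comp1_add[OF B RK] comp1_add[OF R GH_VF[OF K]] comp_reeb_bracket(1)[OF x]
      comp1_fscale[OF reeb_section(2) smooth_funs_const, of s] comp_reeb(1) comp_GH(1)[OF K]
    by (simp add: fun_eq_iff)
  show "proj (with_components \<xi> s \<eta>) = \<eta>"
    unfolding with_components_def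
    using proj_add[OF B RK] proj_add[OF R GH_VF[OF K]] proj_H[OF K] proj_reeb
      proj_fscale[OF reeb_section(2) smooth_funs_const, of s]
    by (simp add: fun_eq_iff)
  have T: "?B p \<in> T p" "?R p \<in> T p" "?K p \<in> T p" "(?R + ?K) p \<in> T p" "reebf p \<in> T p"
    using B R GH_VF[OF K] RK reeb_section(2) vector_fieldsD(1) by blast+
  have "\<omega> p (with_components \<xi> s \<eta> p) = \<omega> p (?B p) + (\<omega> p (?R p) + \<omega> p (?K p))"
    unfolding with_components_def
    using omega_add[OF T(1,4)] omega_add[OF T(2,3)] by simp
  then show "\<omega> p (with_components \<xi> s \<eta> p) = s"
    using canonical_extension_reeb_bracket[OF x] omega_GH[OF K] omega_scale[OF T(5,5), of s] by simp
qed

section \<open>The signature of the metric\<close>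

lemma metric_with_components:
  assumes "\<xi> \<in> GH" "\<eta> \<in> GH" "\<xi>' \<in> GH" "\<eta>' \<in> GH"
  shows "metric p (with_components \<xi> s \<eta> p) (with_components \<xi>' s' \<eta>' p) =
    - \<alpha> p (lie_bracket \<xi> \<eta>' p) - 4/3 * s * s' - \<alpha> p (lie_bracket \<xi>' \<eta> p)"
  unfolding metric_value[OF with_components(1)[OF assms(1,2)] with_components(1)[OF assms(3,4)]]
  using with_components[OF assms(1,2)] with_components[OF assms(3,4)] by (simp add: g_alpha_eq)

text \<open>Both copies of \<open>H\<close> are isotropic, so the vector with components
  \<open>(\<xi>, 0, \<eta>)\<close> has square \<open>- 2 \<sigma>(\<xi>, \<eta>)\<close>. Combining
  each frame vector with half of its symplectic partner, with either sign, gives two squares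
  \<open>1\<close> and two squares \<open>-1\<close>.\<close>

lemma metric_orthonormal_basis: "\<exists>b. orthonormal_basis (T p) (metric p) 2 3 b"
proof -
  obtain e \<theta> where F: "adapted_frame p e \<theta>" by (rule reeb_frame)
  note fr = adapted_frameD[OF F]
  define x where "x i = (if i = 0 \<or> i = 2 then e 0 else if i = 1 \<or> i = 3 then e 1 else 0)" for i :: nat
  \<comment> \<open>With \<open>\<sigma>(e 0, e 1) = 1\<close>, the partners
    \<open>- e 1 / 2\<close> of \<open>e 0\<close> and \<open>e 0 / 2\<close> of \<open>e 1\<close>
    give square \<open>1\<close>, their negatives give \<open>-1\<close>.\<close>
  define y where "y i = (if i = 0 then (-1/2) *\<^sub>R e 1 else if i = 1 then (1/2) *\<^sub>R e 0
    else if i = 2 then (1/2) *\<^sub>R e 1 else if i = 3 then (-1/2) *\<^sub>R e 0 else 0)" for i :: nat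
  \<comment> \<open>The square of \<open>sqrt 3 / 2\<close> is \<open>3/4\<close>, so the factor
    \<open>- 4/3\<close> turns it into \<open>-1\<close>.\<close>
  define s where "s i = (if i = 4 then sqrt 3 / 2 else 0)" for i :: nat
  have xy: "x i \<in> GH" "y i \<in> GH" for i unfolding x_def y_def using fr by auto
  define b where "b i = with_components (x i) (s i) (y i) p" for i
  have lin: "linear (\<theta> 0 p)" "linear (\<theta> 1 p)" by (rule adapted_frame_linear[OF F], simp)+
  have val: "metric p (b i) (b j) = - (\<theta> 0 p (x i p) * \<theta> 1 p (y j p) - \<theta> 1 p (x i p) * \<theta> 0 p (y j p))
      - 4/3 * s i * s j - (\<theta> 0 p (x j p) * \<theta> 1 p (y i p) - \<theta> 1 p (x j p) * \<theta> 0 p (y i p))" for i j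
    unfolding b_def metric_with_components[OF xy xy] adapted_frame_levi_form[OF F xy] ..
  have tx: "\<theta> 0 p (x i p) = (if i = 0 \<or> i = 2 then 1 else 0)" "\<theta> 1 p (x i p) = (if i = 1 \<or> i = 3 then 1 else 0)" for i
    by (simp_all add: x_def adapted_frame_dual[OF F] linear_0[OF lin(1)] linear_0[OF lin(2)])
  have ty: "\<theta> 0 p (y i p) = (if i = 1 then 1/2 else if i = 3 then -1/2 else 0)"
    "\<theta> 1 p (y i p) = (if i = 0 then -1/2 else if i = 2 then 1/2 else 0)" for i
    by (simp_all add: y_def adapted_frame_dual[OF F] linear_0[OF lin(1)] linear_0[OF lin(2)]
        linear_scale[OF lin(1)] linear_scale[OF lin(2)] linear_neg[OF lin(1)] linear_neg[OF lin(2)])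
  have orth: "metric p (b i) (b j) = (if i \<noteq> j then 0 else if i < 2 then 1 else -1)"
    if "i < 2 + 3" "j < 2 + 3" for i j
  proof -
    have "i < 5" "j < 5" using that by auto
    then show ?thesis
      unfolding val tx ty s_def less_5_cases by (elim disjE) (simp_all add: field_simps)
  qed
  have "orthonormal_basis (T p) (metric p) 2 3 b"
  proof (rule orthonormal_basisI[OF subspace_tangent_space])
    show "T p \<subseteq> span ((\<lambda>i. e i p) ` {..<5})"
      using adapted_frame_at[OF F] unfolding adapted_at_def by blast
    show "card ((\<lambda>i. e i p) ` {..<5::nat}) \<le> 2 + 3"
      using card_image_le[of "{..<5::nat}" "\<lambda>i. e i p"] by simp
    show "b i \<in> T p" for i
      unfolding b_def by (rule vector_fieldsD(1)[OF with_components(1)[OF xy]])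
  qed (use metric_linear orth in auto)
  then show ?thesis by blast
qed

text \<open>Nondegeneracy is read off from the orthonormal basis.\<close>

lemma metric_tensor: "metric_tensor A 2 3 metric"
  unfolding metric_tensor_def
proof (intro conjI allI ballI impI)
  fix p v assume v: "v \<in> T p"
  show "linear_over (T p) (metric p v)" by (rule metric_linear[OF v])
  show "metric p v w = metric p w v" if "w \<in> T p" for w by (rule metric_symmetric[OF v that])
  assume "v \<noteq> 0"
  obtain b where "orthonormal_basis (T p) (metric p) 2 3 b" using metric_orthonormal_basis by blast
  then show "\<exists>w\<in>T p. metric p v w \<noteq> 0"
    by (rule orthonormal_basis_nondegenerate[OF _ metric_linear metric_symmetric v \<open>v \<noteq> 0\<close>])
next
  fix X Y assume "X \<in> VF" "Y \<in> VF"
  then show "(\<lambda>p. metric p (X p) (Y p)) \<in> S" using g_smooth by (simp add: metric_value)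
qed (rule metric_orthonormal_basis)

lemma pseudo_riemannian_metric_g_alpha: "pseudo_riemannian_metric A 2 3 g"
  unfolding pseudo_riemannian_metric_def
  by (intro exI[of _ metric] conjI metric_tensor ballI ext) (simp add: metric_value)

end

theorem proposition4:
  fixes A :: "('a::{t2_space, second_countable_topology}, real^5) chart set"
    and H :: "'a \<Rightarrow> 'a tvec set"
    and \<alpha> :: "'a \<Rightarrow> 'a tvec \<Rightarrow> real"
  assumes "smooth_atlas A"
    and "generic_distribution A H"
    and "generalized_contact_form A H \<alpha>"
  shows "pseudo_riemannian_metric A 2 3 (g_alpha A H \<alpha>)"
proof -
  interpret contact_distribution A H \<alpha>
    using assms by unfold_locales
  show ?thesis by (rule pseudo_riemannian_metric_g_alpha)
qed

end
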